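(* Let $d\in\mathbb{N}$, $1<p\le2$, $a>1/p$, $b\in\mathbb{R}$. There exist constants $c_0$, $c=c(a,d,p)$ and $C=C(a,b,d,p)$ such that for every $v\in\mathbb{N}$ there is $M$ with $|\Gamma(M)|\le v^{c_0}$ such that, with $\Phi_N:=\{e^{i(\mathbf{k},\mathbf{x})}\}_{\mathbf{k}\in\Gamma(M)}$, $$\varrho^{ls}_{m,v}(\mathbf{W}^{a,b}_p,\Phi_N,L_2(\mathbb{T}^d))\le C\,v^{-a+1/p-1/2}(\log v)^{(d-1)(a+b+1-2/p)+1/2}$$ for any $m\ge c\,v(\log(2v))^4$.
   Context: $\mathbb{T}^d=[0,2\pi)^d$ with normalized Lebesgue measure, $\|f\|_q=((2\pi)^{-d}\int_{\mathbb{T}^d}|f|^q)^{1/q}$, $\hat f(\mathbf{k})=(2\pi)^{-d}\int f(\mathbf{x})e^{-i(\mathbf{k},\mathbf{x})}d\mathbf{x}$. $\Gamma(M)=\{\mathbf{k}\in\mathbb{Z}^d:\prod_j\max(|k_j|,1)\le M\}$. For $\mathbf{s}\in\mathbb{N}_0^d$, $\rho(\mathbf{s})=\{\mathbf{k}\in\mathbb{Z}^d:[2^{s_j-1}]\le|k_j|<2^{s_j}\}$, $\delta_{\mathbf{s}}(f)=\sum_{\mathbf{k}\in\rho(\mathbf{s})}\hat f(\mathbf{k})e^{i(\mathbf{k},\cdot)}$, $f_j=\sum_{\|\mathbf{s}\|_1=j}\delta_{\mathbf{s}}(f)$. $\mathbf{W}^{a,b}_p:=\{f:\|f_j\|_p\le2^{-aj}\bar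 j^{(d-1)b},\ \bar j=\max(j,1),\ j\in\mathbb{N}_0\}$. $\mathcal{X}_v(\Phi_N)$ is the collection of spans of $v$-element subsets of $\Phi_N$; $LS(\xi,L)(f)$ is an element $u\in L$ minimizing $\frac1m\sum_j|f(\xi^j)-u(\xi^j)|^2$; $\varrho^{ls}_{m,v}(\mathbf{F},\Phi_N,L_2(\mathbb{T}^d)):=\inf_{\xi\in(\mathbb{T}^d)^m}\sup_{f\in\mathbf{F}}\min_{L\in\mathcal{X}_v(\Phi_N)}\|f-LS(\xi,L)(f)\|_2$.
   Formalization: The bound is stated for v ≥ 2, since at v = 1 log v = 0 and the right side vanishes (or is undefined) while the error is positive; functions in the class are taken as their continuous 2π-periodic representatives so that point values make sense. *)

theory Defs
  imports "HOL-Analysis.Analysis"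
begin

text \<open>The torus is modelled by the fundamental domain [0,2pi)^d inside real^'d,
  with d = CARD('d). Frequencies are integer vectors 'd => int.\<close>

definition torus :: "(real^'d) set" where
  "torus = {x. \<forall>i. 0 \<le> x $ i \<and> x $ i < 2 * pi}"

definition kdot :: "('d::finite \<Rightarrow> int) \<Rightarrow> real^'d \<Rightarrow> real" where
  "kdot k x = (\<Sum>i\<in>UNIV. of_int (k i) * x $ i)"

definition expk :: "('d::finite \<Rightarrow> int) \<Rightarrow> real^'d \<Rightarrow> complex" where
  "expk k x = cis (kdot k x)"

definition Lq_norm :: "real \<Rightarrow> (real^'d::finite \<Rightarrow> complex) \<Rightarrow> real" where
  "Lq_norm q f = ((1 / (2 * pi) ^ CARD('d)) *
       set_lebesgue_integral lborel torus (\<lambda>x. norm (f x) powr q)) powr (1 / q)"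

definition fourier_coeff :: "(real^'d::finite \<Rightarrow> complex) \<Rightarrow> ('d \<Rightarrow> int) \<Rightarrow> complex" where
  "fourier_coeff f k = complex_of_real (1 / (2 * pi) ^ CARD('d)) *
       set_lebesgue_integral lborel torus (\<lambda>x. f x * cis (- kdot k x))"

definition periodic_cont :: "(real^'d::finite \<Rightarrow> complex) \<Rightarrow> bool" where
  "periodic_cont f \<longleftrightarrow> continuous_on UNIV f \<and>
     (\<forall>x i. f (x + (2 * pi) *\<^sub>R axis i 1) = f x)"

definition hyp_cross :: "real \<Rightarrow> ('d::finite \<Rightarrow> int) set" where
  "hyp_cross M = {k. (\<Prod>j\<in>UNIV. real_of_int (max \<bar>k j\<bar> 1)) \<le> M}"

definition dyadic_block :: "('d::finite \<Rightarrow> nat) \<Rightarrow> ('d \<Rightarrow> int) set" where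
  "dyadic_block s = {k. \<forall>j. \<lfloor>2 powr (real (s j) - 1)\<rfloor> \<le> \<bar>k j\<bar> \<and> \<bar>k j\<bar> < 2 ^ s j}"

definition delta_s :: "('d::finite \<Rightarrow> nat) \<Rightarrow> (real^'d \<Rightarrow> complex) \<Rightarrow> real^'d \<Rightarrow> complex" where
  "delta_s s f x = (\<Sum>k\<in>dyadic_block s. fourier_coeff f k * expk k x)"

definition f_block :: "nat \<Rightarrow> (real^'d::finite \<Rightarrow> complex) \<Rightarrow> real^'d \<Rightarrow> complex" where
  "f_block j f x = (\<Sum>s\<in>{s :: 'd \<Rightarrow> nat. sum s UNIV = j}. delta_s s f x)"

definition W_class :: "real \<Rightarrow> real \<Rightarrow> real \<Rightarrow> (real^'d::finite \<Rightarrow> complex) set" where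
  "W_class a b p = {f. periodic_cont f \<and>
     (\<forall>j::nat. Lq_norm p (f_block j f) \<le>
        2 powr (- a * real j) * real (max j 1) powr ((real CARD('d) - 1) * b))}"

definition trig_span :: "('d::finite \<Rightarrow> int) set \<Rightarrow> (real^'d \<Rightarrow> complex) set" where
  "trig_span K = {u. \<exists>c. u = (\<lambda>x. \<Sum>k\<in>K. c k * expk k x)}"

text \<open>X_v(Phi_N), Phi_N = exponentials with frequencies in Gamma(M), as index sets.\<close>
definition X_v :: "nat \<Rightarrow> ('d::finite \<Rightarrow> int) set \<Rightarrow> ('d \<Rightarrow> int) set set" where
  "X_v v G = {K. K \<subseteq> G \<and> card K = v}"

definition emp_err :: "nat \<Rightarrow> (nat \<Rightarrow> real^'d) \<Rightarrow> (real^'d \<Rightarrow> complex) \<Rightarrow> (real^'d \<Rightarrow> complex) \<Rightarrow> real" where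
  "emp_err m \<xi> f u = (1 / real m) * (\<Sum>j<m. (cmod (f (\<xi> j) - u (\<xi> j)))\<^sup>2)"

definition LS_set :: "nat \<Rightarrow> (nat \<Rightarrow> real^'d) \<Rightarrow> (real^'d \<Rightarrow> complex) set \<Rightarrow> (real^'d \<Rightarrow> complex)
    \<Rightarrow> (real^'d \<Rightarrow> complex) set" where
  "LS_set m \<xi> L f = {u \<in> L. \<forall>w\<in>L. emp_err m \<xi> f u \<le> emp_err m \<xi> f w}"

text \<open>rho^{ls}_{m,v}(F, Phi_N, L_2); Phi_N given by its frequency set G.
  Ambiguity in the choice of a minimiser is resolved by the worst case.\<close>
definition rho_ls :: "nat \<Rightarrow> nat \<Rightarrow> (real^'d::finite \<Rightarrow> complex) set \<Rightarrow> ('d \<Rightarrow> int) set \<Rightarrow> ereal" where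
  "rho_ls m v F G =
     (INF \<xi> \<in> {\<xi>. \<forall>j<m. \<xi> j \<in> torus}. SUP f \<in> F. INF K \<in> X_v v G.
        SUP u \<in> LS_set m \<xi> (trig_span K) f. ereal (Lq_norm 2 (\<lambda>x. f x - u x)))"

end

theory Submission
  imports Defs
begin

text \<open>
  The absolute sum of the Fourier coefficients of f over a hyperbolic layer is estimated by duality: a
  polynomial on the layer whose coefficients are bounded by one has a small norm in the dual space, because the
  integral of the product of two of its dyadic blocks decays exponentially in the distance of the blocks.

  The sampling points lie on an equispaced grid on which Parseval's identity is exact. A random choice yields
  points for which the norm of every v-sparse polynomial exceeds its empirical norm at most by a factor of order
  sqrt (log v). Allowing this factor, only one level set of the polynomial has to be sampled faithfully, and
  this follows from Maurey's sparsification in the uniform norm, a Chernoff bound and a union bound.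

  For given points and a given f, the low layers are kept and the others are sparsified by Maurey's argument
  in the Hilbert space norm that combines the grid norm with the empirical norm. This step loses no logarithm,
  so the loss in the sampling inequality is exactly the extra exponent 1/2 of log v.
\<close>

section \<open>Trigonometric polynomials on the torus\<close>

text \<open>The points must serve the whole class, whereas the frequency set may depend on f and on
  the points. So the points are found from v and the grid alone, before any f is given. A lower
  sampling inequality is enough: it is applied to the difference of the least squares solution and
  the sparse approximant, which lie in one v-dimensional span, and the empirical size of that
  difference follows from minimality.

  The exponents come from one layer. With \<alpha> = a - 1/p and \<beta> = (d-1)(b+1-1/p), the
  absolute sum over layer j is of order 2^(-\<alpha>j) j^\<beta>. If 2^n n^(d-1) is comparable with
  v, sparsifying layer n costs v^(-1/2) 2^(-\<alpha>n) n^\<beta>, that is, v^(-\<alpha>-1/2) (log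
  v)^((d-1)\<alpha>+\<beta>), where (d-1)\<alpha>+\<beta> = (d-1)(a+b+1-2/p). Later layers get
  shares of the v frequencies that decrease like 2^(-\<alpha>(j-n)). The error depends on the square
  root of a share only, so half of the decay survives and the sum is of the order of its first
  term.\<close>

lemma lborel_integral_prod_Basis:
  fixes f :: "'a::euclidean_space \<Rightarrow> real \<Rightarrow> 'b::{real_normed_field,banach,second_countable_topology}"
  assumes "\<And>b. b \<in> Basis \<Longrightarrow> integrable lborel (f b)"
  shows "(\<integral>x. (\<Prod>b\<in>Basis. f b (x \<bullet> b)) \<partial>(lborel :: 'a measure)) = (\<Prod>b\<in>Basis. (\<integral>x. f b x \<partial>lborel))"
proof -
  interpret product_sigma_finite "\<lambda>_::'a. lborel :: real measure" ..
  have [measurable]: "f b \<in> borel_measurable borel" if "b \<in> Basis" for b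
    using borel_measurable_integrable[OF assms[OF that]] by simp
  have "(\<integral>x. (\<Prod>b\<in>Basis. f b (x \<bullet> b)) \<partial>(lborel :: 'a measure)) =
      (\<integral>x. (\<Prod>b\<in>Basis. f b (x b)) \<partial>(\<Pi>\<^sub>M b\<in>(Basis::'a set). lborel))"
    by (subst lborel_eq, subst integral_distr) (auto intro!: Bochner_Integration.integral_cong prod.cong)
  also have "\<dots> = (\<Prod>b\<in>Basis. (\<integral>x. f b x \<partial>lborel))"
    by (rule product_integral_prod) (use assms in auto)
  finally show ?thesis .
qed

lemma lborel_integral_prod_vec:
  fixes h :: "'d::finite \<Rightarrow> real \<Rightarrow> 'b::{real_normed_field,banach,second_countable_topology}"
  assumes "\<And>i. integrable lborel (h i)"
  shows "(\<integral>x. (\<Prod>i\<in>UNIV. h i (x $ i)) \<partial>(lborel :: (real^'d) measure)) = (\<Prod>i\<in>UNIV. (\<integral>t. h i t \<partial>lborel))"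
proof -
  \<comment> \<open>\<open>idx\<close> inverts the enumeration of the basis by coordinates, so that
    a product over \<open>Basis\<close> can be reindexed by \<open>UNIV\<close>.\<close>
  define idx :: "real^'d \<Rightarrow> 'd" where "idx b = (THE i. b = axis i 1)" for b
  have idx [simp]: "idx (axis i 1) = i" for i
    unfolding idx_def by (rule the_equality) (auto simp: axis_eq_axis)
  have B: "(Basis :: (real^'d) set) = range (\<lambda>i. axis i 1)" by (auto simp: Basis_vec_def)
  have inj: "inj (\<lambda>i::'d. axis i (1::real))" by (auto simp: inj_on_def axis_eq_axis)
  have "(\<Prod>b\<in>Basis. h (idx b) (x \<bullet> b)) = (\<Prod>i\<in>UNIV. h i (x $ i))" for x :: "real^'d"
    unfolding B by (subst prod.reindex[OF inj]) (simp add: inner_axis)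
  moreover have "(\<Prod>b\<in>(Basis::(real^'d) set). (\<integral>x. h (idx b) x \<partial>lborel)) = (\<Prod>i\<in>UNIV. (\<integral>t. h i t \<partial>lborel))"
    unfolding B by (subst prod.reindex[OF inj]) simp
  ultimately show ?thesis
    using lborel_integral_prod_Basis[of "\<lambda>b::real^'d. h (idx b)"] assms by simp
qed

section \<open>Normalized Lebesgue measure on the torus\<close>

definition torus_measure :: "(real^'d::finite) measure" where
  "torus_measure = density lborel (\<lambda>x. ennreal (indicator torus x / (2 * pi) ^ CARD('d)))"

lemma torus_borel [measurable]: "(torus :: (real^'d::finite) set) \<in> sets borel"
proof -
  have "(torus :: (real^'d) set) = (\<Inter>i\<in>UNIV. {x. 0 \<le> x $ i} \<inter> {x. x $ i < 2 * pi})"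
    by (auto simp: torus_def)
  also have "\<dots> \<in> sets borel"
    by (intro sets.finite_INT sets.Int)
       (auto intro!: borel_closed borel_open closed_Collect_le open_Collect_less continuous_intros)
  finally show ?thesis .
qed

lemma sets_torus_measure [measurable_cong, simp]: "sets torus_measure = sets borel"
  by (simp add: torus_measure_def)

lemma space_torus_measure [simp]: "space torus_measure = UNIV"
  by (simp add: torus_measure_def)

text \<open>With the factor and the domain absorbed by the measure, norms and Fourier coefficients
  become plain integrals against a probability measure.\<close>

lemma integral_torus_measure:
  fixes f :: "real^'d::finite \<Rightarrow> 'b::{banach, second_countable_topology}"
  assumes [measurable]: "f \<in> borel_measurable borel"
  shows "integral\<^sup>L torus_measure f = (1 / (2 * pi) ^ CARD('d)) *\<^sub>R set_lebesgue_integral lborel torus f"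
proof -
  have "integral\<^sup>L torus_measure f = (\<integral>x. (indicator torus x / (2 * pi) ^ CARD('d)) *\<^sub>R f x \<partial>lborel)"
    unfolding torus_measure_def
    by (rule integral_density) (auto simp: indicator_def)
  also have "\<dots> = (\<integral>x. (1 / (2 * pi) ^ CARD('d)) *\<^sub>R (indicator torus x *\<^sub>R f x) \<partial>lborel)"
    by (intro Bochner_Integration.integral_cong) auto
  also have "\<dots> = (1 / (2 * pi) ^ CARD('d)) *\<^sub>R set_lebesgue_integral lborel torus f"
    unfolding set_lebesgue_integral_def by (rule integral_scaleR_right)
  finally show ?thesis .
qed

lemma indicator_torus_prod: "(indicator torus x :: real) = (\<Prod>i\<in>UNIV. indicator {0..<2*pi} (x $ i))"
  for x :: "real^'d::finite"
proof (cases "x \<in> torus")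
  case True then show ?thesis by (auto simp: torus_def intro!: prod.neutral)
next
  case False
  then obtain i where "x $ i \<notin> {0..<2*pi}" by (auto simp: torus_def not_le)
  then have "indicator {0..<2*pi} (x $ i) = (0::real)" by simp
  then have "(\<Prod>i\<in>UNIV. indicator {0..<2*pi} (x $ i)) = (0::real)" by (metis prod_zero finite UNIV_I)
  with False show ?thesis by simp
qed

lemma integrable_cis_Ico: "integrable lborel (\<lambda>t. indicator {0..<2*pi} t *\<^sub>R cis (c * t))"
proof -
  have "set_integrable lborel {0..2*pi} (\<lambda>t. cis (c * t))"
    by (intro borel_integrable_atLeastAtMost') (auto intro!: continuous_intros)
  then have "set_integrable lborel {0..<2*pi} (\<lambda>t. cis (c * t))"
    by (rule set_integrable_subset) auto
  then show ?thesis unfolding set_integrable_def .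
qed

lemma integral_cis_Ico:
  "(\<integral>t. indicator {0..<2*pi} t *\<^sub>R cis (of_int n * t) \<partial>lborel) = (if n = 0 then 2 * pi else 0)"
proof (cases "n = 0")
  case True
  have "(\<integral>t. indicator {0..<2*pi} t *\<^sub>R (1::complex) \<partial>lborel) = complex_of_real (2 * pi)"
    by (simp add: scaleR_conv_of_real)
  then show ?thesis using True by simp
next
  case False
  have "(\<integral>t. indicator {0..<2*pi} t *\<^sub>R cis (of_int n * t) \<partial>lborel)
     = (\<integral>t. indicator {0..2*pi} t *\<^sub>R cis (of_int n * t) \<partial>lborel)"
  proof (rule integral_cong_AE)
    have "AE t in lborel. t \<noteq> 2*pi" by (rule AE_lborel_singleton)
    then show "AE t in lborel. indicator {0..<2*pi} t *\<^sub>R cis (of_int n * t) = indicator {0..2*pi} t *\<^sub>R cis (of_int n * t)"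
      by eventually_elim (auto simp: indicator_def)
  next
    have [measurable]: "(\<lambda>t. cis (of_int n * t)) \<in> borel_measurable borel"
      by (intro borel_measurable_continuous_onI continuous_intros)
    show "(\<lambda>t. indicator {0..<2*pi} t *\<^sub>R cis (of_int n * t)) \<in> borel_measurable lborel"
      "(\<lambda>t. indicator {0..2*pi} t *\<^sub>R cis (of_int n * t)) \<in> borel_measurable lborel"
      by simp_all
  qed
  also have "\<dots> = cis (of_int n * (2*pi)) / (\<i> * of_int n) - cis (of_int n * 0) / (\<i> * of_int n)"
  proof (rule integral_FTC_Icc)
    fix x :: real
    show "((\<lambda>t. cis (of_int n * t) / (\<i> * of_int n)) has_vector_derivative cis (of_int n * x)) (at x within {0..2*pi})"
      using False unfolding cis_conv_exp
      by (auto intro!: derivative_eq_intros has_vector_derivative_real_field simp: field_simps)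
  qed (auto intro!: continuous_intros)
  also have "\<dots> = 0"
    using cis_multiple_2pi[of "of_int n"] by (simp add: mult.commute mult.left_commute)
  finally show ?thesis using False by simp
qed

text \<open>The half-open cube is squeezed between the open and the closed box, which have the same
  volume.\<close>

lemma emeasure_lborel_torus: "emeasure lborel (torus :: (real^'d::finite) set) = ennreal ((2 * pi) ^ CARD('d))"
proof (rule antisym)
  define b :: "real^'d" where "b = (\<chi> i. 2 * pi)"
  have P: "(\<Prod>k\<in>Basis. (b - 0) \<bullet> k) = (2 * pi) ^ CARD('d)"
  proof -
    have "(\<Prod>k\<in>Basis. (b - 0) \<bullet> k) = (\<Prod>k\<in>(Basis :: (real^'d) set). 2 * pi)"
      by (intro prod.cong) (auto simp: b_def Basis_vec_def inner_axis)
    then show ?thesis by (simp only: prod_constant DIM_cart DIM_real mult_1_right)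
  qed
  have bB: "0 \<bullet> k \<le> b \<bullet> k" if "k \<in> Basis" for k
    using that by (auto simp: b_def Basis_vec_def inner_axis)
  have "emeasure lborel (torus :: (real^'d) set) \<le> emeasure lborel (cbox 0 b)"
    by (rule emeasure_mono) (auto simp: torus_def b_def mem_box_cart less_imp_le)
  then show "emeasure lborel (torus :: (real^'d) set) \<le> ennreal ((2 * pi) ^ CARD('d))"
    using bB P by (simp add: emeasure_lborel_cbox)
  have "emeasure lborel (box 0 b) \<le> emeasure lborel (torus :: (real^'d) set)"
    by (rule emeasure_mono) (auto simp: torus_def b_def mem_box_cart less_imp_le)
  then show "ennreal ((2 * pi) ^ CARD('d)) \<le> emeasure lborel (torus :: (real^'d) set)"
    using bB P by (simp add: emeasure_lborel_box)
qed

lemma prob_space_torus: "emeasure torus_measure (UNIV :: (real^'d::finite) set) = 1"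
proof -
  have "emeasure torus_measure (UNIV :: (real^'d::finite) set) =
     (\<integral>\<^sup>+x. ennreal (1 / (2 * pi) ^ CARD('d)) * indicator (torus :: (real^'d) set) x \<partial>lborel)"
    unfolding torus_measure_def
    by (subst emeasure_density) (auto intro!: nn_integral_cong simp: indicator_def)
  also have "\<dots> = ennreal (1 / (2 * pi) ^ CARD('d)) * ennreal ((2 * pi) ^ CARD('d))"
    by (subst nn_integral_cmult_indicator) (simp_all add: emeasure_lborel_torus)
  also have "\<dots> = 1" by (simp add: ennreal_mult[symmetric])
  finally show ?thesis .
qed

interpretation TM: finite_measure "torus_measure :: (real^'d::finite) measure"
  by (rule finite_measureI) (simp add: prob_space_torus)

lemma measure_torus_UNIV [simp]: "measure torus_measure (UNIV :: (real^'d::finite) set) = 1"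
  by (simp add: measure_def prob_space_torus)

lemma AE_torus: "AE x in torus_measure. x \<in> torus"
  unfolding torus_measure_def by (subst AE_density) (auto simp: indicator_def)

lemma Lq_norm_torus_measure:
  fixes f :: "real^'d::finite \<Rightarrow> complex"
  assumes [measurable]: "f \<in> borel_measurable borel"
  shows "Lq_norm q f = (\<integral>x. norm (f x) powr q \<partial>torus_measure) powr (1 / q)"
  unfolding Lq_norm_def by (subst integral_torus_measure) auto

lemma measurable_torus_fun:
  fixes f :: "real^'d::finite \<Rightarrow> 'b::topological_space"
  shows "continuous_on UNIV f \<Longrightarrow> f \<in> borel_measurable torus_measure"
  by (simp add: borel_measurable_continuous_onI cong: measurable_cong_sets)

text \<open>Almost every point lies in a compact cube, on which a continuous function is bounded;
  behaviour at infinity is irrelevant.\<close>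

lemma integrable_torus_measure:
  fixes f :: "real^'d::finite \<Rightarrow> 'b::{banach, second_countable_topology}"
  assumes "continuous_on UNIV f"
  shows "integrable torus_measure f"
proof -
  have "compact (f ` cbox 0 (\<chi> i. 2 * pi))"
    by (intro compact_continuous_image continuous_on_subset[OF assms]) auto
  then obtain B where B: "\<And>x. x \<in> cbox 0 (\<chi> i. 2 * pi) \<Longrightarrow> norm (f x) \<le> B"
    by (metis bounded_iff compact_imp_bounded imageI)
  show ?thesis
  proof (rule TM.integrable_const_bound)
    show "AE x in torus_measure. norm (f x) \<le> B"
      using AE_torus by eventually_elim (rule B, auto simp: torus_def mem_box_cart less_imp_le)
  qed (rule measurable_torus_fun[OF assms])
qed

section \<open>Exponentials and their orthogonality\<close>

lemma continuous_on_kdot [continuous_intros]: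
  "continuous_on S g \<Longrightarrow> continuous_on S (\<lambda>x. kdot k (g x))"
  unfolding kdot_def by (intro continuous_intros continuous_on_component)

lemma continuous_on_expk [continuous_intros]:
  "continuous_on S g \<Longrightarrow> continuous_on S (\<lambda>x. expk k (g x))"
  unfolding expk_def by (intro continuous_intros)

lemma cmod_expk [simp]: "cmod (expk k x) = 1"
  by (simp add: expk_def)

lemma expk_mult: "expk k x * expk l x = expk (\<lambda>i. k i + l i) x"
  by (simp add: expk_def cis_mult kdot_def sum.distrib ring_distribs)

lemma cnj_expk: "cnj (expk k x) = expk (\<lambda>i. - k i) x"
  by (simp add: expk_def cis_cnj kdot_def sum_negf)

lemma expk_mult_cnj: "expk k x * cnj (expk l x) = expk (\<lambda>i. k i - l i) x"
  by (simp add: cnj_expk expk_mult)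

lemma expk_prod: "expk k x = (\<Prod>i\<in>UNIV. cis (of_int (k i) * x $ i))"
  unfolding expk_def kdot_def by (simp add: cis_conv_exp sum_distrib_left exp_sum)

lemma integral_expk:
  fixes k :: "'d::finite \<Rightarrow> int"
  shows "(\<integral>x. expk k x \<partial>torus_measure) = (if \<forall>i. k i = 0 then 1 else 0)"
proof -
  have "set_lebesgue_integral lborel torus (expk k) =
     (\<integral>x. (\<Prod>i\<in>UNIV. indicator {0..<2*pi} (x $ i) *\<^sub>R cis (of_int (k i) * x $ i)) \<partial>(lborel :: (real^'d) measure))"
    unfolding set_lebesgue_integral_def
    by (intro Bochner_Integration.integral_cong)
       (auto simp: indicator_torus_prod expk_prod scaleR_conv_of_real prod.distrib)
  also have "\<dots> = (\<Prod>i\<in>UNIV. (\<integral>t. indicator {0..<2*pi} t *\<^sub>R cis (of_int (k i) * t) \<partial>lborel))"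
    by (rule lborel_integral_prod_vec) (rule integrable_cis_Ico)
  also have "\<dots> = (\<Prod>i\<in>UNIV. if k i = 0 then 2 * pi else 0)"
    by (simp add: integral_cis_Ico of_real_prod)
  also have "\<dots> = (if \<forall>i. k i = 0 then (2 * pi) ^ CARD('d) else 0)"
    by (auto intro!: prod_zero)
  finally show ?thesis
    by (subst integral_torus_measure)
       (auto intro!: borel_measurable_continuous_onI continuous_intros simp: scaleR_conv_of_real)
qed

lemma fourier_coeff_torus_measure:
  fixes f :: "real^'d::finite \<Rightarrow> complex"
  assumes "continuous_on UNIV f"
  shows "fourier_coeff f k = (\<integral>x. f x * cnj (expk k x) \<partial>torus_measure)"
  unfolding fourier_coeff_def
  by (subst integral_torus_measure)
     (auto intro!: borel_measurable_continuous_onI continuous_intros assms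
        simp: scaleR_conv_of_real expk_def cis_cnj)

section \<open>Polynomials with prescribed frequencies\<close>

definition tpoly :: "('d::finite \<Rightarrow> int) set \<Rightarrow> (('d \<Rightarrow> int) \<Rightarrow> complex) \<Rightarrow> real^'d \<Rightarrow> complex" where
  "tpoly K c x = (\<Sum>k\<in>K. c k * expk k x)"

lemma continuous_on_tpoly [continuous_intros]:
  "continuous_on S g \<Longrightarrow> continuous_on S (\<lambda>x. tpoly K c (g x))"
  unfolding tpoly_def by (intro continuous_intros)

lemma fourier_coeff_tpoly:
  fixes K :: "('d::finite \<Rightarrow> int) set"
  assumes "finite K"
  shows "(\<integral>x. tpoly K c x * cnj (expk l x) \<partial>torus_measure) = (if l \<in> K then c l else 0)"
proof -
  have "(\<integral>x. tpoly K c x * cnj (expk l x) \<partial>torus_measure) =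
     (\<integral>x. (\<Sum>k\<in>K. c k * expk (\<lambda>i. k i - l i) x) \<partial>torus_measure)"
    by (simp add: tpoly_def sum_distrib_right mult.assoc expk_mult_cnj)
  also have "\<dots> = (\<Sum>k\<in>K. c k * (if k = l then 1 else 0))"
    by (subst Bochner_Integration.integral_sum)
       (auto intro!: integrable_torus_measure continuous_intros sum.cong simp: integral_expk fun_eq_iff)
  also have "\<dots> = (if l \<in> K then c l else 0)"
    using assms by (simp add: sum.delta if_distrib cong: if_cong)
  finally show ?thesis .
qed

lemma integral_tpoly_mult_cnj:
  fixes K :: "('d::finite \<Rightarrow> int) set"
  assumes "finite K"
  shows "(\<integral>x. tpoly K c x * cnj (tpoly K c' x) \<partial>torus_measure) = (\<Sum>k\<in>K. c k * cnj (c' k))"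
proof -
  have "(\<integral>x. tpoly K c x * cnj (tpoly K c' x) \<partial>torus_measure) =
     (\<integral>x. (\<Sum>k\<in>K. cnj (c' k) * (tpoly K c x * cnj (expk k x))) \<partial>torus_measure)"
    by (intro Bochner_Integration.integral_cong) (auto simp: tpoly_def[of K c'] sum_distrib_left mult_ac)
  also have "\<dots> = (\<Sum>k\<in>K. cnj (c' k) * (\<integral>x. tpoly K c x * cnj (expk k x) \<partial>torus_measure))"
    by (subst Bochner_Integration.integral_sum)
       (auto intro!: integrable_torus_measure continuous_intros)
  also have "\<dots> = (\<Sum>k\<in>K. c k * cnj (c' k))"
    using assms by (intro sum.cong) (auto simp: fourier_coeff_tpoly)
  finally show ?thesis .
qed

lemma parseval_tpoly:
  fixes K :: "('d::finite \<Rightarrow> int) set"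
  assumes "finite K"
  shows "(\<integral>x. (cmod (tpoly K c x))\<^sup>2 \<partial>torus_measure) = (\<Sum>k\<in>K. (cmod (c k))\<^sup>2)"
proof -
  have "complex_of_real (\<integral>x. (cmod (tpoly K c x))\<^sup>2 \<partial>torus_measure) =
      (\<integral>x. complex_of_real ((cmod (tpoly K c x))\<^sup>2) \<partial>torus_measure)"
    by (rule integral_complex_of_real[symmetric])
  also have "\<dots> = complex_of_real (\<Sum>k\<in>K. (cmod (c k))\<^sup>2)"
    unfolding complex_norm_square using integral_tpoly_mult_cnj[OF assms, of c c]
    by (simp add: complex_norm_square del: of_real_power)
  finally show ?thesis by (simp only: of_real_eq_iff)
qed

section \<open>Uniqueness of Fourier coefficients\<close>

text \<open>Hiding the frequency set makes the class an algebra, as Stone-Weierstrass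
  requires.\<close>

definition trig_poly :: "(real^'d::finite \<Rightarrow> complex) \<Rightarrow> bool" where
  "trig_poly h \<longleftrightarrow> (\<exists>K c. finite K \<and> h = tpoly K c)"

lemma tpoly_mono_neutral:
  assumes "finite K'" "K \<subseteq> K'" "\<And>k. k \<in> K' - K \<Longrightarrow> c k = 0"
  shows "tpoly K c = tpoly K' c"
  unfolding tpoly_def by (intro ext sum.mono_neutral_left) (use assms in auto)

lemma tpoly_extend:
  assumes "finite K'" "K \<subseteq> K'"
  shows "tpoly K c = tpoly K' (\<lambda>k. if k \<in> K then c k else 0)"
  using assms by (subst tpoly_mono_neutral[OF assms, symmetric]) (auto simp: tpoly_def intro!: ext sum.cong)

lemma trig_poly_add: "trig_poly f \<Longrightarrow> trig_poly g \<Longrightarrow> trig_poly (\<lambda>x. f x + g x)"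
proof -
  assume "trig_poly f" "trig_poly g"
  then obtain K c K' c' where *: "finite K" "f = tpoly K c" "finite K'" "g = tpoly K' c'"
    by (auto simp: trig_poly_def)
  have "f = tpoly (K \<union> K') (\<lambda>k. if k \<in> K then c k else 0)"
    "g = tpoly (K \<union> K') (\<lambda>k. if k \<in> K' then c' k else 0)"
    using * by (auto intro!: tpoly_extend)
  then have "f x + g x = tpoly (K \<union> K') (\<lambda>k. (if k \<in> K then c k else 0) + (if k \<in> K' then c' k else 0)) x" for x
    by (simp only: tpoly_def sum.distrib ring_distribs)
  then have "(\<lambda>x. f x + g x) = tpoly (K \<union> K') (\<lambda>k. (if k \<in> K then c k else 0) + (if k \<in> K' then c' k else 0))"
    by (rule ext)
  then show ?thesis using * unfolding trig_poly_def by blast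
qed

lemma trig_poly_monom: "trig_poly (\<lambda>x. a * expk k x)"
  unfolding trig_poly_def by (rule exI[of _ "{k}"], rule exI[of _ "\<lambda>_. a"]) (auto simp: tpoly_def)

lemma trig_poly_const: "trig_poly (\<lambda>x. a)"
  using trig_poly_monom[of a "\<lambda>_. 0"] by (simp add: expk_def kdot_def)

lemma trig_poly_sum: "finite I \<Longrightarrow> (\<And>i. i \<in> I \<Longrightarrow> trig_poly (f i)) \<Longrightarrow> trig_poly (\<lambda>x. \<Sum>i\<in>I. f i x)"
  by (induction I rule: finite_induct) (auto intro: trig_poly_const trig_poly_add)

lemma trig_poly_mult: "trig_poly f \<Longrightarrow> trig_poly g \<Longrightarrow> trig_poly (\<lambda>x. f x * g x)"
proof -
  assume "trig_poly f" "trig_poly g"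
  then obtain K c K' c' where *: "finite K" "f = tpoly K c" "finite K'" "g = tpoly K' c'"
    by (auto simp: trig_poly_def)
  have "f x * g x = (\<Sum>k\<in>K. \<Sum>l\<in>K'. (c k * c' l) * expk (\<lambda>i. k i + l i) x)" for x
    unfolding * tpoly_def sum_product by (intro sum.cong refl) (simp add: expk_mult[symmetric])
  then show ?thesis using * by (simp add: trig_poly_sum trig_poly_monom)
qed

text \<open>A real linear functional of the point with coordinates cis(x_i) is a combination of
  cos(x_i) and sin(x_i), hence of exponentials whose frequencies are plus or minus the i-th unit
  vector. Sums and products then stay inside the algebra.\<close>

lemma trig_poly_real_polynomial:
  assumes "real_polynomial_function (p :: complex^'d::finite \<Rightarrow> real)"
  shows "trig_poly (\<lambda>x::real^'d. of_real (p (\<chi> i. cis (x $ i))))"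
  using assms
proof induction
  case (linear f)
  interpret bounded_linear f by fact
  have expk_axis: "expk (\<lambda>j. if j = i then m else 0) x = cis (of_int m * x $ i)" for i m and x :: "real^'d"
    by (simp add: expk_def kdot_def if_distrib[of of_int] if_distribR if_distrib[of "\<lambda>z. z * _"] cong: if_cong)
  have "complex_of_real (f (\<chi> i. cis (x $ i))) =
     (\<Sum>i\<in>UNIV. (f (axis i 1) - \<i> * f (axis i \<i>)) / 2 * expk (\<lambda>j. if j = i then 1 else 0) x +
                (f (axis i 1) + \<i> * f (axis i \<i>)) / 2 * expk (\<lambda>j. if j = i then -1 else 0) x)" for x :: "real^'d"
  proof -
    have "(\<chi> i. cis (x $ i)) = (\<Sum>i\<in>UNIV. cos (x $ i) *\<^sub>R axis i 1 + sin (x $ i) *\<^sub>R axis i \<i>)"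
      by (simp add: vec_eq_iff axis_def if_distrib cong: if_cong)
         (simp add: complex_eq_iff sum.distrib if_distrib cong: if_cong)
    then have "f (\<chi> i. cis (x $ i)) = (\<Sum>i\<in>UNIV. cos (x $ i) * f (axis i 1) + sin (x $ i) * f (axis i \<i>))"
      by (simp add: sum add scaleR)
    then show ?thesis
      unfolding expk_axis
      by (auto simp: complex_eq_iff field_simps sum_divide_distrib intro!: sum.cong)
  qed
  then show ?case by (simp only:) (intro trig_poly_sum trig_poly_add trig_poly_monom finite)
next
  case (const c)
  then show ?case by (simp add: trig_poly_const)
next
  case (add f g)
  then show ?case by (simp add: trig_poly_add)
next
  case (mult f g)
  then show ?case by (simp add: trig_poly_mult)
qed

text \<open>Moves a point from the upper faces of the closed cube to the lower ones. Periodicity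
  shifts one coordinate at a time, hence the induction over a set of coordinates.\<close>

lemma periodic_cont_reduce:
  assumes "periodic_cont g" "x \<in> cbox 0 (\<chi> i. 2 * pi)"
  shows "g (\<chi> i. if x $ i = 2 * pi then 0 else x $ i) = g x"
proof -
  have "g (\<chi> i. if i \<in> I \<and> x $ i = 2 * pi then 0 else x $ i) = g x" if "finite I" for I
    using that
  proof (induction I rule: finite_induct)
    case empty
    then show ?case by (simp add: vec_lambda_eta)
  next
    case (insert j I)
    let ?y = "\<lambda>I. (\<chi> i. if i \<in> I \<and> x $ i = 2 * pi then 0 else x $ i)"
    show ?case
    proof (cases "x $ j = 2 * pi")
      case True
      have "?y I = ?y (insert j I) + (2 * pi) *\<^sub>R axis j 1"
        using True insert.hyps by (auto simp: vec_eq_iff axis_def)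
      then show ?thesis using assms insert.IH by (simp add: periodic_cont_def)
    next
      case False
      then have "?y I = ?y (insert j I)" by (auto simp: vec_eq_iff)
      then show ?thesis using insert.IH by simp
    qed
  qed
  from this[of UNIV] show ?thesis by simp
qed

text \<open>The function is transported to the compact product of unit circles in
  \<open>complex^'d\<close>, where ordinary polynomials are dense; a polynomial there pulls back to
  a trigonometric one.\<close>

lemma trig_poly_dense:
  fixes g :: "real^'d::finite \<Rightarrow> complex"
  assumes g: "periodic_cont g" and e: "e > 0"
  shows "\<exists>h. trig_poly h \<and> (\<forall>x\<in>torus. cmod (g x - h x) < e)"
proof -
  define Q :: "(real^'d) set" where "Q = cbox 0 (\<chi> i. 2 * pi)"
  define \<phi> :: "real^'d \<Rightarrow> complex^'d" where "\<phi> x = (\<chi> i. cis (x $ i))" for x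
  define F :: "complex^'d \<Rightarrow> complex" where "F z = g (\<chi> i. Arg2pi (z $ i))" for z
  have cont\<phi>: "continuous_on T \<phi>" for T
    unfolding \<phi>_def by (intro continuous_intros)
  have contg: "continuous_on UNIV g" using g by (simp add: periodic_cont_def)
  have F\<phi>: "F (\<phi> x) = g x" if "x \<in> Q" for x
  proof -
    have "Arg2pi (cis (x $ i)) = (if x $ i = 2 * pi then 0 else x $ i)" for i
      using that Arg2pi_unique[of 1 "x $ i" "cis (x $ i)"]
      by (auto simp: Q_def mem_box_cart cis_conv_exp less_le mult.commute Arg2pi_eq_0)
    then have "F (\<phi> x) = g (\<chi> i. if x $ i = 2 * pi then 0 else x $ i)"
      by (simp add: F_def \<phi>_def)
    also have "\<dots> = g x" using periodic_cont_reduce[OF g] that by (simp add: Q_def)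
    finally show ?thesis .
  qed
  have cQ: "compact Q" by (simp add: Q_def)
  then have cS: "compact (\<phi> ` Q)" by (intro compact_continuous_image cont\<phi>)
  \<comment> \<open>\<open>Arg2pi\<close> jumps, so F is not a composition of continuous maps.
    Continuity holds because the preimage under F of a closed set is the image under \<phi> of a
    compact set.\<close>
  have "continuous_on (\<phi> ` Q) F"
  proof (subst continuous_on_closed_vimage[OF compact_imp_closed[OF cS]], intro allI impI)
    fix B :: "complex set" assume "closed B"
    have "closed (g -` B)"
      using contg \<open>closed B\<close> by (simp add: continuous_closed_vimage continuous_on_eq_continuous_at)
    then have "compact (\<phi> ` (Q \<inter> g -` B))"
      using cQ by (intro compact_continuous_image cont\<phi> compact_Int_closed)
    moreover have "\<phi> ` (Q \<inter> g -` B) = F -` B \<inter> \<phi> ` Q" using F\<phi> by auto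
    ultimately show "closed (F -` B \<inter> \<phi> ` Q)" by (metis compact_imp_closed)
  qed
  from Stone_Weierstrass_polynomial_function[OF cS this e]
  obtain P where P: "polynomial_function P" "\<And>z. z \<in> \<phi> ` Q \<Longrightarrow> cmod (F z - P z) < e" by auto
  show ?thesis
  proof (intro exI conjI ballI)
    have "real_polynomial_function (\<lambda>z. Re (P z))" "real_polynomial_function (\<lambda>z. Im (P z))"
      using P(1) unfolding polynomial_function_iff_Basis_inner by (auto simp: Basis_complex_def)
    then have "trig_poly (\<lambda>x. of_real (Re (P (\<phi> x))) + \<i> * of_real (Im (P (\<phi> x))))"
      unfolding \<phi>_def by (intro trig_poly_add trig_poly_mult trig_poly_const trig_poly_real_polynomial)
    then show "trig_poly (\<lambda>x. P (\<phi> x))" by (simp flip: complex_eq)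
    show "cmod (g x - P (\<phi> x)) < e" if "x \<in> torus" for x
    proof -
      have "x \<in> Q" using that by (auto simp: Q_def torus_def mem_box_cart less_imp_le)
      then show ?thesis using P(2)[of "\<phi> x"] F\<phi> by auto
    qed
  qed
qed

text \<open>An open null set is empty, so g vanishes on the open box; the faces that belong to the
  torus are reached by closure.\<close>

lemma continuous_AE_torus_zero:
  fixes g :: "real^'d::finite \<Rightarrow> complex"
  assumes cont: "continuous_on UNIV g" and AE: "AE x in torus_measure. g x = 0" and x: "x \<in> torus"
  shows "g x = 0"
proof -
  define b :: "real^'d" where "b = (\<chi> i. 2 * pi)"
  have bt: "box 0 b \<subseteq> torus" by (auto simp: b_def torus_def mem_box_cart less_imp_le)
  have AE': "AE x in lborel. x \<in> torus \<longrightarrow> g x = 0"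
    using AE unfolding torus_measure_def by (subst (asm) AE_density) (auto simp: indicator_def elim: eventually_mono)
  have "closed {x. g x = 0}" using cont by (intro closed_Collect_eq continuous_intros)
  then have op: "open (box 0 b \<inter> {x. g x \<noteq> 0})" by (auto simp: open_closed Collect_neg_eq intro!: open_Int)
  have "box 0 b \<inter> {x. g x \<noteq> 0} \<in> null_sets lborel"
  proof -
    have "AE x in lborel. x \<notin> box 0 b \<inter> {x. g x \<noteq> 0}" using AE' bt by (auto elim!: eventually_mono)
    then show ?thesis using op by (subst AE_iff_null_sets) auto
  qed
  then have "negligible (box 0 b \<inter> {x. g x \<noteq> 0})"
    by (auto simp: negligible_iff_null_sets null_sets_completionI)
  then have "box 0 b \<inter> {x. g x \<noteq> 0} = {}" using op open_not_negligible by blast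
  then have "box 0 b \<subseteq> {x. g x = 0}" by auto
  then have "closure (box 0 b) \<subseteq> {x. g x = 0}" using \<open>closed {x. g x = 0}\<close> by (rule closure_minimal)
  moreover have "box 0 b \<noteq> {}" by (auto simp: box_ne_empty b_def Basis_vec_def inner_axis)
  moreover have "x \<in> cbox 0 b" using x by (auto simp: b_def torus_def mem_box_cart less_imp_le)
  ultimately show ?thesis by (auto simp: closure_box)
qed

text \<open>g is orthogonal to every trigonometric polynomial h, so its squared norm is the integral
  of g times the conjugate of g - h, which is at most sup |g - h| times the L1 norm of g. Density
  makes this arbitrarily small.\<close>

lemma fourier_uniqueness:
  fixes g :: "real^'d::finite \<Rightarrow> complex"
  assumes g: "periodic_cont g" and zero: "\<And>k. (\<integral>x. g x * cnj (expk k x) \<partial>torus_measure) = 0"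
    and x: "x \<in> torus"
  shows "g x = 0"
proof -
  have contg [continuous_intros]: "continuous_on UNIV g" using g by (simp add: periodic_cont_def)
  have int: "integrable torus_measure (\<lambda>x. (cmod (g x))\<^sup>2)" "integrable torus_measure (\<lambda>x. cmod (g x))"
    by (intro integrable_torus_measure continuous_intros)+
  define B where "B = (\<integral>x. cmod (g x) \<partial>torus_measure)"
  have B: "0 \<le> B" by (simp add: B_def)
  have le: "(\<integral>x. (cmod (g x))\<^sup>2 \<partial>torus_measure) \<le> e * B" if "e > 0" for e
  proof -
    obtain h where h: "trig_poly h" "\<forall>x\<in>torus. cmod (g x - h x) < e"
      using trig_poly_dense[OF g \<open>e > 0\<close>] by blast
    then obtain K c where K: "finite K" "h = tpoly K c" by (auto simp: trig_poly_def)
    have conth [continuous_intros]: "continuous_on UNIV h" unfolding K by (intro continuous_intros)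
    have "(\<integral>x. g x * cnj (h x) \<partial>torus_measure) = (\<integral>x. (\<Sum>k\<in>K. cnj (c k) * (g x * cnj (expk k x))) \<partial>torus_measure)"
      by (simp add: K tpoly_def sum_distrib_left mult_ac)
    also have "\<dots> = (\<Sum>k\<in>K. cnj (c k) * (\<integral>x. g x * cnj (expk k x) \<partial>torus_measure))"
      by (subst Bochner_Integration.integral_sum) (auto intro!: integrable_torus_measure continuous_intros)
    also have "\<dots> = 0" by (simp add: zero)
    finally have gh: "(\<integral>x. g x * cnj (h x) \<partial>torus_measure) = 0" .
    have "complex_of_real (\<integral>x. (cmod (g x))\<^sup>2 \<partial>torus_measure) = (\<integral>x. g x * cnj (g x) \<partial>torus_measure)"
      by (simp flip: integral_complex_of_real complex_norm_square)
    also have "\<dots> = (\<integral>x. g x * cnj (g x - h x) + g x * cnj (h x) \<partial>torus_measure)"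
      by (simp add: algebra_simps)
    also have "\<dots> = (\<integral>x. g x * cnj (g x - h x) \<partial>torus_measure)"
    proof -
      have "integrable torus_measure (\<lambda>x. g x * cnj (g x - h x))" "integrable torus_measure (\<lambda>x. g x * cnj (h x))"
        by (intro integrable_torus_measure continuous_intros)+
      then show ?thesis by (simp only: Bochner_Integration.integral_add gh add_0_right)
    qed
    finally have eq: "complex_of_real (\<integral>x. (cmod (g x))\<^sup>2 \<partial>torus_measure) = (\<integral>x. g x * cnj (g x - h x) \<partial>torus_measure)" .
    have "(\<integral>x. (cmod (g x))\<^sup>2 \<partial>torus_measure) = cmod (\<integral>x. g x * cnj (g x - h x) \<partial>torus_measure)"
      unfolding eq[symmetric] norm_of_real by simp
    also have "\<dots> \<le> (\<integral>x. cmod (g x * cnj (g x - h x)) \<partial>torus_measure)" by (rule integral_norm_bound)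
    also have "\<dots> \<le> (\<integral>x. e * cmod (g x) \<partial>torus_measure)"
    proof (rule integral_mono_AE)
      show "AE x in torus_measure. cmod (g x * cnj (g x - h x)) \<le> e * cmod (g x)"
        using AE_torus
      proof eventually_elim
        fix x :: "real^'d" assume "x \<in> torus"
        then have "cmod (g x - h x) \<le> e" using h(2) by (simp add: less_imp_le)
        then have "cmod (g x) * cmod (g x - h x) \<le> cmod (g x) * e" by (intro mult_left_mono) auto
        then show "cmod (g x * cnj (g x - h x)) \<le> e * cmod (g x)"
          by (simp only: norm_mult complex_mod_cnj mult.commute)
      qed
    qed (intro integrable_torus_measure continuous_intros)+
    finally show ?thesis by (simp add: B_def)
  qed
  have "(\<integral>x. (cmod (g x))\<^sup>2 \<partial>torus_measure) \<le> 0"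
  proof (rule field_le_epsilon)
    fix e :: real assume "e > 0"
    \<comment> \<open>Dividing by B + 1 rather than B covers the case B = 0.\<close>
    have "(\<integral>x. (cmod (g x))\<^sup>2 \<partial>torus_measure) \<le> e / (B + 1) * B"
      using \<open>e > 0\<close> B by (intro le) simp
    also have "\<dots> \<le> e" using \<open>e > 0\<close> B by (simp add: divide_simps)
    finally show "(\<integral>x. (cmod (g x))\<^sup>2 \<partial>torus_measure) \<le> 0 + e" by simp
  qed
  then have "(\<integral>x. (cmod (g x))\<^sup>2 \<partial>torus_measure) = 0" by (simp add: antisym)
  then have "AE x in torus_measure. (cmod (g x))\<^sup>2 = 0"
    by (subst (asm) integral_nonneg_eq_0_iff_AE) (auto intro!: int)
  then show ?thesis by (intro continuous_AE_torus_zero[OF contg _ x]) simp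
qed

section \<open>Dyadic blocks and hyperbolic layers\<close>

text \<open>The bit length of the absolute value of n: the index of the one-dimensional dyadic block
  that contains n, with value 0 exactly at n = 0.\<close>

definition blk :: "int \<Rightarrow> nat" where "blk n = (LEAST s. \<bar>n\<bar> < 2 ^ s)"

lemma blk_upper: "\<bar>n\<bar> < 2 ^ blk n"
proof -
  have "\<bar>n\<bar> < 2 ^ nat \<bar>n\<bar>" using of_nat_less_two_power[of "nat \<bar>n\<bar>", where 'a = int] by simp
  then show ?thesis unfolding blk_def by (rule LeastI)
qed

lemma blk_eq_iff: "blk n = s \<longleftrightarrow> \<bar>n\<bar> < 2 ^ s \<and> (s \<noteq> 0 \<longrightarrow> 2 ^ (s - 1) \<le> \<bar>n\<bar>)"
proof
  assume "blk n = s"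
  then show "\<bar>n\<bar> < 2 ^ s \<and> (s \<noteq> 0 \<longrightarrow> 2 ^ (s - 1) \<le> \<bar>n\<bar>)"
    using blk_upper[of n] not_less_Least[of "s - 1" "\<lambda>s. \<bar>n\<bar> < 2 ^ s"] by (auto simp: blk_def not_less)
next
  assume *: "\<bar>n\<bar> < 2 ^ s \<and> (s \<noteq> 0 \<longrightarrow> 2 ^ (s - 1) \<le> \<bar>n\<bar>)"
  show "blk n = s" unfolding blk_def
  proof (rule Least_equality)
    fix t assume t: "\<bar>n\<bar> < 2 ^ t"
    show "s \<le> t"
    proof (rule ccontr)
      assume "\<not> s \<le> t"
      then have "(2::int) ^ t \<le> 2 ^ (s - 1)" by (intro power_increasing) auto
      moreover have "2 ^ (s - 1) \<le> \<bar>n\<bar>" using * \<open>\<not> s \<le> t\<close> by auto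
      ultimately show False using t by linarith
    qed
  qed (use * in auto)
qed

text \<open>The floor in the definition matters only for s_j = 0, where it turns 1/2 into 0. In this
  form the blocks are visibly a partition and a product over the coordinates.\<close>

lemma dyadic_block_eq: "dyadic_block s = {k. \<forall>i. blk (k i) = s i}"
proof -
  have "\<lfloor>2 powr (real n - 1)\<rfloor> = (if n = 0 then 0 else 2 ^ (n - 1))" for n :: nat
  proof (cases n)
    case 0
    then show ?thesis by (simp add: powr_minus floor_eq_iff)
  next
    case (Suc m)
    then have "2 powr (real n - 1) = of_int (2 ^ m)" by (simp add: powr_realpow)
    then show ?thesis using Suc by (simp only: floor_of_int) simp
  qed
  then have "(\<lfloor>2 powr (real (s j) - 1)\<rfloor> \<le> \<bar>k j\<bar> \<and> \<bar>k j\<bar> < 2 ^ s j) = (blk (k j) = s j)" for k :: "'a \<Rightarrow> int" and j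
    by (cases "s j = 0") (auto simp: blk_eq_iff)
  then show ?thesis by (simp add: dyadic_block_def)
qed

lemma blk_fiber: "{n. blk n = s} \<subseteq> {- (2 ^ s) .. 2 ^ s}"
  by (auto simp: blk_eq_iff)

lemma finite_blk_fiber [simp]: "finite {n. blk n = s}"
  by (rule finite_subset[OF blk_fiber]) simp

lemma card_blk_fiber: "card {n. blk n = s} \<le> 2 ^ s"
proof (cases s)
  case 0
  then have "{n. blk n = s} = {0}" by (auto simp: blk_eq_iff)
  then show ?thesis by simp
next
  case (Suc m)
  have "{n. blk n = s} \<subseteq> {2 ^ m ..< 2 ^ s} \<union> uminus ` {2 ^ m ..< 2 ^ s}"
    using Suc by (auto simp: blk_eq_iff image_iff)
  then have "card {n. blk n = s} \<le> card ({2 ^ m ..< 2 ^ s} \<union> uminus ` {2 ^ m ..< (2::int) ^ s})"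
    by (intro card_mono) auto
  also have "\<dots> \<le> card {2 ^ m ..< (2::int) ^ s} + card {2 ^ m ..< (2::int) ^ s}"
    by (intro order.trans[OF card_Un_le] add_mono card_image_le) auto
  also have "\<dots> = 2 ^ s" using Suc by (simp add: nat_diff_distrib nat_power_eq)
  finally show ?thesis .
qed

lemma dyadic_block_PiE: "dyadic_block s = PiE UNIV (\<lambda>i. {n. blk n = s i})"
  by (auto simp: dyadic_block_eq PiE_def Pi_def)

lemma finite_dyadic_block [simp]: "finite (dyadic_block s)"
  unfolding dyadic_block_PiE by (rule finite_PiE) auto

lemma card_dyadic_block: "card (dyadic_block (s :: 'd::finite \<Rightarrow> nat)) \<le> 2 ^ sum s UNIV"
proof -
  have "card (dyadic_block s) = (\<Prod>i\<in>UNIV. card {n. blk n = s i})"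
    unfolding dyadic_block_PiE by (rule card_PiE) simp
  also have "\<dots> \<le> (\<Prod>i\<in>UNIV. 2 ^ s i)" by (intro prod_mono) (auto simp: card_blk_fiber)
  also have "\<dots> = 2 ^ sum s UNIV" by (simp add: power_sum)
  finally show ?thesis .
qed

section \<open>Hyperbolic layers and hyperbolic crosses\<close>

definition lev :: "('d::finite \<Rightarrow> int) \<Rightarrow> nat" where "lev k = (\<Sum>i\<in>UNIV. blk (k i))"

lemma finite_multi_deg [simp]: "finite {s :: 'd::finite \<Rightarrow> nat. sum s UNIV = j}"
proof (rule finite_subset)
  show "{s :: 'd \<Rightarrow> nat. sum s UNIV = j} \<subseteq> PiE UNIV (\<lambda>_. {..j})"
    by (auto simp: PiE_def Pi_def intro!: member_le_sum)
qed (auto intro: finite_PiE)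

text \<open>One coordinate is determined by the others and the total. This is the origin of the
  exponent d - 1 of every logarithm that depends on the dimension.\<close>

lemma card_multi_deg: "card {s :: 'd::finite \<Rightarrow> nat. sum s UNIV = j} \<le> (j + 1) ^ (CARD('d) - 1)"
proof -
  obtain i0 :: 'd where True by simp
  define I where "I = UNIV - {i0}"
  have inj: "inj_on (\<lambda>s. restrict s I) {s :: 'd \<Rightarrow> nat. sum s UNIV = j}"
  proof (rule inj_onI, safe)
    fix s t :: "'d \<Rightarrow> nat" assume j: "j = sum s UNIV" "sum t UNIV = sum s UNIV" and r: "restrict s I = restrict t I"
    have e: "s i = t i" if "i \<in> I" for i using r that by (metis restrict_apply')
    have "s i0 + sum s I = t i0 + sum t I"
      using j(2) by (simp add: I_def sum.remove[of UNIV i0])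
    moreover have "sum s I = sum t I" using e by (rule sum.cong[OF refl])
    ultimately have "s i0 = t i0" by simp
    then show "s = t" using e unfolding I_def by (metis DiffI UNIV_I ext singletonD)
  qed
  have "card {s :: 'd \<Rightarrow> nat. sum s UNIV = j} = card ((\<lambda>s. restrict s I) ` {s :: 'd \<Rightarrow> nat. sum s UNIV = j})"
    by (rule card_image[OF inj, symmetric])
  also have "\<dots> \<le> card (PiE I (\<lambda>_. {..j}))"
  proof (rule card_mono)
    show "finite (PiE I (\<lambda>_. {..j}))" by (rule finite_PiE) (auto simp: I_def)
    show "(\<lambda>s. restrict s I) ` {s :: 'd \<Rightarrow> nat. sum s UNIV = j} \<subseteq> PiE I (\<lambda>_. {..j})"
      by (rule image_subsetI, rule restrict_PiE[THEN iffD2])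
         (auto simp: Pi_def intro!: member_le_sum)
  qed
  also have "\<dots> = (j + 1) ^ (CARD('d) - 1)"
    by (subst card_PiE) (auto simp: I_def card_Diff_singleton)
  finally show ?thesis .
qed

definition levset :: "nat \<Rightarrow> ('d::finite \<Rightarrow> int) set" where "levset j = {k. lev k = j}"

lemma levset_UN: "levset j = (\<Union>s\<in>{s :: 'd::finite \<Rightarrow> nat. sum s UNIV = j}. dyadic_block s)"
  by (auto simp: levset_def lev_def dyadic_block_eq)

lemma finite_levset [simp]: "finite (levset j)"
  unfolding levset_UN by auto

lemma disjoint_dyadic_block: "s \<noteq> t \<Longrightarrow> dyadic_block s \<inter> dyadic_block t = {}"
  by (auto simp: dyadic_block_eq fun_eq_iff)

lemma card_levset: "card (levset j :: ('d::finite \<Rightarrow> int) set) \<le> 2 ^ j * (j + 1) ^ (CARD('d) - 1)"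
proof -
  have "card (levset j :: ('d \<Rightarrow> int) set) \<le> (\<Sum>s\<in>{s :: 'd \<Rightarrow> nat. sum s UNIV = j}. card (dyadic_block s))"
    unfolding levset_UN by (rule card_UN_le) simp
  also have "\<dots> \<le> (\<Sum>s\<in>{s :: 'd \<Rightarrow> nat. sum s UNIV = j}. 2 ^ j)"
    by (intro sum_mono) (metis (mono_tags, lifting) card_dyadic_block mem_Collect_eq)
  also have "\<dots> \<le> (j + 1) ^ (CARD('d) - 1) * 2 ^ j"
    using card_multi_deg[where 'd = 'd and j = j] by (simp only: sum_constant of_nat_id) (intro mult_right_mono, simp_all)
  finally show ?thesis by (simp add: mult.commute)
qed

lemma tpoly_UN_disjoint:
  assumes "finite I" "\<And>i. i \<in> I \<Longrightarrow> finite (A i)"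
    "\<And>i j. i \<in> I \<Longrightarrow> j \<in> I \<Longrightarrow> i \<noteq> j \<Longrightarrow> A i \<inter> A j = {}"
  shows "tpoly (\<Union>i\<in>I. A i) c x = (\<Sum>i\<in>I. tpoly (A i) c x)"
  unfolding tpoly_def by (rule sum.UNION_disjoint) (use assms in auto)

lemma f_block_eq: "f_block j f = tpoly (levset j) (fourier_coeff f)"
proof
  fix x
  have "f_block j f x = (\<Sum>s\<in>{s. sum s UNIV = j}. tpoly (dyadic_block s) (fourier_coeff f) x)"
    by (simp add: f_block_def delta_s_def tpoly_def)
  also have "\<dots> = tpoly (levset j) (fourier_coeff f) x"
    unfolding levset_UN by (rule tpoly_UN_disjoint[symmetric]) (auto simp: disjoint_dyadic_block)
  finally show "f_block j f x = tpoly (levset j) (fourier_coeff f) x" .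
qed

lemma prod_max_le_lev: "(\<Prod>i\<in>UNIV. real_of_int (max \<bar>k i\<bar> 1)) \<le> 2 ^ lev (k :: 'd::finite \<Rightarrow> int)"
proof -
  have "real_of_int (max \<bar>n\<bar> 1) \<le> 2 ^ blk n" for n
  proof -
    have "max \<bar>n\<bar> 1 \<le> 2 ^ blk n" using blk_upper[of n] by simp
    then have "real_of_int (max \<bar>n\<bar> 1) \<le> real_of_int (2 ^ blk n)" by (simp only: of_int_le_iff)
    then show ?thesis by simp
  qed
  then have "(\<Prod>i\<in>UNIV. real_of_int (max \<bar>k i\<bar> 1)) \<le> (\<Prod>i\<in>UNIV. 2 ^ blk (k i))"
    by (intro prod_mono) auto
  also have "\<dots> = 2 ^ lev k" by (simp add: lev_def power_sum)
  finally show ?thesis .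
qed

lemma hyp_cross_lev: "lev k \<le> J \<Longrightarrow> k \<in> hyp_cross (2 ^ J)"
  unfolding hyp_cross_def using order.trans[OF prod_max_le_lev power_increasing[of "lev k" J 2]] by simp

lemma hyp_cross_coord:
  fixes k :: "'d::finite \<Rightarrow> int"
  assumes "k \<in> hyp_cross (2 ^ J)" shows "\<bar>k i\<bar> \<le> 2 ^ J"
proof -
  have "real_of_int (max \<bar>k i\<bar> 1) * 1 \<le> real_of_int (max \<bar>k i\<bar> 1) * (\<Prod>j\<in>UNIV-{i}. real_of_int (max \<bar>k j\<bar> 1))"
    by (intro mult_left_mono prod_ge_1) auto
  also have "\<dots> = (\<Prod>j\<in>UNIV. real_of_int (max \<bar>k j\<bar> 1))" by (rule prod.remove[symmetric]) auto
  also have "\<dots> \<le> 2 ^ J" using assms by (simp add: hyp_cross_def)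
  finally have "real_of_int (max \<bar>k i\<bar> 1) \<le> real_of_int (2 ^ J)" by simp
  then have "max \<bar>k i\<bar> 1 \<le> 2 ^ J" by (simp only: of_int_le_iff)
  then show ?thesis by simp
qed

lemma hyp_cross_subset: "(hyp_cross (2 ^ J) :: ('d::finite \<Rightarrow> int) set) \<subseteq> PiE UNIV (\<lambda>_. {- (2 ^ J) .. 2 ^ J})"
proof (intro subsetI PiE_I)
  fix k :: "'d \<Rightarrow> int" and i assume "k \<in> hyp_cross (2 ^ J)"
  from hyp_cross_coord[OF this, of i] show "k i \<in> {- (2 ^ J) .. 2 ^ J}" by (simp add: abs_le_iff)
qed auto

lemma finite_hyp_cross [simp]: "finite (hyp_cross (2 ^ J) :: ('d::finite \<Rightarrow> int) set)"
  by (rule finite_subset[OF hyp_cross_subset]) (auto intro: finite_PiE)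

text \<open>The enclosing cube is a sufficient bound: the cross only has to be polynomial in v, and
  only the logarithm of its size enters the sample size.\<close>

lemma card_hyp_cross_le: "card (hyp_cross (2 ^ J) :: ('d::finite \<Rightarrow> int) set) \<le> (2 * 2 ^ J + 1) ^ CARD('d)"
proof -
  have "card (hyp_cross (2 ^ J) :: ('d \<Rightarrow> int) set) \<le> card (PiE (UNIV::'d set) (\<lambda>_. {- (2 ^ J) .. (2::int) ^ J}))"
    by (intro card_mono hyp_cross_subset finite_PiE) auto
  also have "\<dots> = (2 * 2 ^ J + 1) ^ CARD('d)"
    by (simp add: card_PiE nat_add_distrib nat_mult_distrib nat_power_eq algebra_simps)
  finally show ?thesis .
qed

text \<open>The frequencies 1, ..., 2^J on one axis suffice. The bound guarantees that the cross has
  subsets with v elements.\<close>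

lemma card_hyp_cross_ge: "2 ^ J \<le> card (hyp_cross (2 ^ J) :: ('d::finite \<Rightarrow> int) set)"
proof -
  obtain i0 :: 'd where True by simp
  define u where "u n = (\<lambda>i::'d. if i = i0 then int n else 0)" for n
  have "inj_on u {1..2^J}" by (auto simp: inj_on_def u_def fun_eq_iff split: if_splits)
  then have "2 ^ J = card (u ` {1..2^J})" by (simp add: card_image)
  also have "\<dots> \<le> card (hyp_cross (2 ^ J) :: ('d \<Rightarrow> int) set)"
  proof (intro card_mono finite_hyp_cross, safe)
    fix n :: nat assume n: "n \<in> {1..2^J}"
    have "(\<Prod>j\<in>UNIV. real_of_int (max \<bar>u n j\<bar> 1)) = (\<Prod>j\<in>UNIV. if j = i0 then real n else 1)"
      using n by (intro prod.cong) (auto simp: u_def max_def)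
    also have "\<dots> = real n" by simp
    also have "\<dots> \<le> real (2 ^ J)" using n by (simp only: of_nat_le_iff atLeastAtMost_iff)
    finally show "u n \<in> hyp_cross (2 ^ J)" by (simp add: hyp_cross_def)
  qed
  finally show ?thesis .
qed

text \<open>The absolutely convergent series defines a continuous periodic function h with the
  Fourier coefficients of f, so h and f agree on the torus by uniqueness. The tail estimate is
  trivial for h.\<close>

lemma fourier_series_tail:
  fixes f :: "real^'d::finite \<Rightarrow> complex"
  assumes f: "periodic_cont f" and summ: "summable (\<lambda>j. \<Sum>k\<in>levset j. cmod (fourier_coeff f k))"
    and x: "x \<in> torus"
  shows "cmod (f x - (\<Sum>j<J. tpoly (levset j) (fourier_coeff f) x)) \<le> (\<Sum>j. \<Sum>k\<in>levset (j + J). cmod (fourier_coeff f k))"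
proof -
  define A where "A j = (\<Sum>k\<in>levset j. cmod (fourier_coeff f k))" for j
  define F where "F j = tpoly (levset j) (fourier_coeff f)" for j
  define h where "h x = (\<Sum>j. F j x)" for x
  have contf: "continuous_on UNIV f" using f by (simp add: periodic_cont_def)
  have FA: "cmod (F j x) \<le> A j" for j x
    unfolding F_def A_def tpoly_def by (rule order.trans[OF norm_sum]) (simp add: norm_mult)
  have sA: "summable A" using summ by (simp add: A_def[abs_def])
  have sF: "summable (\<lambda>j. F j x)" for x
    by (rule summable_comparison_test'[OF sA, of 0]) (simp add: FA)
  have tail: "cmod (h x - (\<Sum>j<J. F j x)) \<le> (\<Sum>j. A (j + J))" for J x
  proof -
    have "h x - (\<Sum>j<J. F j x) = (\<Sum>j. F (j + J) x)"
      unfolding h_def by (rule suminf_minus_initial_segment[OF sF, symmetric])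
    also have "cmod \<dots> \<le> (\<Sum>j. A (j + J))"
    proof (rule norm_suminf_le)
      show "summable (\<lambda>n. A (n + J))" using sA by (simp add: summable_iff_shift)
    qed (rule FA)
    finally show ?thesis .
  qed
  have tail0: "(\<lambda>J. \<Sum>j. A (j + J)) \<longlonglongrightarrow> 0" by (rule suminf_exist_split2[OF sA])
  have F_cont: "continuous_on T (F j)" for j T
    unfolding F_def by (intro continuous_intros)
  have unif: "uniform_limit UNIV (\<lambda>n x. \<Sum>j<n. F j x) h sequentially"
    unfolding h_def by (rule Weierstrass_m_test[OF _ sA]) (rule FA)
  have h_cont: "continuous_on UNIV h"
    by (rule uniform_limit_theorem[OF _ unif]) (auto intro!: always_eventually continuous_on_sum F_cont)
  have expk_per: "expk k (x + (2 * pi) *\<^sub>R axis i 1) = expk k x" for k x and i :: 'd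
  proof -
    have "kdot k (x + (2 * pi) *\<^sub>R axis i 1) = kdot k x + 2 * pi * of_int (k i)"
    proof -
      have "kdot k (x + (2 * pi) *\<^sub>R axis i 1) = (\<Sum>j\<in>UNIV. of_int (k j) * x $ j + (if j = i then 2 * pi * of_int (k i) else 0))"
        unfolding kdot_def by (intro sum.cong) (auto simp: axis_def algebra_simps)
      then show ?thesis by (simp add: sum.distrib kdot_def)
    qed
    then show ?thesis by (simp add: expk_def cis_mult[symmetric] cis_multiple_2pi)
  qed
  have h_per: "h (x + (2 * pi) *\<^sub>R axis i 1) = h x" for x i
    by (simp add: h_def F_def tpoly_def expk_per)
  have coef: "(\<integral>x. h x * cnj (expk k x) \<partial>torus_measure) = fourier_coeff f k" for k
  proof -
    \<comment> \<open>Once J exceeds the layer of k, the partial sum has exactly the coefficient of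
      f at k, so the error is at most a tail that tends to 0.\<close>
    have "cmod ((\<integral>x. h x * cnj (expk k x) \<partial>torus_measure) - fourier_coeff f k) \<le> (\<Sum>j. A (j + J))" if "lev k < J" for J
    proof -
      have int: "integrable torus_measure (\<lambda>x. h x * cnj (expk k x))" "integrable torus_measure (\<lambda>x. (\<Sum>j<J. F j x) * cnj (expk k x))"
         "\<And>j. integrable torus_measure (\<lambda>x. F j x * cnj (expk k x))"
        by (intro integrable_torus_measure continuous_on_mult h_cont continuous_on_cnj continuous_on_expk
              continuous_on_id continuous_on_sum F_cont)+
      have "(\<integral>x. (\<Sum>j<J. F j x) * cnj (expk k x) \<partial>torus_measure) = (\<Sum>j<J. \<integral>x. F j x * cnj (expk k x) \<partial>torus_measure)"
        unfolding sum_distrib_right by (rule Bochner_Integration.integral_sum) (rule int)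
      also have "\<dots> = (\<Sum>j<J. if lev k = j then fourier_coeff f k else 0)"
        unfolding F_def by (simp only: fourier_coeff_tpoly[OF finite_levset]) (simp only: levset_def mem_Collect_eq)
      also have "\<dots> = fourier_coeff f k" using that by simp
      finally have "(\<integral>x. h x * cnj (expk k x) \<partial>torus_measure) - fourier_coeff f k =
          (\<integral>x. (h x - (\<Sum>j<J. F j x)) * cnj (expk k x) \<partial>torus_measure)"
        using int by (simp add: left_diff_distrib)
      also have "cmod \<dots> \<le> (\<integral>x. cmod ((h x - (\<Sum>j<J. F j x)) * cnj (expk k x)) \<partial>torus_measure)"
        by (rule integral_norm_bound)
      also have "\<dots> \<le> (\<integral>x. (\<Sum>j. A (j + J)) \<partial>(torus_measure :: (real^'d) measure))"
        using tail
        by (intro integral_mono integrable_torus_measure continuous_on_mult h_cont continuous_on_cnj continuous_on_expk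
              continuous_on_id continuous_on_sum F_cont continuous_on_norm continuous_on_diff continuous_on_const) (auto simp: norm_mult)
      finally show ?thesis by simp
    qed
    then have "\<forall>\<^sub>F J in sequentially. cmod ((\<integral>x. h x * cnj (expk k x) \<partial>torus_measure) - fourier_coeff f k) \<le> (\<Sum>j. A (j + J))"
      by (intro eventually_sequentiallyI[of "Suc (lev k)"]) auto
    then have "cmod ((\<integral>x. h x * cnj (expk k x) \<partial>torus_measure) - fourier_coeff f k) \<le> 0"
      by (rule tendsto_lowerbound[OF tail0]) simp
    then show ?thesis by simp
  qed
  have "f x - h x = 0"
  proof (rule fourier_uniqueness[OF _ _ x])
    show "periodic_cont (\<lambda>x. f x - h x)"
      using f h_cont h_per by (auto simp: periodic_cont_def intro!: continuous_intros)
    fix k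
    have "(\<integral>x. (f x - h x) * cnj (expk k x) \<partial>torus_measure) =
       (\<integral>x. f x * cnj (expk k x) \<partial>torus_measure) - (\<integral>x. h x * cnj (expk k x) \<partial>torus_measure)"
      unfolding left_diff_distrib
      by (rule Bochner_Integration.integral_diff)
         (intro integrable_torus_measure continuous_on_mult h_cont contf continuous_on_cnj continuous_on_expk continuous_on_id)+
    then show "(\<integral>x. (f x - h x) * cnj (expk k x) \<partial>torus_measure) = 0"
      by (simp add: coef fourier_coeff_torus_measure[OF contf])
  qed
  then show ?thesis using tail[of x J] by (simp add: F_def A_def)
qed

section \<open>Absolute sums of Fourier coefficients over a hyperbolic layer\<close>

text \<open>Jensen's inequality for the power q, applied to the values h_s / w_s with weights
  proportional to w_s.\<close>

lemma sum_powr_le_weighted: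
  fixes h w :: "'a \<Rightarrow> real"
  assumes fin: "finite S" and h: "\<And>s. s \<in> S \<Longrightarrow> 0 \<le> h s" and w: "\<And>s. s \<in> S \<Longrightarrow> 0 < w s" and q: "1 \<le> q"
  shows "(\<Sum>s\<in>S. h s) powr q \<le> (\<Sum>s\<in>S. w s) powr (q - 1) * (\<Sum>s\<in>S. h s powr q * w s powr (1 - q))"
proof -
  \<comment> \<open>Vanishing terms are dropped because convexity is used on the positive
    reals.\<close>
  define S' where "S' = {s \<in> S. 0 < h s}"
  define T where "T = (\<Sum>s\<in>S'. w s)"
  have S': "finite S'" "S' \<subseteq> S" using fin by (auto simp: S'_def)
  have hS': "(\<Sum>s\<in>S. h s) = (\<Sum>s\<in>S'. h s)"
    by (rule sum.mono_neutral_right[OF fin S'(2)]) (use h in \<open>auto simp: S'_def not_less antisym\<close>)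
  have RHS0: "0 \<le> (\<Sum>s\<in>S. h s powr q * w s powr (1 - q))" by (intro sum_nonneg) simp
  show ?thesis
  proof (cases "S' = {}")
    case True
    then show ?thesis using hS' RHS0 by simp
  next
    case False
    have wS': "0 < w s" if "s \<in> S'" for s using that w S' by auto
    have T: "0 < T" unfolding T_def by (rule sum_pos[OF S'(1) False]) (rule wS')
    have "(\<lambda>x. x powr q) (\<Sum>s\<in>S'. (w s / T) *\<^sub>R (h s / w s)) \<le> (\<Sum>s\<in>S'. (w s / T) * (h s / w s) powr q)"
    proof (rule convex_on_sum[OF S'(1) False powr_convex[OF q]])
      show "(\<Sum>s\<in>S'. w s / T) = 1" using T by (simp add: T_def flip: sum_divide_distrib)
      show "0 \<le> w s / T" "h s / w s \<in> {0<..}" if "s \<in> S'" for s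
        using wS'[OF that] that T by (auto simp: S'_def)
    qed
    also have "(\<Sum>s\<in>S'. (w s / T) *\<^sub>R (h s / w s)) = (\<Sum>s\<in>S'. h s) / T"
      unfolding sum_divide_distrib by (intro sum.cong refl) (use wS' in force)
    also have "(\<Sum>s\<in>S'. (w s / T) * (h s / w s) powr q) = (\<Sum>s\<in>S'. h s powr q * w s powr (1 - q)) / T"
      unfolding sum_divide_distrib
    proof (intro sum.cong refl)
      fix s assume s: "s \<in> S'"
      then show "(w s / T) * (h s / w s) powr q = h s powr q * w s powr (1 - q) / T"
        using wS'[OF s] by (simp add: powr_divide powr_diff S'_def mult_ac)
    qed
    finally have "((\<Sum>s\<in>S'. h s) / T) powr q \<le> (\<Sum>s\<in>S'. h s powr q * w s powr (1 - q)) / T" .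
    moreover have "((\<Sum>s\<in>S'. h s) / T) powr q = (\<Sum>s\<in>S'. h s) powr q / T powr q"
      by (rule powr_divide)
    ultimately have "(\<Sum>s\<in>S'. h s) powr q / T powr q \<le> (\<Sum>s\<in>S'. h s powr q * w s powr (1 - q)) / T"
      by simp
    then have "(\<Sum>s\<in>S'. h s) powr q \<le> (\<Sum>s\<in>S'. h s powr q * w s powr (1 - q)) / T * T powr q"
      using T by (subst (asm) pos_divide_le_eq) auto
    then have "(\<Sum>s\<in>S'. h s) powr q \<le> T powr q / T * (\<Sum>s\<in>S'. h s powr q * w s powr (1 - q))"
      by (simp add: mult_ac)
    also have "T powr q / T = T powr (q - 1)" using T by (simp add: powr_diff)
    also have "T powr (q - 1) * (\<Sum>s\<in>S'. h s powr q * w s powr (1 - q)) \<le>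
       (\<Sum>s\<in>S. w s) powr (q - 1) * (\<Sum>s\<in>S. h s powr q * w s powr (1 - q))"
    proof (intro mult_mono powr_mono2 sum_mono2 fin S' sum_nonneg)
      show "T \<le> (\<Sum>s\<in>S. w s)" unfolding T_def by (intro sum_mono2 fin S') (use w in force)
    qed (use q T in auto)
    finally show ?thesis using hS' by simp
  qed
qed

text \<open>Comparing all terms with the largest one avoids any multilinear expansion of the power.\<close>
lemma sum_powr_le_pairs:
  fixes h :: "'a \<Rightarrow> real" and w :: "'a \<Rightarrow> 'a \<Rightarrow> real"
  assumes fin: "finite S" and h: "\<And>s. s \<in> S \<Longrightarrow> 0 \<le> h s" and w: "\<And>s t. 0 < w s t" and q: "1 \<le> q"
    and Z: "\<And>t. t \<in> S \<Longrightarrow> (\<Sum>s\<in>S. w s t) \<le> Z"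
  shows "(\<Sum>s\<in>S. h s) powr q \<le> Z powr (q - 1) * (\<Sum>s\<in>S. \<Sum>t\<in>S. (h s * h t) powr (q / 2) * w s t powr (1 - q))"
proof (cases "S = {}")
  case False
  have "finite (h ` S)" "h ` S \<noteq> {}" using fin False by auto
  then have "Max (h ` S) \<in> h ` S" by (rule Max_in)
  then obtain t where t: "t \<in> S" "h t = Max (h ` S)" by auto
  then have ht: "h s \<le> h t" if "s \<in> S" for s using fin that by simp
  have "(\<Sum>s\<in>S. h s) powr q \<le> (\<Sum>s\<in>S. w s t) powr (q - 1) * (\<Sum>s\<in>S. h s powr q * w s t powr (1 - q))"
    by (rule sum_powr_le_weighted) (use fin h w q in auto)
  also have "\<dots> \<le> Z powr (q - 1) * (\<Sum>s\<in>S. \<Sum>t\<in>S. (h s * h t) powr (q / 2) * w s t powr (1 - q))"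
  proof (intro mult_mono powr_mono2 sum_mono)
    fix s assume s: "s \<in> S"
    have "h s powr q = (h s * h s) powr (q / 2)"
      using h[OF s] by (simp add: powr_mult flip: powr_add)
    also have "\<dots> \<le> (h s * h t) powr (q / 2)"
      using h[OF s] ht[OF s] q by (intro powr_mono2 mult_left_mono) auto
    finally have "h s powr q * w s t powr (1 - q) \<le> (h s * h t) powr (q / 2) * w s t powr (1 - q)"
      by (rule mult_right_mono) simp
    \<comment> \<open>In the application the terms depend on a point x, and so does the index t of
      the largest one. Summing over all t gives a bound that can be integrated term by term.\<close>
    also have "\<dots> \<le> (\<Sum>t\<in>S. (h s * h t) powr (q / 2) * w s t powr (1 - q))"
      by (rule member_le_sum[OF t(1)]) (use fin in auto)
    finally show "h s powr q * w s t powr (1 - q) \<le> (\<Sum>t\<in>S. (h s * h t) powr (q / 2) * w s t powr (1 - q))" .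
  qed (use q Z t w in \<open>auto intro!: sum_nonneg less_imp_le[OF w]\<close>)
  finally show ?thesis .
qed simp

text \<open>Interpolation between first and second moments with a free threshold t: below t the
  first term dominates, above t the second. The caller chooses t to balance the two moments.\<close>

lemma powr_le_interpolate:
  fixes y t r :: real
  assumes "0 \<le> y" "0 < t" "1 \<le> r" "r \<le> 2"
  shows "y powr r \<le> y * t powr (r - 1) + y\<^sup>2 * t powr (r - 2)"
proof (cases "y \<le> t")
  case True
  show ?thesis
  proof (cases "y = 0")
    case False
    then have "y powr r = y * y powr (r - 1)" using assms by (simp add: powr_diff)
    also have "\<dots> \<le> y * t powr (r - 1)" using True assms by (intro mult_left_mono powr_mono2) auto
    also have "\<dots> \<le> y * t powr (r - 1) + y\<^sup>2 * t powr (r - 2)" by simp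
    finally show ?thesis .
  qed simp
next
  case False
  then have "y powr r = y\<^sup>2 * y powr (r - 2)" using assms by (simp add: powr_diff)
  also have "\<dots> \<le> y\<^sup>2 * t powr (r - 2)" using False assms by (intro mult_left_mono powr_mono2') auto
  also have "\<dots> \<le> y * t powr (r - 1) + y\<^sup>2 * t powr (r - 2)" using assms by simp
  finally show ?thesis .
qed

lemma sum_geometric_dist_le:
  fixes x :: real and j t :: nat
  assumes "0 < x" "x < 1"
  shows "(\<Sum>n\<le>j. x powr \<bar>real n - real t\<bar>) \<le> 2 / (1 - x)"
proof -
  have geo: "(\<Sum>n\<in>A. x ^ n) \<le> 1 / (1 - x)" if "finite A" for A
  proof -
    have "(\<Sum>n\<in>A. x ^ n) \<le> (\<Sum>n. x ^ n)"
      using assms that by (intro sum_le_suminf summable_geometric) auto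
    then show ?thesis using assms by (simp add: suminf_geometric)
  qed
  have "(\<Sum>n\<le>j. x powr \<bar>real n - real t\<bar>) \<le> (\<Sum>n\<in>{..t} \<union> {t..j}. x powr \<bar>real n - real t\<bar>)"
    by (intro sum_mono2) auto
  also have "\<dots> \<le> (\<Sum>n\<le>t. x powr \<bar>real n - real t\<bar>) + (\<Sum>n\<in>{t..j}. x powr \<bar>real n - real t\<bar>)"
    by (subst sum_Un) (auto intro!: sum_nonneg)
  also have "(\<Sum>n\<le>t. x powr \<bar>real n - real t\<bar>) = (\<Sum>n\<le>t. x ^ (t - n))"
  proof (intro sum.cong refl)
    fix n assume "n \<in> {..t}"
    then have "\<bar>real n - real t\<bar> = real (t - n)" by (simp add: of_nat_diff)
    then show "x powr \<bar>real n - real t\<bar> = x ^ (t - n)" by (simp only: powr_realpow[OF assms(1)])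
  qed
  also have "\<dots> = (\<Sum>n\<le>t. x ^ n)"
    by (rule sum.reindex_bij_witness[of _ "\<lambda>n. t - n" "\<lambda>n. t - n"]) auto
  also have "(\<Sum>n\<in>{t..j}. x powr \<bar>real n - real t\<bar>) = (\<Sum>n\<in>{t..j}. x ^ (n - t))"
  proof (intro sum.cong refl)
    fix n assume "n \<in> {t..j}"
    then have "\<bar>real n - real t\<bar> = real (n - t)" by (simp add: of_nat_diff)
    then show "x powr \<bar>real n - real t\<bar> = x ^ (n - t)" by (simp only: powr_realpow[OF assms(1)])
  qed
  also have "\<dots> = (\<Sum>m\<in>(\<lambda>n. n - t) ` {t..j}. x ^ m)"
    by (subst sum.reindex) (auto simp: inj_on_def)
  finally show ?thesis using geo[of "{..t}"] geo[of "(\<lambda>n. n - t) ` {t..j}"] by simp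
qed

section \<open>Interaction of two dyadic blocks\<close>

definition mdist :: "('d::finite \<Rightarrow> nat) \<Rightarrow> ('d \<Rightarrow> nat) \<Rightarrow> real" where
  "mdist s t = (\<Sum>i\<in>UNIV. \<bar>real (s i) - real (t i)\<bar>)"

text \<open>Enlarging the simplex of indices to a cube makes the sum factorize into geometric
  series. The bound is uniform in j and t, so no power of j is lost here.\<close>

lemma sum_powr_mdist_le:
  fixes x :: real and t :: "'d::finite \<Rightarrow> nat"
  assumes x: "0 < x" "x < 1"
  shows "(\<Sum>s\<in>{s. sum s UNIV = j}. x powr mdist s t) \<le> (2 / (1 - x)) ^ CARD('d)"
proof -
  have "(\<Sum>s\<in>{s. sum s UNIV = j}. x powr mdist s t) \<le> (\<Sum>s\<in>PiE UNIV (\<lambda>_. {..j}). x powr mdist s t)"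
  proof (rule sum_mono2)
    show "finite (PiE (UNIV :: 'd set) (\<lambda>_. {..j}))" by (rule finite_PiE) auto
    show "{s. sum s UNIV = j} \<subseteq> PiE (UNIV :: 'd set) (\<lambda>_. {..j})"
      by (auto simp: PiE_def Pi_def intro!: member_le_sum)
  qed auto
  also have "\<dots> = (\<Sum>s\<in>PiE UNIV (\<lambda>_. {..j}). \<Prod>i\<in>UNIV. x powr \<bar>real (s i) - real (t i)\<bar>)"
    unfolding mdist_def using x by (intro sum.cong refl powr_sum) auto
  also have "\<dots> = (\<Prod>i\<in>UNIV. \<Sum>n\<le>j. x powr \<bar>real n - real (t i)\<bar>)"
    by (rule prod_sum_PiE[symmetric]) auto
  also have "\<dots> \<le> (\<Prod>i\<in>(UNIV::'d set). 2 / (1 - x))"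
    using x by (intro prod_mono conjI sum_nonneg sum_geometric_dist_le) auto
  finally show ?thesis by simp
qed

lemma cmod_tpoly_le_card: "(\<And>k. k \<in> K \<Longrightarrow> cmod (c k) \<le> 1) \<Longrightarrow> cmod (tpoly K c x) \<le> real (card K)"
  unfolding tpoly_def by (rule order.trans[OF norm_sum], rule order.trans[OF sum_bounded_above[where K = 1]]) (auto simp: norm_mult)

text \<open>By Parseval the integral is the square sum of the coefficients of the product. Such a
  coefficient is at most the number of representations of l as a sum of one frequency from each
  block, and in each coordinate that number is at most the size of the smaller block.\<close>

lemma integral_tpoly_product_le:
  fixes s t :: "'d::finite \<Rightarrow> nat"
  assumes c: "\<And>k. cmod (c k) \<le> 1" and c': "\<And>k. cmod (c' k) \<le> 1"
  shows "(\<integral>x. (cmod (tpoly (dyadic_block s) c x) * cmod (tpoly (dyadic_block t) c' x))\<^sup>2 \<partial>torus_measure)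
    \<le> 2 ^ (\<Sum>i\<in>UNIV. min (s i) (t i)) * 2 ^ sum s UNIV * 2 ^ sum t UNIV"
proof -
  let ?A = "dyadic_block s" and ?B = "dyadic_block t"
  define add where "add = (\<lambda>(k, l) i::'d. (k i + l i :: int))"
  define L where "L = add ` (?A \<times> ?B)"
  define N where "N l = {p \<in> ?A \<times> ?B. add p = l}" for l
  define C where "C l = (\<Sum>p\<in>N l. c (fst p) * c' (snd p))" for l
  have fin: "finite L" "finite (?A \<times> ?B)" "finite (N l)" for l by (auto simp: L_def N_def)
  have prod: "tpoly ?A c x * tpoly ?B c' x = tpoly L C x" for x
  proof -
    have "tpoly ?A c x * tpoly ?B c' x = (\<Sum>p\<in>?A \<times> ?B. c (fst p) * c' (snd p) * expk (add p) x)"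
      unfolding tpoly_def sum_product sum.cartesian_product
      by (intro sum.cong) (auto simp: add_def expk_mult[symmetric])
    also have "\<dots> = (\<Sum>l\<in>L. \<Sum>p\<in>N l. c (fst p) * c' (snd p) * expk (add p) x)"
      unfolding N_def by (rule sum.group[symmetric]) (auto simp: fin L_def)
    also have "\<dots> = tpoly L C x"
      unfolding tpoly_def C_def sum_distrib_right by (intro sum.cong) (auto simp: N_def)
    finally show ?thesis .
  qed
  have C1: "cmod (C l) \<le> real (card (N l))" for l
    unfolding C_def
    by (rule order.trans[OF norm_sum], rule order.trans[OF sum_bounded_above[where K = 1]])
       (auto simp: norm_mult intro!: mult_le_one c c')
  have cardN: "card (N l) \<le> 2 ^ (\<Sum>i\<in>UNIV. min (s i) (t i))" for l
  proof -
    have "inj_on fst (N l)" by (rule inj_onI) (auto simp: N_def add_def fun_eq_iff, metis add_left_cancel)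
    then have "card (N l) = card (fst ` N l)" by (simp add: card_image)
    also have "\<dots> \<le> card (PiE UNIV (\<lambda>i. {n. blk n = s i} \<inter> {n. blk (l i - n) = t i}))"
      by (intro card_mono finite_PiE) (auto simp: N_def add_def dyadic_block_eq PiE_def Pi_def)
    also have "\<dots> = (\<Prod>i\<in>UNIV. card ({n. blk n = s i} \<inter> {n. blk (l i - n) = t i}))" by (rule card_PiE) simp
    also have "\<dots> \<le> (\<Prod>i\<in>UNIV. 2 ^ min (s i) (t i))"
    proof (intro prod_mono conjI)
      fix i
      have "card ({n. blk n = s i} \<inter> {n. blk (l i - n) = t i}) \<le> card {n. blk n = s i}"
        by (intro card_mono) auto
      moreover have "card ({n. blk n = s i} \<inter> {n. blk (l i - n) = t i}) \<le> card {n. blk n = t i}"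
        by (rule card_inj_on_le[of "\<lambda>n. l i - n"]) (auto simp: inj_on_def)
      ultimately show "card ({n. blk n = s i} \<inter> {n. blk (l i - n) = t i}) \<le> 2 ^ min (s i) (t i)"
        using card_blk_fiber[of "s i"] card_blk_fiber[of "t i"] by (auto simp: min_def)
    qed simp
    also have "\<dots> = 2 ^ (\<Sum>i\<in>UNIV. min (s i) (t i))" by (simp add: power_sum)
    finally show ?thesis .
  qed
  have "(\<integral>x. (cmod (tpoly ?A c x) * cmod (tpoly ?B c' x))\<^sup>2 \<partial>torus_measure) = (\<Sum>l\<in>L. (cmod (C l))\<^sup>2)"
    by (simp only: norm_mult[symmetric] prod parseval_tpoly[OF fin(1)])
  \<comment> \<open>One factor is bounded by the maximal number of representations; the other is
    kept, because its sum over l counts all pairs.\<close>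
  also have "\<dots> \<le> (\<Sum>l\<in>L. 2 ^ (\<Sum>i\<in>UNIV. min (s i) (t i)) * real (card (N l)))"
  proof (rule sum_mono)
    fix l
    have "real (card (N l)) \<le> 2 ^ (\<Sum>i\<in>UNIV. min (s i) (t i))"
      using of_nat_mono[OF cardN[of l], where 'a = real] by simp
    then show "(cmod (C l))\<^sup>2 \<le> 2 ^ (\<Sum>i\<in>UNIV. min (s i) (t i)) * real (card (N l))"
      unfolding power2_eq_square using C1[of l] order.trans[OF C1[of l]] by (intro mult_mono) auto
  qed
  also have "\<dots> = 2 ^ (\<Sum>i\<in>UNIV. min (s i) (t i)) * real (\<Sum>l\<in>L. card (N l))"
    by (simp add: sum_distrib_left)
  also have "(\<Sum>l\<in>L. card (N l)) = card (?A \<times> ?B)"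
    unfolding N_def card_eq_sum by (rule sum.group) (auto simp: fin L_def)
  also have "real (card (?A \<times> ?B)) \<le> 2 ^ sum s UNIV * 2 ^ sum t UNIV"
  proof -
    have "card (?A \<times> ?B) \<le> 2 ^ sum s UNIV * 2 ^ sum t UNIV"
      unfolding card_cartesian_product by (intro mult_mono card_dyadic_block) auto
    then have "real (card (?A \<times> ?B)) \<le> real (2 ^ sum s UNIV * 2 ^ sum t UNIV)" by (simp only: of_nat_le_iff)
    then show ?thesis by simp
  qed
  finally show ?thesis by (simp add: mult_left_mono mult.assoc)
qed

text \<open>For two blocks of layer j the sum of the minima is j - \<open>mdist s t / 2\<close>:
  this is the exponential decay in the distance of the blocks.\<close>

lemma sum_min_eq_mdist:
  fixes s t :: "'d::finite \<Rightarrow> nat"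
  shows "real (\<Sum>i\<in>UNIV. min (s i) (t i)) = (real (sum s UNIV) + real (sum t UNIV) - mdist s t) / 2"
proof -
  have "real (\<Sum>i\<in>UNIV. min (s i) (t i)) = (\<Sum>i\<in>UNIV. (real (s i) + real (t i) - \<bar>real (s i) - real (t i)\<bar>) / 2)"
    unfolding of_nat_sum by (intro sum.cong) (auto simp: min_def)
  also have "\<dots> = (real (sum s UNIV) + real (sum t UNIV) - mdist s t) / 2"
    by (simp add: mdist_def sum.distrib sum_subtractf flip: sum_divide_distrib)
  finally show ?thesis .
qed

lemma continuous_on_powr_nonneg:
  fixes f :: "'a::topological_space \<Rightarrow> real"
  assumes "continuous_on S f" "\<And>x. 0 \<le> f x" "0 < q"
  shows "continuous_on S (\<lambda>x. f x powr q)"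
  by (rule continuous_on_powr') (use assms in \<open>auto intro: continuous_on_const\<close>)

text \<open>The product y of the two moduli has first moment at most 2^j, second moment at most
  2^(3j-D) with D half the distance, and supremum at most 2^(2j). Only the second moment sees the
  distance. Interpolating at an exponent r > 1 therefore inherits decay at rate r - 1, which is
  positive because q > 2.\<close>

lemma integral_pair_powr_le:
  fixes s t :: "'d::finite \<Rightarrow> nat"
  assumes s: "sum s UNIV = j" and t: "sum t UNIV = j" and c: "\<And>k. cmod (c k) \<le> 1" and q: "2 < q"
  defines "r \<equiv> min (q / 2) 2"
  shows "(\<integral>x. (cmod (tpoly (dyadic_block s) c x) * cmod (tpoly (dyadic_block t) c x)) powr (q / 2) \<partial>torus_measure)
    \<le> 2 * 2 powr (real j * (q - 1)) * 2 powr (- (r - 1) * (mdist s t / 2))"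
proof -
  let ?g = "\<lambda>s x. cmod (tpoly (dyadic_block s) c x)"
  define y where "y x = ?g s x * ?g t x" for x
  define D where "D = mdist s t / 2"
  \<comment> \<open>The ratio of the two moment bounds; with this threshold both interpolation terms
    coincide.\<close>
  define \<tau> where "\<tau> = 2 powr (2 * real j - D)"
  have r: "1 < r" "r \<le> 2" "r \<le> q / 2" using q by (auto simp: r_def)
  have cont: "continuous_on UNIV y" "continuous_on UNIV (?g s)" "continuous_on UNIV (?g t)"
    unfolding y_def by (intro continuous_intros)+
  have y0: "0 \<le> y x" for x by (simp add: y_def)
  have card: "real (card (dyadic_block s)) \<le> 2 powr real j" if "sum s UNIV = j" for s :: "'d \<Rightarrow> nat"
    using of_nat_mono[OF card_dyadic_block[of s], where 'a = real] that by (simp add: powr_realpow)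
  have gB: "?g s x \<le> 2 powr real j" if "sum s UNIV = j" for s and x
    using order.trans[OF cmod_tpoly_le_card card[OF that]] c by blast
  have yB: "y x \<le> 2 powr (2 * real j)" for x
    using mult_mono[OF gB[OF s] gB[OF t], of x x] by (simp add: y_def flip: powr_add)
  have L2: "(\<integral>x. (?g s x)\<^sup>2 \<partial>torus_measure) \<le> 2 powr real j" if "sum s UNIV = j" for s
  proof -
    have "(\<integral>x. (?g s x)\<^sup>2 \<partial>torus_measure) = (\<Sum>k\<in>dyadic_block s. (cmod (c k))\<^sup>2)"
      by (rule parseval_tpoly) simp
    also have "\<dots> \<le> real (card (dyadic_block s))"
      by (rule order.trans[OF sum_bounded_above[where K = 1]]) (auto simp: power_le_one c)
    finally show ?thesis using card[OF that] by simp
  qed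
  have int1: "(\<integral>x. y x \<partial>torus_measure) \<le> 2 powr real j"
  proof -
    have "(\<integral>x. y x \<partial>torus_measure) \<le> (\<integral>x. ((?g s x)\<^sup>2 + (?g t x)\<^sup>2) / 2 \<partial>torus_measure)"
    proof (intro integral_mono integrable_torus_measure continuous_intros cont)
      fix x show "y x \<le> ((?g s x)\<^sup>2 + (?g t x)\<^sup>2) / 2"
        using sum_squares_bound[of "?g s x" "?g t x"] by (simp add: y_def)
    qed simp
    also have "\<dots> = ((\<integral>x. (?g s x)\<^sup>2 \<partial>torus_measure) + (\<integral>x. (?g t x)\<^sup>2 \<partial>torus_measure)) / 2"
      by (simp add: Bochner_Integration.integral_add integrable_torus_measure continuous_intros cont)
    also have "\<dots> \<le> 2 powr real j" using L2[OF s] L2[OF t] by simp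
    finally show ?thesis .
  qed
  have int2: "(\<integral>x. (y x)\<^sup>2 \<partial>torus_measure) \<le> 2 powr (3 * real j - D)"
  proof -
    have "(\<integral>x. (y x)\<^sup>2 \<partial>torus_measure) \<le> 2 ^ (\<Sum>i\<in>UNIV. min (s i) (t i)) * 2 ^ sum s UNIV * 2 ^ sum t UNIV"
      unfolding y_def by (rule integral_tpoly_product_le) (rule c)+
    also have "\<dots> = 2 powr (real (\<Sum>i\<in>UNIV. min (s i) (t i)) + real j + real j)"
      unfolding powr_add by (simp only: powr_realpow zero_less_numeral s t)
    also have "\<dots> = 2 powr (3 * real j - D)"
      unfolding sum_min_eq_mdist s t D_def by (simp add: field_simps)
    finally show ?thesis .
  qed
  have "(\<integral>x. y x powr (q / 2) \<partial>torus_measure) \<le>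
     (\<integral>x. (2 powr (2 * real j)) powr (q / 2 - r) * (y x * \<tau> powr (r - 1) + (y x)\<^sup>2 * \<tau> powr (r - 2)) \<partial>torus_measure)"
  proof (rule integral_mono)
    show "integrable torus_measure (\<lambda>x. y x powr (q / 2))"
      using q by (intro integrable_torus_measure continuous_on_powr_nonneg cont y0) simp
    show "integrable torus_measure (\<lambda>x. (2 powr (2 * real j)) powr (q / 2 - r) * (y x * \<tau> powr (r - 1) + (y x)\<^sup>2 * \<tau> powr (r - 2)))"
      by (intro integrable_torus_measure continuous_on_mult continuous_on_add continuous_on_const continuous_on_power cont)
    fix x
    \<comment> \<open>The excess q/2 - r is nonzero only for q > 4 and is covered by the bound on
      the supremum.\<close>
    have "y x powr (q / 2) = y x powr (q / 2 - r) * y x powr r" by (simp flip: powr_add)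
    also have "\<dots> \<le> (2 powr (2 * real j)) powr (q / 2 - r) * (y x * \<tau> powr (r - 1) + (y x)\<^sup>2 * \<tau> powr (r - 2))"
    proof (rule mult_mono)
      show "y x powr (q / 2 - r) \<le> (2 powr (2 * real j)) powr (q / 2 - r)"
        using r y0 yB by (intro powr_mono2) auto
      show "y x powr r \<le> y x * \<tau> powr (r - 1) + (y x)\<^sup>2 * \<tau> powr (r - 2)"
        using r y0 by (intro powr_le_interpolate) (auto simp: \<tau>_def)
    qed auto
    finally show "y x powr (q / 2) \<le> (2 powr (2 * real j)) powr (q / 2 - r) * (y x * \<tau> powr (r - 1) + (y x)\<^sup>2 * \<tau> powr (r - 2))" .
  qed
  also have "\<dots> = (2 powr (2 * real j)) powr (q / 2 - r) * ((\<integral>x. y x \<partial>torus_measure) * \<tau> powr (r - 1) + (\<integral>x. (y x)\<^sup>2 \<partial>torus_measure) * \<tau> powr (r - 2))"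
    by (simp add: Bochner_Integration.integral_add integrable_torus_measure continuous_intros cont)
  also have "\<dots> \<le> (2 powr (2 * real j)) powr (q / 2 - r) * (2 powr real j * \<tau> powr (r - 1) + 2 powr (3 * real j - D) * \<tau> powr (r - 2))"
    by (intro mult_left_mono add_mono mult_right_mono int1 int2) auto
  also have "\<dots> = 2 powr (2 * real j * (q / 2 - r) + real j + (2 * real j - D) * (r - 1))
      + 2 powr (2 * real j * (q / 2 - r) + (3 * real j - D) + (2 * real j - D) * (r - 2))"
    by (simp add: \<tau>_def powr_powr powr_add distrib_left mult.assoc)
  also have "2 * real j * (q / 2 - r) + real j + (2 * real j - D) * (r - 1) = real j * (q - 1) + - (r - 1) * D"
    by (simp add: algebra_simps)
  also have "2 * real j * (q / 2 - r) + (3 * real j - D) + (2 * real j - D) * (r - 2) = real j * (q - 1) + - (r - 1) * D"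
    by (simp add: algebra_simps)
  also have "2 powr (real j * (q - 1) + - (r - 1) * D) + 2 powr (real j * (q - 1) + - (r - 1) * D) =
     2 * 2 powr (real j * (q - 1)) * 2 powr (- (r - 1) * D)" by (simp add: powr_add)
  finally show ?thesis by (simp add: y_def D_def)
qed

text \<open>The layer has about j^(d-1) blocks, and the integral of the power q grows only linearly
  in their number: in the double sum over pairs, each t sees a convergent sum over s. For q = 2 the
  decay degenerates, but Parseval gives the bound directly.\<close>

lemma dual_Lq_bound:
  fixes q :: real
  assumes q: "2 \<le> q"
  obtains C where "0 < C" "\<And>j c. (\<And>k :: 'd::finite \<Rightarrow> int. cmod (c k) \<le> 1) \<Longrightarrow>
      (\<integral>x. cmod (tpoly (levset j) c x) powr q \<partial>torus_measure) \<le> C * 2 powr (real j * (q - 1)) * (real j + 1) ^ (CARD('d) - 1)"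
proof (cases "q = 2")
  case True
  show ?thesis
  proof (rule that[of 1])
    fix j and c :: "('d \<Rightarrow> int) \<Rightarrow> complex" assume c: "\<And>k. cmod (c k) \<le> 1"
    have "(\<integral>x. cmod (tpoly (levset j) c x) powr q \<partial>torus_measure) = (\<integral>x. (cmod (tpoly (levset j) c x))\<^sup>2 \<partial>torus_measure)"
      by (simp add: True)
    also have "\<dots> = (\<Sum>k\<in>levset j. (cmod (c k))\<^sup>2)" by (rule parseval_tpoly) simp
    also have "\<dots> \<le> real (card (levset j :: ('d \<Rightarrow> int) set))"
      by (rule order.trans[OF sum_bounded_above[where K = 1]]) (auto simp: power_le_one c)
    also have "\<dots> \<le> 1 * 2 powr (real j * (q - 1)) * (real j + 1) ^ (CARD('d) - 1)"
      using of_nat_mono[OF card_levset[where 'd = 'd and j = j], where 'a = real] True by (simp add: powr_realpow add.commute)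
    finally show "(\<integral>x. cmod (tpoly (levset j) c x) powr q \<partial>torus_measure) \<le> 1 * 2 powr (real j * (q - 1)) * (real j + 1) ^ (CARD('d) - 1)" .
  qed simp
next
  case False
  with q have q: "2 < q" by simp
  define r where "r = min (q / 2) 2"
  define \<eta> where "\<eta> = (r - 1) / 2"
  \<comment> \<open>The pairs decay like 2^(-\<eta> mdist). Half of this rate pays for the weights
    \<open>u powr mdist s t\<close> raised to the power 1 - q; the other half, with base
    \<open>u'\<close>, keeps the double sum convergent.\<close>
  define u where "u = 2 powr (- (\<eta> / (q - 1)) / 2)"
  define u' where "u' = 2 powr (- \<eta> / 2)"
  have r: "1 < r" using q by (simp add: r_def)
  then have \<eta>: "0 < \<eta>" by (simp add: \<eta>_def)
  have u: "0 < u" "u < 1" using \<eta> q by (auto simp: u_def intro!: powr_less_one)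
  have u': "0 < u'" "u' < 1" using \<eta> by (auto simp: u'_def intro!: powr_less_one)
  define Z where "Z = (2 / (1 - u)) ^ CARD('d)"
  define Z' where "Z' = (2 / (1 - u')) ^ CARD('d)"
  have Z: "0 < Z" "0 < Z'" using u u' by (auto simp: Z_def Z'_def)
  show ?thesis
  proof (rule that[of "Z powr (q - 1) * 2 * Z'"])
    show "0 < Z powr (q - 1) * 2 * Z'" using Z by simp
    fix j and c :: "('d \<Rightarrow> int) \<Rightarrow> complex" assume c: "\<And>k. cmod (c k) \<le> 1"
    define S where "S = {s :: 'd \<Rightarrow> nat. sum s UNIV = j}"
    let ?g = "\<lambda>s x. cmod (tpoly (dyadic_block s) c x)"
    have S: "finite S" by (simp add: S_def)
    have contg: "continuous_on UNIV (\<lambda>x. (?g s x * ?g t x) powr (q / 2))" for s t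
      using q by (intro continuous_on_powr_nonneg continuous_intros) auto
    have "(\<integral>x. cmod (tpoly (levset j) c x) powr q \<partial>torus_measure) \<le>
        (\<integral>x. Z powr (q - 1) * (\<Sum>s\<in>S. \<Sum>t\<in>S. (?g s x * ?g t x) powr (q / 2) * (u powr mdist s t) powr (1 - q)) \<partial>torus_measure)"
    proof (rule integral_mono)
      show "integrable torus_measure (\<lambda>x. cmod (tpoly (levset j) c x) powr q)"
        using q by (intro integrable_torus_measure continuous_on_powr_nonneg continuous_intros) auto
      show "integrable torus_measure (\<lambda>x. Z powr (q - 1) * (\<Sum>s\<in>S. \<Sum>t\<in>S. (?g s x * ?g t x) powr (q / 2) * (u powr mdist s t) powr (1 - q)))"
        by (intro integrable_torus_measure continuous_on_mult continuous_on_sum continuous_on_const contg)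
      fix x
      have "tpoly (levset j) c x = (\<Sum>s\<in>S. tpoly (dyadic_block s) c x)"
        unfolding levset_UN S_def by (rule tpoly_UN_disjoint) (auto simp: disjoint_dyadic_block)
      then have "cmod (tpoly (levset j) c x) powr q \<le> (\<Sum>s\<in>S. ?g s x) powr q"
        using q by (intro powr_mono2) (auto intro: norm_sum)
      also have "\<dots> \<le> Z powr (q - 1) * (\<Sum>s\<in>S. \<Sum>t\<in>S. (?g s x * ?g t x) powr (q / 2) * (u powr mdist s t) powr (1 - q))"
        by (rule sum_powr_le_pairs) (use S q u sum_powr_mdist_le[OF u, where j = j] in \<open>auto simp: Z_def S_def\<close>)
      finally show "cmod (tpoly (levset j) c x) powr q \<le> Z powr (q - 1) * (\<Sum>s\<in>S. \<Sum>t\<in>S. (?g s x * ?g t x) powr (q / 2) * (u powr mdist s t) powr (1 - q))" .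
    qed
    also have "\<dots> = Z powr (q - 1) * (\<Sum>s\<in>S. \<Sum>t\<in>S. (\<integral>x. (?g s x * ?g t x) powr (q / 2) \<partial>torus_measure) * (u powr mdist s t) powr (1 - q))"
      by (simp add: Bochner_Integration.integral_sum integrable_torus_measure continuous_intros contg)
    also have "\<dots> \<le> Z powr (q - 1) * (\<Sum>s\<in>S. \<Sum>t\<in>S. 2 * 2 powr (real j * (q - 1)) * u' powr mdist s t)"
    proof (intro mult_left_mono sum_mono)
      fix s t assume st: "s \<in> S" "t \<in> S"
      have ueq: "(u powr mdist s t) powr (1 - q) = 2 powr (\<eta> * (mdist s t / 2))"
      proof -
        have "(u powr mdist s t) powr (1 - q) = 2 powr (- (\<eta> / (q - 1)) / 2 * mdist s t * (1 - q))"
          unfolding u_def powr_powr ..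
        also have "- (\<eta> / (q - 1)) / 2 * mdist s t * (1 - q) = \<eta> * (mdist s t / 2)"
          using q by (simp add: field_simps)
        finally show ?thesis .
      qed
      have "(\<integral>x. (?g s x * ?g t x) powr (q / 2) \<partial>torus_measure) * (u powr mdist s t) powr (1 - q) \<le>
         2 * 2 powr (real j * (q - 1)) * 2 powr (- (r - 1) * (mdist s t / 2)) * (u powr mdist s t) powr (1 - q)"
        unfolding r_def by (intro mult_right_mono integral_pair_powr_le) (use st c q in \<open>auto simp: S_def\<close>)
      also have "\<dots> = 2 * 2 powr (real j * (q - 1)) * (2 powr (- (r - 1) * (mdist s t / 2) + \<eta> * (mdist s t / 2)))"
        by (simp only: ueq powr_add mult.assoc)
      also have "- (r - 1) * (mdist s t / 2) + \<eta> * (mdist s t / 2) = - \<eta> / 2 * mdist s t"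
        by (simp add: \<eta>_def field_simps)
      also have "2 powr (- \<eta> / 2 * mdist s t) = u' powr mdist s t"
        by (simp add: u'_def powr_powr)
      finally show "(\<integral>x. (?g s x * ?g t x) powr (q / 2) \<partial>torus_measure) * (u powr mdist s t) powr (1 - q) \<le>
         2 * 2 powr (real j * (q - 1)) * u' powr mdist s t" .
    qed simp
    also have "(\<Sum>s\<in>S. \<Sum>t\<in>S. 2 * 2 powr (real j * (q - 1)) * u' powr mdist s t) =
       2 * 2 powr (real j * (q - 1)) * (\<Sum>t\<in>S. \<Sum>s\<in>S. u' powr mdist s t)"
      by (subst sum.swap) (simp add: sum_distrib_left)
    also have "(\<Sum>t\<in>S. \<Sum>s\<in>S. u' powr mdist s t) \<le> (\<Sum>t\<in>S. Z')"
      unfolding S_def Z'_def by (intro sum_mono sum_powr_mdist_le u')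
    also have "\<dots> \<le> (real j + 1) ^ (CARD('d) - 1) * Z'"
      using of_nat_mono[OF card_multi_deg[where 'd = 'd and j = j], where 'a = real] Z
      by (simp add: S_def add.commute)
    finally show "(\<integral>x. cmod (tpoly (levset j) c x) powr q \<partial>torus_measure) \<le>
        Z powr (q - 1) * 2 * Z' * 2 powr (real j * (q - 1)) * (real j + 1) ^ (CARD('d) - 1)"
      using Z by (simp add: mult_ac mult_left_mono)
  qed
qed

section \<open>Duality on a hyperbolic layer\<close>

lemma Hoelder_torus:
  fixes F G :: "real^'d::finite \<Rightarrow> complex"
  assumes F: "continuous_on UNIV F" and G: "continuous_on UNIV G"
    and pq: "1 < p" "1 < q" "1 / p + 1 / q = 1"
    and bound: "(\<integral>x. cmod (G x) powr q \<partial>torus_measure) \<le> B" and B: "0 < B"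
  shows "(\<integral>x. cmod (F x) * cmod (G x) \<partial>torus_measure) \<le> Lq_norm p F * B powr (1 / q)"
proof -
  define a where "a = (\<integral>x. cmod (F x) powr p \<partial>torus_measure)"
  define \<Gamma> where "\<Gamma> = B powr (1 / q)"
  have \<Gamma>: "0 < \<Gamma>" "\<Gamma> powr q = B" using B pq by (auto simp: \<Gamma>_def powr_powr)
  have cF: "continuous_on UNIV (\<lambda>x. cmod (F x) powr p)" and cG: "continuous_on UNIV (\<lambda>x. cmod (G x) powr q)"
    using pq by (auto intro!: continuous_on_powr_nonneg continuous_on_norm F G)
  have a: "0 \<le> a" by (simp add: a_def)
  \<comment> \<open>Young's inequality for F / N and G / \<Gamma>. N is any positive upper bound of
    the norm, so that nothing is divided by a norm that may vanish; afterwards N tends to the norm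
    itself.\<close>
  have *: "(\<integral>x. cmod (F x) * cmod (G x) \<partial>torus_measure) \<le> N * \<Gamma>" if N: "0 < N" "a \<le> N powr p" for N
  proof -
    have "(\<integral>x. cmod (F x) * cmod (G x) \<partial>torus_measure) \<le>
      (\<integral>x. N * \<Gamma> * (cmod (F x) powr p / (p * N powr p) + cmod (G x) powr q / (q * B)) \<partial>torus_measure)"
    proof (rule integral_mono)
      show "integrable torus_measure (\<lambda>x. cmod (F x) * cmod (G x))"
        by (intro integrable_torus_measure continuous_on_mult continuous_on_norm F G)
      show "integrable torus_measure (\<lambda>x. N * \<Gamma> * (cmod (F x) powr p / (p * N powr p) + cmod (G x) powr q / (q * B)))"
        using pq N B
        by (intro integrable_torus_measure continuous_on_mult continuous_on_add continuous_on_divide continuous_on_const cF cG) auto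
      fix x
      have "cmod (F x) / N * (cmod (G x) / \<Gamma>) \<le> (cmod (F x) / N) powr p / p + (cmod (G x) / \<Gamma>) powr q / q"
        using N \<Gamma> pq by (intro Youngs_inequality) auto
      also have "\<dots> = cmod (F x) powr p / (p * N powr p) + cmod (G x) powr q / (q * B)"
        by (simp add: powr_divide \<Gamma>(2) mult.commute)
      finally have "cmod (F x) * cmod (G x) / (N * \<Gamma>) \<le> cmod (F x) powr p / (p * N powr p) + cmod (G x) powr q / (q * B)" by simp
      then have "cmod (F x) * cmod (G x) \<le> (cmod (F x) powr p / (p * N powr p) + cmod (G x) powr q / (q * B)) * (N * \<Gamma>)"
        using N \<Gamma> by (subst (asm) pos_divide_le_eq) auto
      then show "cmod (F x) * cmod (G x) \<le> N * \<Gamma> * (cmod (F x) powr p / (p * N powr p) + cmod (G x) powr q / (q * B))"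
        by (simp add: mult.commute)
    qed
    also have "\<dots> = N * \<Gamma> * (a / (p * N powr p) + (\<integral>x. cmod (G x) powr q \<partial>torus_measure) / (q * B))"
      by (simp add: Bochner_Integration.integral_add integrable_torus_measure cF cG continuous_on_divide a_def)
    also have "\<dots> \<le> N * \<Gamma> * (1 / p + 1 / q)"
    proof (intro mult_left_mono add_mono)
      show "a / (p * N powr p) \<le> 1 / p" using N pq by (simp add: field_simps)
      show "(\<integral>x. cmod (G x) powr q \<partial>torus_measure) / (q * B) \<le> 1 / q" using bound B pq by (simp add: field_simps)
    qed (use N \<Gamma> in auto)
    finally show ?thesis using pq by simp
  qed
  have L: "Lq_norm p F = a powr (1 / p)"
    unfolding a_def by (rule Lq_norm_torus_measure) (intro borel_measurable_continuous_onI F)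
  show ?thesis
  proof (rule field_le_epsilon)
    fix e :: real assume e: "0 < e"
    have "a = (a powr (1 / p)) powr p" using a pq by (simp add: powr_powr)
    also have "\<dots> \<le> (a powr (1 / p) + e / \<Gamma>) powr p" using e \<Gamma> pq by (intro powr_mono2) auto
    finally have "(\<integral>x. cmod (F x) * cmod (G x) \<partial>torus_measure) \<le> (a powr (1 / p) + e / \<Gamma>) * \<Gamma>"
      using e \<Gamma> by (intro *) (auto intro!: add_nonneg_pos)
    also have "\<dots> = Lq_norm p F * B powr (1 / q) + e" using \<Gamma> by (simp add: L ring_distribs \<Gamma>_def)
    finally show "(\<integral>x. cmod (F x) * cmod (G x) \<partial>torus_measure) \<le> Lq_norm p F * B powr (1 / q) + e" .
  qed
qed

text \<open>The absolute sum is the pairing of the polynomial with the one whose coefficients are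
  the signs of c. Hoelder with the conjugate exponent q, which is finite as p > 1 and at least 2 as
  p \<le> 2, leads to the dual estimate; its exponents become (q-1)/q = 1/p and (d-1)/q =
  (d-1)(1-1/p).\<close>

lemma wiener_norm_levset_le:
  fixes p :: real
  assumes p: "1 < p" "p \<le> 2"
  obtains C where "0 < C" "\<And>j (c :: ('d::finite \<Rightarrow> int) \<Rightarrow> complex). (\<Sum>k\<in>levset j. cmod (c k)) \<le>
     C * 2 powr (real j / p) * (real j + 1) powr ((real CARD('d) - 1) * (1 - 1 / p)) * Lq_norm p (tpoly (levset j) c)"
proof -
  define q where "q = p / (p - 1)"
  have q: "2 \<le> q" "1 / p + 1 / q = 1" using p by (auto simp: q_def field_simps)
  obtain C where C: "0 < C" "\<And>j c. (\<And>k :: 'd \<Rightarrow> int. cmod (c k) \<le> 1) \<Longrightarrow>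
      (\<integral>x. cmod (tpoly (levset j) c x) powr q \<partial>torus_measure) \<le> C * 2 powr (real j * (q - 1)) * (real j + 1) ^ (CARD('d) - 1)"
    using dual_Lq_bound[OF q(1), where 'd = 'd] by blast
  show ?thesis
  proof (rule that[of "C powr (1 / q)"])
    show "0 < C powr (1 / q)" using C by simp
    fix j and c :: "('d \<Rightarrow> int) \<Rightarrow> complex"
    \<comment> \<open>Where c k = 0, \<open>sgn\<close> is 0; the bound by one still holds and the
      pairing is not affected.\<close>
    define u where "u k = sgn (c k)" for k
    define B where "B = C * 2 powr (real j * (q - 1)) * (real j + 1) ^ (CARD('d) - 1)"
    have B: "0 < B" using C by (simp add: B_def)
    have u: "c k * cnj (u k) = complex_of_real (cmod (c k))" "cmod (u k) \<le> 1" for k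
      by (auto simp: u_def sgn_eq complex_norm_square[symmetric] power2_eq_square norm_divide)
    have "complex_of_real (\<Sum>k\<in>levset j. cmod (c k)) = (\<Sum>k\<in>levset j. c k * cnj (u k))" by (simp add: u)
    also have "\<dots> = (\<integral>x. tpoly (levset j) c x * cnj (tpoly (levset j) u x) \<partial>torus_measure)"
      by (rule integral_tpoly_mult_cnj[symmetric]) simp
    finally have eq: "complex_of_real (\<Sum>k\<in>levset j. cmod (c k)) = (\<integral>x. tpoly (levset j) c x * cnj (tpoly (levset j) u x) \<partial>torus_measure)" .
    have "(\<Sum>k\<in>levset j. cmod (c k)) = cmod (complex_of_real (\<Sum>k\<in>levset j. cmod (c k)))"
      unfolding norm_of_real by (simp add: sum_nonneg)
    also have "\<dots> \<le> (\<integral>x. cmod (tpoly (levset j) c x * cnj (tpoly (levset j) u x)) \<partial>torus_measure)"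
      unfolding eq by (rule integral_norm_bound)
    also have "\<dots> = (\<integral>x. cmod (tpoly (levset j) c x) * cmod (tpoly (levset j) u x) \<partial>torus_measure)"
      by (simp add: norm_mult)
    also have "\<dots> \<le> Lq_norm p (tpoly (levset j) c) * B powr (1 / q)"
      using p q B u C(2)[of u j]
      by (intro Hoelder_torus continuous_intros) (auto simp: B_def)
    also have "B powr (1 / q) = C powr (1 / q) * 2 powr (real j / p) * (real j + 1) powr ((real CARD('d) - 1) * (1 - 1 / p))"
    proof -
      have e: "(q - 1) * (1 / q) = 1 / p" "1 / q = 1 - 1 / p" using p by (auto simp: q_def field_simps)
      have "(real j + 1) ^ (CARD('d) - 1) = (real j + 1) powr (real CARD('d) - 1)"
        by (simp add: powr_realpow[symmetric] of_nat_diff)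
      then have "B powr (1 / q) = C powr (1 / q) * 2 powr (real j * ((q - 1) * (1 / q))) * (real j + 1) powr ((real CARD('d) - 1) * (1 / q))"
        using C by (simp add: B_def powr_mult powr_powr mult.assoc)
      then show ?thesis unfolding e(1) by (simp add: e(2))
    qed
    finally show "(\<Sum>k\<in>levset j. cmod (c k)) \<le>
      C powr (1 / q) * 2 powr (real j / p) * (real j + 1) powr ((real CARD('d) - 1) * (1 - 1 / p)) * Lq_norm p (tpoly (levset j) c)"
      by (simp add: mult_ac)
  qed
qed

section \<open>Sparsification of convex combinations and random sampling\<close>

text \<open>The probabilistic method in finite form: some outcome is no worse than the mean.\<close>

lemma weighted_average_le:
  fixes p a :: "'i \<Rightarrow> real"
  assumes "finite I" "\<And>i. i \<in> I \<Longrightarrow> 0 \<le> p i" "(\<Sum>i\<in>I. p i) = 1" "(\<Sum>i\<in>I. p i * a i) \<le> b"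
  shows "\<exists>i\<in>I. a i \<le> b"
proof (rule ccontr)
  assume "\<not> ?thesis"
  then have *: "b < a i" if "i \<in> I" for i using that by auto
  obtain i where i: "i \<in> I" "0 < p i"
    using assms(2,3) by (metis less_eq_real_def sum.neutral zero_neq_one)
  have "(\<Sum>i\<in>I. p i * b) < (\<Sum>i\<in>I. p i * a i)"
  proof (rule sum_strict_mono_ex1)
    show "\<forall>i\<in>I. p i * b \<le> p i * a i" using assms(2) * by (auto intro: mult_left_mono less_imp_le)
    show "\<exists>i\<in>I. p i * b < p i * a i" using i * by (auto intro!: bexI[of _ i])
  qed fact
  then show False using assms by (simp flip: sum_distrib_right)
qed

lemma exp_le_quadratic:
  fixes t :: real
  assumes "\<bar>t\<bar> \<le> 1"
  shows "exp t \<le> 1 + t + t\<^sup>2"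
proof (cases "0 \<le> t")
  case True
  then show ?thesis using assms exp_bound[of t] by simp
next
  case False
  have "exp t * (1 - t) \<le> exp t * exp (- t)"
    using exp_ge_add_one_self[of "-t"] by (intro mult_left_mono) auto
  also have "\<dots> = 1" by (simp flip: exp_add)
  also have "1 \<le> (1 + t + t\<^sup>2) * (1 - t)"
  proof -
    have "t ^ 3 \<le> 0" using False by (simp add: power_le_zero_eq)
    then show ?thesis by (simp add: algebra_simps power2_eq_square power3_eq_cube)
  qed
  finally show ?thesis using False by simp
qed

text \<open>The four quarter turns. They reduce complex deviations to real ones and replace
  arbitrary phases of coefficients by finitely many, so that approximants can be counted.\<close>

definition unit4 :: "complex set" where "unit4 = {1, -1, \<i>, -\<i>}"

lemma unit4_facts: "finite unit4" "card unit4 = 4" "u \<in> unit4 \<Longrightarrow> cmod u = 1"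
  by (simp add: unit4_def) (simp add: unit4_def complex_eq_iff, auto simp: unit4_def)

lemma cmod_le_unit4:
  assumes "\<And>u. u \<in> unit4 \<Longrightarrow> Re (u * z) \<le> b"
  shows "cmod z \<le> 2 * b"
  using assms[of 1] assms[of "-1"] assms[of \<i>] assms[of "-\<i>"] cmod_le[of z] by (auto simp: unit4_def)

text \<open>p is the law of a random index, \<open>comb\<close> below is the mean of \<phi> and
  \<open>avg xs\<close> the empirical mean of a list of draws. Good lists are built one draw at a
  time by averaging over the next index.\<close>

locale convex_combination =
  fixes I :: "'i set" and p :: "'i \<Rightarrow> real" and X :: "'x set" and \<phi> :: "'i \<Rightarrow> 'x \<Rightarrow> complex"
  assumes finI: "finite I" and p_nonneg: "\<And>i. i \<in> I \<Longrightarrow> 0 \<le> p i" and p_sum: "(\<Sum>i\<in>I. p i) = 1"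
    and finX: "finite X" and \<phi>_le: "\<And>i x. i \<in> I \<Longrightarrow> x \<in> X \<Longrightarrow> cmod (\<phi> i x) \<le> 1"
begin

definition comb :: "'x \<Rightarrow> complex" where "comb x = (\<Sum>i\<in>I. of_real (p i) * \<phi> i x)"

definition avg :: "'i list \<Rightarrow> 'x \<Rightarrow> complex" where "avg xs x = (\<Sum>i\<leftarrow>xs. \<phi> i x) / of_nat (length xs)"

lemma cmod_comb_le: "x \<in> X \<Longrightarrow> cmod (comb x) \<le> 1"
proof -
  assume x: "x \<in> X"
  have "cmod (comb x) \<le> (\<Sum>i\<in>I. p i * cmod (\<phi> i x))"
    unfolding comb_def by (rule order.trans[OF norm_sum]) (auto simp: norm_mult p_nonneg intro!: sum_mono)
  also have "\<dots> \<le> (\<Sum>i\<in>I. p i * 1)" by (intro sum_mono mult_left_mono \<phi>_le p_nonneg x)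
  finally show ?thesis by (simp add: p_sum)
qed

lemma sum_deviation: "(\<Sum>i\<in>I. of_real (p i) * (\<phi> i x - comb x)) = 0"
proof -
  have "(\<Sum>i\<in>I. of_real (p i) * (\<phi> i x - comb x)) = comb x - of_real (\<Sum>i\<in>I. p i) * comb x"
    by (simp add: comb_def right_diff_distrib sum_subtractf sum_distrib_right)
  then show ?thesis by (simp add: p_sum)
qed

text \<open>The deviation has mean zero, which removes the linear term of the exponential, and
  modulus at most 2; the condition l \<le> 1/2 keeps the exponent in the range of the quadratic
  bound.\<close>

lemma exp_moment_step:
  assumes x: "x \<in> X" and u: "cmod u = 1" and l: "0 < l" "l \<le> 1 / 2"
  shows "(\<Sum>i\<in>I. p i * exp (l * Re (u * (\<phi> i x - comb x)))) \<le> exp (4 * l\<^sup>2)"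
proof -
  have dev: "\<bar>Re (u * (\<phi> i x - comb x))\<bar> \<le> 2" if "i \<in> I" for i
  proof -
    have "\<bar>Re (u * (\<phi> i x - comb x))\<bar> \<le> cmod (u * (\<phi> i x - comb x))" by (rule abs_Re_le_cmod)
    also have "\<dots> \<le> cmod (\<phi> i x) + cmod (comb x)" by (simp add: norm_mult u norm_triangle_ineq4)
    also have "\<dots> \<le> 2" using \<phi>_le[OF that x] cmod_comb_le[OF x] by simp
    finally show ?thesis .
  qed
  have "(\<Sum>i\<in>I. p i * exp (l * Re (u * (\<phi> i x - comb x)))) \<le>
        (\<Sum>i\<in>I. p i * (1 + l * Re (u * (\<phi> i x - comb x)) + 4 * l\<^sup>2))"
  proof (intro sum_mono mult_left_mono p_nonneg)
    fix i assume i: "i \<in> I"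
    let ?t = "l * Re (u * (\<phi> i x - comb x))"
    have "\<bar>?t\<bar> \<le> l * 2" unfolding abs_mult using dev[OF i] l by (simp add: mult_left_mono)
    then have "exp ?t \<le> 1 + ?t + ?t\<^sup>2" using l by (intro exp_le_quadratic) linarith
    also have "?t\<^sup>2 \<le> (l * 2)\<^sup>2" using \<open>\<bar>?t\<bar> \<le> l * 2\<close> by (rule abs_le_square_iff[THEN iffD1, OF order.trans]) (use l in simp)
    finally show "exp ?t \<le> 1 + ?t + 4 * l\<^sup>2" by (simp add: power_mult_distrib)
  qed
  also have "\<dots> = (\<Sum>i\<in>I. p i) * (1 + 4 * l\<^sup>2) + l * Re (u * (\<Sum>i\<in>I. of_real (p i) * (\<phi> i x - comb x)))"
  proof -
    have "Re (u * (\<Sum>i\<in>I. of_real (p i) * (\<phi> i x - comb x))) = (\<Sum>i\<in>I. p i * Re (u * (\<phi> i x - comb x)))"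
      by (simp add: sum_distrib_left Re_sum algebra_simps)
    then show ?thesis
      by (simp add: sum_distrib_left sum_distrib_right sum.distrib[symmetric] algebra_simps)
  qed
  also have "\<dots> = 1 + 4 * l\<^sup>2" by (simp add: sum_deviation p_sum)
  also have "\<dots> \<le> exp (4 * l\<^sup>2)" by (rule exp_ge_add_one_self)
  finally show ?thesis .
qed

text \<open>Method of conditional expectations: averaged over the next index, the potential grows at
  most by the factor of a single step, hence some index achieves this. It starts at four terms per
  point of X.\<close>

lemma exp_potential:
  assumes l: "0 < l" "l \<le> 1 / 2"
  shows "\<exists>xs. length xs = n \<and> set xs \<subseteq> I \<and>
    (\<Sum>x\<in>X. \<Sum>u\<in>unit4. exp (l * Re (u * ((\<Sum>i\<leftarrow>xs. \<phi> i x) - of_nat n * comb x)))) \<le> 4 * real (card X) * exp (4 * l\<^sup>2 * real n)"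
proof (induction n)
  case 0
  show ?case by (auto simp: unit4_facts mult.commute)
next
  case (Suc n)
  then obtain xs where xs: "length xs = n" "set xs \<subseteq> I"
    and b: "(\<Sum>x\<in>X. \<Sum>u\<in>unit4. exp (l * Re (u * ((\<Sum>i\<leftarrow>xs. \<phi> i x) - of_nat n * comb x)))) \<le> 4 * real (card X) * exp (4 * l\<^sup>2 * real n)"
    by blast
  define E where "E u x = exp (l * Re (u * ((\<Sum>i\<leftarrow>xs. \<phi> i x) - of_nat n * comb x)))" for u x
  define a where "a i = (\<Sum>x\<in>X. \<Sum>u\<in>unit4. E u x * exp (l * Re (u * (\<phi> i x - comb x))))" for i
  have "(\<Sum>i\<in>I. p i * a i) = (\<Sum>x\<in>X. \<Sum>u\<in>unit4. E u x * (\<Sum>i\<in>I. p i * exp (l * Re (u * (\<phi> i x - comb x)))))"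
    unfolding a_def sum_distrib_left
    by (subst sum.swap, intro sum.cong refl, subst sum.swap, intro sum.cong refl) (simp add: mult_ac)
  also have "\<dots> \<le> (\<Sum>x\<in>X. \<Sum>u\<in>unit4. E u x * exp (4 * l\<^sup>2))"
    by (intro sum_mono mult_left_mono exp_moment_step l unit4_facts) (auto simp: E_def)
  also have "\<dots> \<le> 4 * real (card X) * exp (4 * l\<^sup>2 * real n) * exp (4 * l\<^sup>2)"
    using b by (simp add: E_def flip: sum_distrib_right)
  also have "\<dots> = 4 * real (card X) * exp (4 * l\<^sup>2 * real (Suc n))" by (simp add: algebra_simps flip: exp_add)
  finally obtain i where i: "i \<in> I" "a i \<le> 4 * real (card X) * exp (4 * l\<^sup>2 * real (Suc n))"
    using weighted_average_le[OF finI p_nonneg p_sum] by blast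
  have "(\<Sum>x\<in>X. \<Sum>u\<in>unit4. exp (l * Re (u * ((\<Sum>i\<leftarrow>i # xs. \<phi> i x) - of_nat (Suc n) * comb x)))) = a i"
    unfolding a_def E_def by (intro sum.cong refl) (simp add: algebra_simps flip: exp_add)
  then show ?case using i xs by (intro exI[of _ "i # xs"]) auto
qed

lemma approx_sup:
  assumes \<eta>: "0 < \<eta>" "\<eta> \<le> 1" and n: "64 * ln (4 * real (card X)) / \<eta>\<^sup>2 \<le> real n" "0 < n"
  shows "\<exists>xs. length xs = n \<and> set xs \<subseteq> I \<and> (\<forall>x\<in>X. cmod (comb x - avg xs x) \<le> \<eta>)"
proof -
  \<comment> \<open>Each of the four directions may deviate by \<eta>/2, so ln(4 |X|) + 4 l^2 n has
    to be at most l n \<eta>/2. The choice l = \<eta>/16 turns this into ln(4 |X|) \<le> \<eta>^2 n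
    / 64, the hypothesis on n.\<close>
  define l where "l = \<eta> / 16"
  have l: "0 < l" "l \<le> 1 / 2" using \<eta> by (auto simp: l_def)
  obtain xs where xs: "length xs = n" "set xs \<subseteq> I"
    and b: "(\<Sum>x\<in>X. \<Sum>u\<in>unit4. exp (l * Re (u * ((\<Sum>i\<leftarrow>xs. \<phi> i x) - of_nat n * comb x)))) \<le> 4 * real (card X) * exp (4 * l\<^sup>2 * real n)"
    using exp_potential[OF l] by blast
  have "cmod (comb x - avg xs x) \<le> \<eta>" if x: "x \<in> X" for x
  proof -
    have X: "0 < card X" using x finX by (auto simp: card_gt_0_iff)
    have "Re (u * (avg xs x - comb x)) \<le> \<eta> / 2" if u: "u \<in> unit4" for u
    proof -
      let ?R = "Re (u * ((\<Sum>i\<leftarrow>xs. \<phi> i x) - of_nat n * comb x))"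
      have "exp (l * ?R) \<le> (\<Sum>u\<in>unit4. exp (l * Re (u * ((\<Sum>i\<leftarrow>xs. \<phi> i x) - of_nat n * comb x))))"
        by (rule member_le_sum[OF u]) (auto simp: unit4_facts)
      also have "\<dots> \<le> (\<Sum>x\<in>X. \<Sum>u\<in>unit4. exp (l * Re (u * ((\<Sum>i\<leftarrow>xs. \<phi> i x) - of_nat n * comb x))))"
        by (rule member_le_sum[OF x]) (auto simp: finX intro!: sum_nonneg)
      also note b
      finally have "ln (exp (l * ?R)) \<le> ln (4 * real (card X) * exp (4 * l\<^sup>2 * real n))"
        using X by (subst ln_le_cancel_iff) auto
      then have "l * ?R \<le> ln (4 * real (card X)) + 4 * l\<^sup>2 * real n"
        using X by (simp add: ln_mult)
      also have "ln (4 * real (card X)) \<le> \<eta>\<^sup>2 / 64 * real n"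
        using n \<eta> by (simp add: field_simps)
      finally have "l * ?R \<le> l * (\<eta> / 2 * real n)" by (simp add: l_def power2_eq_square field_simps)
      then have "?R \<le> \<eta> / 2 * real n" using l by simp
      then have "?R / real n \<le> \<eta> / 2" using n by (subst pos_divide_le_eq) auto
      moreover have "Re (u * (avg xs x - comb x)) = ?R / real n"
      proof -
        have "u * (avg xs x - comb x) = (u * ((\<Sum>i\<leftarrow>xs. \<phi> i x) - of_nat n * comb x)) / of_nat n"
          using n xs by (simp add: avg_def field_simps)
        then show ?thesis by (simp only: Re_divide_of_nat)
      qed
      ultimately show ?thesis by simp
    qed
    from cmod_le_unit4[OF this] show ?thesis by (simp add: norm_minus_commute)
  qed
  then show ?thesis using xs by blast
qed

text \<open>Maurey's argument: the cross term of a new draw averages to zero and its variance is at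
  most 1 at every point, so the squared error of the sum grows linearly in n instead of
  quadratically. Only the total weight enters, and no logarithm of the size of X.\<close>

lemma approx_l2:
  fixes \<omega> :: "'x \<Rightarrow> real"
  assumes \<omega>: "\<And>x. x \<in> X \<Longrightarrow> 0 \<le> \<omega> x" and n: "0 < n"
  shows "\<exists>xs. length xs = n \<and> set xs \<subseteq> I \<and> (\<Sum>x\<in>X. \<omega> x * (cmod (comb x - avg xs x))\<^sup>2) \<le> (\<Sum>x\<in>X. \<omega> x) / real n"
proof -
  have var: "(\<Sum>i\<in>I. p i * (cmod (z + (\<phi> i x - comb x)))\<^sup>2) \<le> (cmod z)\<^sup>2 + 1" if x: "x \<in> X" for x z
  proof -
    have sq: "(cmod (z + w))\<^sup>2 = (cmod z)\<^sup>2 + 2 * Re (cnj z * w) + (cmod w)\<^sup>2" for z w :: complex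
      by (simp only: cmod_power2) (simp add: power2_eq_square algebra_simps)
    have 0: "(\<Sum>i\<in>I. p i * Re (z * (\<phi> i x - comb x))) = 0" for z
    proof -
      have "(\<Sum>i\<in>I. p i * Re (z * (\<phi> i x - comb x))) = Re (z * (\<Sum>i\<in>I. of_real (p i) * (\<phi> i x - comb x)))"
        by (simp add: sum_distrib_left Re_sum algebra_simps)
      then show ?thesis by (simp add: sum_deviation)
    qed
    \<comment> \<open>The second moment, at most 1, is the squared mean plus the variance; dropping
      the former bounds the variance.\<close>
    have "(\<Sum>i\<in>I. p i * (cmod (comb x + (\<phi> i x - comb x)))\<^sup>2) \<le> (\<Sum>i\<in>I. p i * 1)"
      by (intro sum_mono mult_left_mono p_nonneg) (auto simp: \<phi>_le x power_le_one)
    then have le1: "(\<Sum>i\<in>I. p i * (cmod (comb x))\<^sup>2) + 2 * (\<Sum>i\<in>I. p i * Re (cnj (comb x) * (\<phi> i x - comb x))) +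
        (\<Sum>i\<in>I. p i * (cmod (\<phi> i x - comb x))\<^sup>2) \<le> 1"
      unfolding sq by (simp add: sum_distrib_left sum.distrib distrib_left p_sum mult_ac)
    then have v: "(\<Sum>i\<in>I. p i * (cmod (\<phi> i x - comb x))\<^sup>2) \<le> 1"
    proof -
      have "0 \<le> (\<Sum>i\<in>I. p i * (cmod (comb x))\<^sup>2)" by (intro sum_nonneg mult_nonneg_nonneg p_nonneg) auto
      then show ?thesis using le1 unfolding 0 by linarith
    qed
    have "(\<Sum>i\<in>I. p i * (cmod (z + (\<phi> i x - comb x)))\<^sup>2) =
       (\<Sum>i\<in>I. p i * (cmod z)\<^sup>2) + 2 * (\<Sum>i\<in>I. p i * Re (cnj z * (\<phi> i x - comb x))) + (\<Sum>i\<in>I. p i * (cmod (\<phi> i x - comb x))\<^sup>2)"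
      unfolding sq by (simp add: sum_distrib_left sum.distrib distrib_left mult_ac)
    then show ?thesis using v unfolding 0 by (simp add: p_sum flip: sum_distrib_right)
  qed
  have "\<exists>xs. length xs = n \<and> set xs \<subseteq> I \<and>
     (\<Sum>x\<in>X. \<omega> x * (cmod ((\<Sum>i\<leftarrow>xs. \<phi> i x) - of_nat n * comb x))\<^sup>2) \<le> real n * (\<Sum>x\<in>X. \<omega> x)" for n
  proof (induction n)
    case 0
    show ?case by auto
  next
    case (Suc n)
    then obtain xs where xs: "length xs = n" "set xs \<subseteq> I"
      and b: "(\<Sum>x\<in>X. \<omega> x * (cmod ((\<Sum>i\<leftarrow>xs. \<phi> i x) - of_nat n * comb x))\<^sup>2) \<le> real n * (\<Sum>x\<in>X. \<omega> x)" by blast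
    define z where "z x = (\<Sum>i\<leftarrow>xs. \<phi> i x) - of_nat n * comb x" for x
    define a where "a i = (\<Sum>x\<in>X. \<omega> x * (cmod (z x + (\<phi> i x - comb x)))\<^sup>2)" for i
    have "(\<Sum>i\<in>I. p i * a i) = (\<Sum>x\<in>X. \<omega> x * (\<Sum>i\<in>I. p i * (cmod (z x + (\<phi> i x - comb x)))\<^sup>2))"
      unfolding a_def sum_distrib_left by (subst sum.swap) (simp add: mult_ac)
    also have "\<dots> \<le> (\<Sum>x\<in>X. \<omega> x * ((cmod (z x))\<^sup>2 + 1))" by (intro sum_mono mult_left_mono var \<omega>)
    also have "\<dots> \<le> real (Suc n) * (\<Sum>x\<in>X. \<omega> x)"
      using b by (simp add: z_def distrib_left distrib_right sum.distrib)
    finally obtain i where i: "i \<in> I" "a i \<le> real (Suc n) * (\<Sum>x\<in>X. \<omega> x)"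
      using weighted_average_le[OF finI p_nonneg p_sum] by blast
    have "(\<Sum>x\<in>X. \<omega> x * (cmod ((\<Sum>i\<leftarrow>i # xs. \<phi> i x) - of_nat (Suc n) * comb x))\<^sup>2) = a i"
      unfolding a_def z_def by (intro sum.cong refl) (simp add: algebra_simps)
    then show ?case using i xs by (intro exI[of _ "i # xs"]) auto
  qed
  then obtain xs where xs: "length xs = n" "set xs \<subseteq> I"
    and b: "(\<Sum>x\<in>X. \<omega> x * (cmod ((\<Sum>i\<leftarrow>xs. \<phi> i x) - of_nat n * comb x))\<^sup>2) \<le> real n * (\<Sum>x\<in>X. \<omega> x)" by blast
  have "(cmod (comb x - avg xs x))\<^sup>2 = (cmod ((\<Sum>i\<leftarrow>xs. \<phi> i x) - of_nat n * comb x))\<^sup>2 / (real n)\<^sup>2" for x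
  proof -
    have "comb x - avg xs x = - (((\<Sum>i\<leftarrow>xs. \<phi> i x) - of_nat n * comb x) / of_nat n)"
      using n xs by (simp add: avg_def field_simps)
    then show ?thesis by (simp add: norm_divide power_divide)
  qed
  then have "(\<Sum>x\<in>X. \<omega> x * (cmod (comb x - avg xs x))\<^sup>2) =
     (\<Sum>x\<in>X. \<omega> x * (cmod ((\<Sum>i\<leftarrow>xs. \<phi> i x) - of_nat n * comb x))\<^sup>2) / (real n)\<^sup>2"
    by (simp add: sum_divide_distrib)
  also have "\<dots> \<le> real n * (\<Sum>x\<in>X. \<omega> x) / (real n)\<^sup>2" by (intro divide_right_mono b) simp
  also have "\<dots> = (\<Sum>x\<in>X. \<omega> x) / real n" using n by (simp add: power2_eq_square)
  finally show ?thesis using xs by blast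
qed

end

section \<open>Random sampling of finitely many sets\<close>

text \<open>Lower Chernoff bound by counting m-tuples. The average of (1/2)^cnt factorizes and is at
  most exp(-m\<mu>/2), whereas a tuple with fewer than m\<mu>/4 hits contributes at least
  exp(-m\<mu>/4). The union bound over the sets leaves room for a good tuple.\<close>

lemma sampling_hits_sets:
  fixes X :: "'x set" and \<D> :: "'x set set"
  assumes X: "finite X" "X \<noteq> {}" and \<D>: "finite \<D>" "\<And>D. D \<in> \<D> \<Longrightarrow> D \<subseteq> X"
    and small: "(\<Sum>D\<in>\<D>. exp (- (real m * (real (card D) / real (card X)) / 4))) < 1"
  shows "\<exists>\<xi>. (\<forall>j<m. \<xi> j \<in> X) \<and> (\<forall>D\<in>\<D>. real m * (real (card D) / real (card X)) / 4 \<le> real (card {j. j < m \<and> \<xi> j \<in> D}))"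
proof (rule ccontr)
  assume neg: "\<not> ?thesis"
  define P where "P = PiE {..<m} (\<lambda>_. X)"
  define \<mu> where "\<mu> D = real (card D) / real (card X)" for D :: "'x set"
  define cnt where "cnt \<xi> D = card {j. j < m \<and> \<xi> j \<in> D}" for \<xi> :: "nat \<Rightarrow> 'x" and D :: "'x set"
  have cX: "0 < card X" using X by (simp add: card_gt_0_iff)
  have finP: "finite P" unfolding P_def using X by (intro finite_PiE) auto
  have cardP: "real (card P) = real (card X) ^ m" unfolding P_def by (subst card_PiE) auto
  have bad: "\<exists>D\<in>\<D>. real (cnt \<xi> D) < real m * \<mu> D / 4" if "\<xi> \<in> P" for \<xi>
  proof -
    have "\<forall>j<m. \<xi> j \<in> X" using that by (auto simp: P_def)
    then show ?thesis using neg by (force simp: cnt_def \<mu>_def not_le)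
  qed
  have mgf: "(\<Sum>\<xi>\<in>P. (1 / 2) ^ cnt \<xi> D) \<le> real (card X) ^ m * exp (- (real m * \<mu> D / 2))" if "D \<in> \<D>" for D
  proof -
    have D: "D \<subseteq> X" using \<D> that by auto
    have "(\<Sum>\<xi>\<in>P. (1 / 2) ^ cnt \<xi> D) = (\<Sum>\<xi>\<in>P. \<Prod>j<m. if \<xi> j \<in> D then 1 / 2 else (1::real))"
    proof (rule sum.cong[OF refl])
      fix \<xi>
      have "(\<Prod>j<m. if \<xi> j \<in> D then 1 / 2 else (1::real)) = (\<Prod>j\<in>{j \<in> {..<m}. \<xi> j \<in> D}. 1 / 2)"
        by (rule prod.inter_filter[symmetric]) simp
      then show "(1 / 2) ^ cnt \<xi> D = (\<Prod>j<m. if \<xi> j \<in> D then 1 / 2 else (1::real))"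
        by (simp add: cnt_def)
    qed
    also have "\<dots> = (\<Prod>j<m. \<Sum>x\<in>X. if x \<in> D then 1 / 2 else 1)"
      unfolding P_def by (rule prod_sum_PiE[symmetric]) (use X in auto)
    also have "(\<Sum>x\<in>X. if x \<in> D then 1 / 2 else (1::real)) = real (card X) - real (card D) / 2"
    proof -
      have "(\<Sum>x\<in>X. if x \<in> D then 1 / 2 else (1::real)) = (\<Sum>x\<in>X. 1 - (if x \<in> D then 1 / 2 else 0))"
        by (intro sum.cong) auto
      also have "\<dots> = real (card X) - (\<Sum>x\<in>{x\<in>X. x \<in> D}. 1 / 2)"
        by (simp only: sum_subtractf sum.inter_filter[OF X(1)]) simp
      also have "{x\<in>X. x \<in> D} = D" using D by auto
      finally show ?thesis by simp
    qed
    also have "real (card X) - real (card D) / 2 = real (card X) * (1 - \<mu> D / 2)"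
      using cX by (simp add: \<mu>_def field_simps)
    also have "(\<Prod>j<m. real (card X) * (1 - \<mu> D / 2)) = (real (card X) * (1 - \<mu> D / 2)) ^ m"
      by simp
    also have "\<dots> \<le> (real (card X) * exp (- (\<mu> D / 2))) ^ m"
    proof (intro power_mono mult_left_mono)
      show "1 - \<mu> D / 2 \<le> exp (- (\<mu> D / 2))" using exp_ge_add_one_self[of "- (\<mu> D / 2)"] by simp
      have "card D \<le> card X" using D X by (intro card_mono)
      then have "\<mu> D \<le> 1" using cX by (simp add: \<mu>_def)
      then show "0 \<le> real (card X) * (1 - \<mu> D / 2)" by simp
    qed simp
    also have "\<dots> = real (card X) ^ m * exp (- (real m * \<mu> D / 2))"
      by (simp add: power_mult_distrib exp_of_nat_mult[symmetric])
    finally show ?thesis .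
  qed
  have "real (card X) ^ m = (\<Sum>\<xi>\<in>P. 1)" by (simp add: cardP)
  also have "\<dots> \<le> (\<Sum>\<xi>\<in>P. \<Sum>D\<in>\<D>. exp (real m * \<mu> D / 4) * (1 / 2) ^ cnt \<xi> D)"
  proof (rule sum_mono)
    fix \<xi> assume "\<xi> \<in> P"
    then obtain D where D: "D \<in> \<D>" "real (cnt \<xi> D) < real m * \<mu> D / 4" using bad by blast
    have "1 = exp (real (cnt \<xi> D)) * exp (- real (cnt \<xi> D))" by (simp flip: exp_add)
    also have "\<dots> \<le> exp (real m * \<mu> D / 4) * (1 / 2) ^ cnt \<xi> D"
    proof (intro mult_mono)
      have "exp (- real (cnt \<xi> D)) = exp (-1) ^ cnt \<xi> D" by (simp add: exp_of_nat_mult[symmetric])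
      also have "\<dots> \<le> (1 / 2) ^ cnt \<xi> D"
      proof (rule power_mono)
        have "2 \<le> exp (1::real)" using exp_ge_add_one_self[of 1] by simp
        then show "exp (-1) \<le> (1 / 2 :: real)" by (simp add: exp_minus field_simps)
      qed simp
      finally show "exp (- real (cnt \<xi> D)) \<le> (1 / 2) ^ cnt \<xi> D" .
    qed (use D in auto)
    also have "\<dots> \<le> (\<Sum>D\<in>\<D>. exp (real m * \<mu> D / 4) * (1 / 2) ^ cnt \<xi> D)"
      by (rule member_le_sum[OF D(1)]) (use \<D> in auto)
    finally show "1 \<le> (\<Sum>D\<in>\<D>. exp (real m * \<mu> D / 4) * (1 / 2) ^ cnt \<xi> D)" .
  qed
  also have "\<dots> = (\<Sum>D\<in>\<D>. exp (real m * \<mu> D / 4) * (\<Sum>\<xi>\<in>P. (1 / 2) ^ cnt \<xi> D))"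
    by (subst sum.swap) (simp add: sum_distrib_left)
  also have "\<dots> \<le> (\<Sum>D\<in>\<D>. exp (real m * \<mu> D / 4) * (real (card X) ^ m * exp (- (real m * \<mu> D / 2))))"
    by (intro sum_mono mult_left_mono mgf) auto
  also have "\<dots> = real (card X) ^ m * (\<Sum>D\<in>\<D>. exp (- (real m * \<mu> D / 4)))"
    unfolding sum_distrib_left
  proof (rule sum.cong[OF refl])
    fix D
    have "exp (real m * \<mu> D / 4) * exp (- (real m * \<mu> D / 2)) = exp (- (real m * \<mu> D / 4))"
      by (simp flip: exp_add)
    then show "exp (real m * \<mu> D / 4) * (real (card X) ^ m * exp (- (real m * \<mu> D / 2))) =
        real (card X) ^ m * exp (- (real m * \<mu> D / 4))" by (simp add: mult_ac)
  qed
  also have "\<dots> < real (card X) ^ m * 1"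
    using small cX by (intro mult_strict_left_mono) (auto simp: \<mu>_def)
  finally show False by simp
qed

text \<open>A discrete layer-cake formula: the dyadic level just below y already contributes at
  least y, and values below all n levels are covered by the remainder.\<close>

lemma dyadic_layer_bound:
  fixes y :: real
  assumes "0 \<le> y" "y \<le> 1"
  shows "y \<le> (\<Sum>i<n. (1 / 2) ^ i * of_bool ((1 / 2) ^ Suc i < y)) + (1 / 2) ^ n"
proof (induction n)
  case 0
  then show ?case using assms by simp
next
  case (Suc n)
  show ?case
  proof (cases "(1 / 2) ^ Suc n < y")
    case True
    then have "(\<Sum>i<Suc n. (1 / 2 :: real) ^ i * of_bool ((1 / 2) ^ Suc i < y)) =
       (\<Sum>i<n. (1 / 2) ^ i * of_bool ((1 / 2) ^ Suc i < y)) + (1 / 2) ^ n"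
      by (simp only: sum.lessThan_Suc of_bool_eq mult_1_right)
    moreover have "0 \<le> (1 / 2 :: real) ^ Suc n" by simp
    ultimately show ?thesis using Suc by linarith
  next
    case False
    have "0 \<le> (\<Sum>i<Suc n. (1 / 2) ^ i * of_bool ((1 / 2) ^ Suc i < y) :: real)" by (intro sum_nonneg) simp
    then show ?thesis using False by linarith
  qed
qed

section \<open>Coefficients as combinations of quarter turns\<close>

lemma sum_unit4: "(\<Sum>u\<in>unit4. f u) = f 1 + f (-1) + f \<i> + f (-\<i>)"
proof -
  have "1 \<noteq> (-1 :: complex)" "\<i> \<noteq> -\<i>" by (auto simp: complex_eq_iff)
  moreover have "1 \<noteq> \<i>" "1 \<noteq> -\<i>" "-1 \<noteq> \<i>" "-1 \<noteq> -\<i>" by (auto simp: complex_eq_iff)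
  ultimately show ?thesis by (simp add: unit4_def add.assoc)
qed

lemma unit4_decomp: "(\<Sum>u\<in>unit4. of_real (max 0 (Re (z * cnj u))) * u) = z"
  by (simp add: sum_unit4 complex_eq_iff max_def)

lemma unit4_decomp_weight: "(\<Sum>u\<in>unit4. max 0 (Re (z * cnj u))) = \<bar>Re z\<bar> + \<bar>Im z\<bar>"
  by (simp add: sum_unit4 max_def)

text \<open>The total weight of the nonnegative decomposition of the coefficients into quarter
  turns, hence real and imaginary parts instead of moduli.\<close>

definition l1norm :: "'k set \<Rightarrow> ('k \<Rightarrow> complex) \<Rightarrow> real" where
  "l1norm K c = (\<Sum>k\<in>K. \<bar>Re (c k)\<bar> + \<bar>Im (c k)\<bar>)"

lemma l1norm_nonneg: "0 \<le> l1norm K c"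
  unfolding l1norm_def by (intro sum_nonneg) auto

lemma l1norm_le: "l1norm K c \<le> 2 * (\<Sum>k\<in>K. cmod (c k))"
  unfolding l1norm_def sum_distrib_left
  by (intro sum_mono) (use abs_Re_le_cmod abs_Im_le_cmod in \<open>smt (verit)\<close>)

lemma l1norm_eq_0: "finite K \<Longrightarrow> l1norm K c = 0 \<Longrightarrow> k \<in> K \<Longrightarrow> c k = 0"
  unfolding l1norm_def by (subst (asm) sum_nonneg_eq_0_iff) (auto simp: complex_eq_iff add_nonneg_eq_0_iff)

text \<open>Cauchy-Schwarz. It is the point where the number of frequencies enters the sampling
  inequality: the mean square of a normalized v-sparse polynomial is at least 1/(2v).\<close>

lemma l1norm_square_le: "(l1norm K c)\<^sup>2 \<le> 2 * real (card K) * (\<Sum>k\<in>K. (cmod (c k))\<^sup>2)"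
proof -
  have "(l1norm K c)\<^sup>2 \<le> (\<Sum>k\<in>K. (\<bar>Re (c k)\<bar> + \<bar>Im (c k)\<bar>)\<^sup>2) * (\<Sum>k\<in>K. 1\<^sup>2)"
    unfolding l1norm_def using Cauchy_Schwarz_ineq_sum[of "\<lambda>k. \<bar>Re (c k)\<bar> + \<bar>Im (c k)\<bar>" "\<lambda>_. 1" K] by simp
  also have "\<dots> \<le> (\<Sum>k\<in>K. 2 * (cmod (c k))\<^sup>2) * (\<Sum>k\<in>K. 1\<^sup>2)"
  proof (intro mult_right_mono sum_mono)
    fix k show "(\<bar>Re (c k)\<bar> + \<bar>Im (c k)\<bar>)\<^sup>2 \<le> 2 * (cmod (c k))\<^sup>2"
      using sum_squares_bound[of "\<bar>Re (c k)\<bar>" "\<bar>Im (c k)\<bar>"] by (simp add: cmod_power2 power2_sum)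
  qed simp
  finally show ?thesis by (simp add: sum_distrib_left mult_ac)
qed

text \<open>The index set involves all of G, with weight zero outside K. The lists of draws then
  range over a set independent of K and c, which a single union bound can cover.\<close>

lemma convex_combination_of_system:
  fixes e :: "'k \<Rightarrow> 'x \<Rightarrow> complex"
  assumes G: "finite G" "K \<subseteq> G" and X: "finite X" and e: "\<And>k x. k \<in> G \<Longrightarrow> x \<in> X \<Longrightarrow> cmod (e k x) \<le> 1"
    and A: "l1norm K c \<noteq> 0"
  defines "\<phi> \<equiv> \<lambda>(u, k) x. u * e k x"
  shows "\<exists>p. convex_combination (unit4 \<times> G) p X \<phi> \<and>
     (\<forall>x. convex_combination.comb (unit4 \<times> G) p \<phi> x = (\<Sum>k\<in>K. c k * e k x) / of_real (l1norm K c))"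
proof -
  let ?A = "l1norm K c"
  define p where "p = (\<lambda>(u, k). if k \<in> K then max 0 (Re (c k * cnj u)) / ?A else 0)"
  have GK: "G \<inter> K = K" using G by auto
  have cc: "convex_combination (unit4 \<times> G) p X \<phi>"
  proof
    show "finite (unit4 \<times> G)" using G unit4_facts by simp
    show "0 \<le> p i" for i by (cases i) (auto simp: p_def l1norm_nonneg)
    have "(\<Sum>i\<in>unit4 \<times> G. p i) = (\<Sum>k\<in>G. \<Sum>u\<in>unit4. p (u, k))"
      by (subst sum.swap) (simp add: sum.cartesian_product)
    also have "\<dots> = (\<Sum>k\<in>G. if k \<in> K then (\<bar>Re (c k)\<bar> + \<bar>Im (c k)\<bar>) / ?A else 0)"
    proof (intro sum.cong refl)
      fix k show "(\<Sum>u\<in>unit4. p (u, k)) = (if k \<in> K then (\<bar>Re (c k)\<bar> + \<bar>Im (c k)\<bar>) / ?A else 0)"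
      proof (cases "k \<in> K")
        case True
        then show ?thesis
          by (simp only: p_def prod.case if_True sum_divide_distrib[symmetric] unit4_decomp_weight)
      qed (simp add: p_def)
    qed
    also have "\<dots> = (\<Sum>k\<in>K. (\<bar>Re (c k)\<bar> + \<bar>Im (c k)\<bar>) / ?A)"
      using G by (simp add: GK flip: sum.inter_restrict)
    also have "\<dots> = 1" using A by (simp add: l1norm_def flip: sum_divide_distrib)
    finally show "(\<Sum>i\<in>unit4 \<times> G. p i) = 1" .
    show "cmod (\<phi> i x) \<le> 1" if "i \<in> unit4 \<times> G" "x \<in> X" for i x
      using that by (auto simp: \<phi>_def norm_mult unit4_facts e)
  qed fact
  have "convex_combination.comb (unit4 \<times> G) p \<phi> x = (\<Sum>k\<in>K. c k * e k x) / of_real ?A" for x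
  proof -
    have "convex_combination.comb (unit4 \<times> G) p \<phi> x = (\<Sum>k\<in>G. \<Sum>u\<in>unit4. of_real (p (u, k)) * \<phi> (u, k) x)"
      unfolding convex_combination.comb_def[OF cc]
      by (subst sum.swap) (simp add: sum.cartesian_product case_prod_unfold)
    also have "\<dots> = (\<Sum>k\<in>G. if k \<in> K then c k * e k x / of_real ?A else 0)"
    proof (intro sum.cong refl)
      fix k
      have "(\<Sum>u\<in>unit4. of_real (max 0 (Re (c k * cnj u)) / ?A) * (u * e k x)) =
         (\<Sum>u\<in>unit4. of_real (max 0 (Re (c k * cnj u))) * u) * e k x / of_real ?A"
        unfolding sum_distrib_right sum_divide_distrib by (intro sum.cong) auto
      then show "(\<Sum>u\<in>unit4. of_real (p (u, k)) * \<phi> (u, k) x) = (if k \<in> K then c k * e k x / of_real ?A else 0)"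
        unfolding unit4_decomp by (auto simp: p_def \<phi>_def)
    qed
    also have "\<dots> = (\<Sum>k\<in>K. c k * e k x / of_real ?A)"
      using G by (simp add: GK flip: sum.inter_restrict)
    finally show ?thesis by (simp add: sum_divide_distrib)
  qed
  with cc show ?thesis by blast
qed

text \<open>Only one dyadic level set of the polynomial has to be sampled faithfully. Choosing it by the pigeonhole
  principle costs the factor n in the conclusion.\<close>
lemma sparse_lower_discretization:
  fixes e :: "'k \<Rightarrow> 'x \<Rightarrow> complex"
  assumes G: "finite G" "G \<noteq> {}" and X: "finite X" "X \<noteq> {}"
    and e: "\<And>k x. k \<in> G \<Longrightarrow> x \<in> X \<Longrightarrow> cmod (e k x) \<le> 1"
    and parseval: "\<And>K c. K \<subseteq> G \<Longrightarrow> (\<Sum>x\<in>X. (cmod (\<Sum>k\<in>K. c k * e k x))\<^sup>2) = real (card X) * (\<Sum>k\<in>K. (cmod (c k))\<^sup>2)"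
    and v: "0 < v" "4 * v \<le> 2 ^ n"
    and m: "16 * real v * real n * (2049 * ln (4 * real (card X)) * ln (4 * real (card G)) + 1) \<le> real m"
  shows "\<exists>\<xi>. (\<forall>j<m. \<xi> j \<in> X) \<and> (\<forall>K c. K \<subseteq> G \<longrightarrow> card K \<le> v \<longrightarrow>
     (\<Sum>k\<in>K. (cmod (c k))\<^sup>2) \<le> 64 * real n * ((1 / real m) * (\<Sum>j<m. (cmod (\<Sum>k\<in>K. c k * e k (\<xi> j)))\<^sup>2)))"
proof -
  define Lx where "Lx = ln (4 * real (card X))"
  define Lg where "Lg = ln (4 * real (card G))"
  define \<phi> where "\<phi> = (\<lambda>(u :: complex, k) x. u * e k x)"
  define av where "av xs x = (\<Sum>i\<leftarrow>xs. \<phi> i x) / of_nat (length xs)" for xs x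
  \<comment> \<open>Level i consists of the points with modulus above 4\<eta>. Sparsification moves
    values by at most \<eta>, so the threshold drops to 3\<eta> for the sparse average, and to
    2\<eta> on the way back at the sample points.\<close>
  define \<eta> where "\<eta> i = sqrt ((1 / 2) ^ Suc i) / 4" for i
  \<comment> \<open>The length that uniform approximation up to \<eta> requires, since 64 / \<eta>^2
    = 2048 * 2^i.\<close>
  define l where "l i = nat \<lceil>2048 * 2 ^ i * Lx\<rceil>" for i
  define D where "D i xs = {x \<in> X. 3 * \<eta> i \<le> cmod (av xs x)}" for i xs
  define \<mu> where "\<mu> S = real (card S) / real (card X)" for S :: "'x set"
  \<comment> \<open>The least density of the level set found by the pigeonhole principle: 2^i T /
    (2n) with T \<ge> 1/(2v).\<close>
  define \<tau> where "\<tau> i = 2 ^ i / (4 * real v * real n)" for i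
  define W where "W i = {xs. set xs \<subseteq> unit4 \<times> G \<and> length xs = l i}" for i
  \<comment> \<open>Finitely many sets, described by lists only, stand in for the level sets of all
    sparse polynomials. Sets of small density are left out, since no moderate number of samples
    would hit them reliably.\<close>
  define \<D> where "\<D> i = {S \<in> D i ` W i. \<tau> i \<le> \<mu> S}" for i
  have cX: "1 \<le> card X" and cG: "1 \<le> card G" using X G by (auto simp: Suc_le_eq card_gt_0_iff)
  have Lx: "1 \<le> Lx"
  proof -
    have "exp 1 \<le> (4::real)" using exp_le by simp
    then have "ln (exp 1) \<le> ln (4 * real (card X))" using cX by (subst ln_le_cancel_iff) auto
    then show ?thesis by (simp add: Lx_def)
  qed
  have Lg: "0 \<le> Lg" using cG by (simp add: Lg_def)
  have n: "0 < n" using v by (cases n) auto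
  have m0: "0 < m"
  proof -
    have "0 < 16 * real v * real n * (2049 * Lx * Lg + 1)" using v n Lx Lg by (intro mult_pos_pos add_nonneg_pos) auto
    then have "0 < real m" unfolding Lx_def Lg_def by (rule less_le_trans[OF _ m])
    then show ?thesis by simp
  qed
  have finW: "finite (W i)" for i unfolding W_def using G unit4_facts by (intro finite_lists_length_eq) auto
  have fin\<D>: "finite (\<D> i)" for i unfolding \<D>_def using finW by simp
  have card\<D>: "real (card (\<D> i)) \<le> exp (real (l i) * Lg)" for i
  proof -
    have "card (\<D> i) \<le> card (D i ` W i)" unfolding \<D>_def using finW by (intro card_mono) auto
    also have "\<dots> \<le> card (W i)" by (rule card_image_le[OF finW])
    also have "\<dots> = (4 * card G) ^ l i"
      unfolding W_def using G unit4_facts by (subst card_lists_length_eq) (auto simp: card_cartesian_product)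
    finally have "real (card (\<D> i)) \<le> (4 * real (card G)) ^ l i"
      by (metis of_nat_le_iff of_nat_mult of_nat_numeral of_nat_power)
    also have "\<dots> = exp (real (l i) * Lg)" using cG by (simp add: Lg_def exp_of_nat_mult)
    finally show ?thesis .
  qed
  have l: "real (l i) \<le> 2049 * 2 ^ i * Lx" "2048 * 2 ^ i * Lx \<le> real (l i)" "0 < l i" for i
  proof -
    have 1: "1 \<le> 2 ^ i * Lx" using Lx by (metis mult_mono one_le_power mult_1 one_le_numeral zero_le_one zero_le_power zero_le_numeral)
    have 2: "0 \<le> 2048 * 2 ^ i * Lx" using Lx by simp
    show "real (l i) \<le> 2049 * 2 ^ i * Lx" unfolding l_def using 1 2 by linarith
    show "2048 * 2 ^ i * Lx \<le> real (l i)" unfolding l_def using 2 by linarith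
    with 1 show "0 < l i" by (cases "l i") auto
  qed
  \<comment> \<open>The number of sets is at most exp(l_i Lg), and both l_i and m \<tau>_i are
    proportional to 2^i; hence the same m serves every level. The summand 1 in the condition on m
    leaves exp(-2^i), which is at most exp(-(i+1)) and makes the failures of all levels
    summable.\<close>
  have small_i: "(\<Sum>S\<in>\<D> i. exp (- (real m * \<mu> S / 4))) \<le> (1 / 2) ^ Suc i" for i
  proof -
    have "(\<Sum>S\<in>\<D> i. exp (- (real m * \<mu> S / 4))) \<le> (\<Sum>S\<in>\<D> i. exp (- (real m * \<tau> i / 4)))"
      by (intro sum_mono) (auto simp: \<D>_def mult_left_mono)
    also have "\<dots> \<le> exp (real (l i) * Lg) * exp (- (real m * \<tau> i / 4))"
      using card\<D>[of i] by (simp add: mult_right_mono)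
    also have "\<dots> = exp (real (l i) * Lg - real m * \<tau> i / 4)" by (simp flip: exp_add)
    also have "\<dots> \<le> exp (- real (Suc i))"
    proof -
      have "real (l i) * Lg \<le> 2049 * 2 ^ i * Lx * Lg" by (intro mult_right_mono l Lg)
      moreover have "2 ^ i * (2049 * Lx * Lg + 1) \<le> real m * \<tau> i / 4"
      proof -
        have "2049 * Lx * Lg + 1 \<le> real m / (16 * real v * real n)"
          using m v n by (simp add: Lx_def Lg_def field_simps)
        then have "2 ^ i * (2049 * Lx * Lg + 1) \<le> 2 ^ i * (real m / (16 * real v * real n))"
          by (rule mult_left_mono) simp
        also have "\<dots> = real m * \<tau> i / 4" by (simp add: \<tau>_def mult_ac)
        finally show ?thesis .
      qed
      moreover have "real (Suc i) \<le> 2 ^ i"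
      proof -
        have "Suc i \<le> 2 ^ i" by (simp add: Suc_leI)
        then show ?thesis by (metis of_nat_le_iff of_nat_numeral of_nat_power)
      qed
      ultimately show ?thesis by (simp add: algebra_simps)
    qed
    also have "\<dots> = exp (-1) ^ Suc i" by (simp only: exp_of_nat_mult[symmetric]) simp
    also have "\<dots> \<le> (1 / 2) ^ Suc i"
    proof (rule power_mono)
      have "2 \<le> exp (1::real)" using exp_ge_add_one_self[of 1] by simp
      then show "exp (-1) \<le> (1 / 2 :: real)" by (simp add: exp_minus field_simps)
    qed simp
    finally show ?thesis .
  qed
  have small: "(\<Sum>S\<in>(\<Union>i<n. \<D> i). exp (- (real m * \<mu> S / 4))) < 1"
  proof -
    have "(\<Sum>S\<in>(\<Union>i<n. \<D> i). exp (- (real m * \<mu> S / 4))) \<le> (\<Sum>i<n. \<Sum>S\<in>\<D> i. exp (- (real m * \<mu> S / 4)))"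
    proof (induction n)
      case (Suc n)
      have "(\<Sum>S\<in>(\<Union>i<Suc n. \<D> i). exp (- (real m * \<mu> S / 4))) = (\<Sum>S\<in>\<D> n \<union> (\<Union>i<n. \<D> i). exp (- (real m * \<mu> S / 4)))"
        by (simp add: lessThan_Suc)
      also have "\<dots> \<le> (\<Sum>S\<in>\<D> n. exp (- (real m * \<mu> S / 4))) + (\<Sum>S\<in>(\<Union>i<n. \<D> i). exp (- (real m * \<mu> S / 4)))"
        using fin\<D> by (subst sum_Un) (auto intro!: sum_nonneg)
      finally show ?case using Suc by simp
    qed simp
    also have "\<dots> \<le> (\<Sum>i<n. (1 / 2) ^ Suc i)" by (intro sum_mono small_i)
    also have "\<dots> = 1 - (1 / 2) ^ n" by (induction n) auto
    also have "\<dots> < 1" by simp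
    finally show ?thesis .
  qed
  have "\<exists>\<xi>. (\<forall>j<m. \<xi> j \<in> X) \<and> (\<forall>S\<in>(\<Union>i<n. \<D> i). real m * (real (card S) / real (card X)) / 4 \<le> real (card {j. j < m \<and> \<xi> j \<in> S}))"
  proof (rule sampling_hits_sets[OF X])
    show "finite (\<Union>i<n. \<D> i)" using fin\<D> by auto
    show "S \<subseteq> X" if "S \<in> (\<Union>i<n. \<D> i)" for S using that by (auto simp: \<D>_def D_def)
    show "(\<Sum>S\<in>(\<Union>i<n. \<D> i). exp (- (real m * (real (card S) / real (card X)) / 4))) < 1"
      using small by (simp add: \<mu>_def)
  qed
  then obtain \<xi> where \<xi>: "\<And>j. j < m \<Longrightarrow> \<xi> j \<in> X"
    and hit: "\<And>i S. i < n \<Longrightarrow> S \<in> \<D> i \<Longrightarrow> real m * \<mu> S / 4 \<le> real (card {j. j < m \<and> \<xi> j \<in> S})"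
    unfolding \<mu>_def by blast
  have "(\<Sum>k\<in>K. (cmod (c k))\<^sup>2) \<le> 64 * real n * ((1 / real m) * (\<Sum>j<m. (cmod (\<Sum>k\<in>K. c k * e k (\<xi> j)))\<^sup>2))"
    if K: "K \<subseteq> G" "card K \<le> v" for K c
  proof (cases "l1norm K c = 0")
    case True
    have "finite K" using K G finite_subset by blast
    then show ?thesis using l1norm_eq_0[OF _ True] by (simp add: sum_nonneg)
  next
    case False
    define A where "A = l1norm K c"
    have A: "0 < A" using False l1norm_nonneg[of K c] by (simp add: A_def)
    obtain p where cc: "convex_combination (unit4 \<times> G) p X \<phi>"
      and comb: "\<And>x. convex_combination.comb (unit4 \<times> G) p \<phi> x = (\<Sum>k\<in>K. c k * e k x) / of_real A"
      using convex_combination_of_system[OF G(1) K(1) X(1), of e c] e False unfolding \<phi>_def A_def by blast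
    interpret convex_combination "unit4 \<times> G" p X \<phi> by (rule cc)
    define w where "w x = (cmod (comb x))\<^sup>2" for x
    have w_eq: "w x = (cmod (\<Sum>k\<in>K. c k * e k x))\<^sup>2 / A\<^sup>2" for x
      using A by (simp add: w_def comb norm_divide power_divide)
    define T where "T = (\<Sum>k\<in>K. (cmod (c k))\<^sup>2) / A\<^sup>2"
    have T: "T = (\<Sum>x\<in>X. w x) / real (card X)"
      unfolding T_def w_eq using parseval[OF K(1), of c] cX by (simp flip: sum_divide_distrib)
    have "A\<^sup>2 \<le> 2 * real v * (\<Sum>k\<in>K. (cmod (c k))\<^sup>2)"
      unfolding A_def
      by (rule order.trans[OF l1norm_square_le], intro mult_right_mono mult_left_mono sum_nonneg)
         (use K(2) in auto)
    then have Tv: "1 / (2 * real v) \<le> T" using A v by (simp add: T_def field_simps)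
    have w01: "0 \<le> w x" "x \<in> X \<Longrightarrow> w x \<le> 1" for x
      using cmod_comb_le by (auto simp: w_def power_le_one)
    define U where "U i = {x \<in> X. (1 / 2) ^ Suc i < w x}" for i
    have "(\<Sum>x\<in>X. w x) \<le> (\<Sum>x\<in>X. (\<Sum>i<n. (1 / 2) ^ i * of_bool ((1 / 2) ^ Suc i < w x)) + (1 / 2) ^ n)"
      using w01 by (intro sum_mono dyadic_layer_bound) auto
    also have "\<dots> = (\<Sum>i<n. (1 / 2) ^ i * real (card (U i))) + real (card X) * (1 / 2) ^ n"
    proof -
      have "(\<Sum>x\<in>X. of_bool ((1 / 2) ^ Suc i < w x)) = real (card (U i))" for i
        using X by (simp add: U_def sum.If_cases of_bool_def Int_def)
      then show ?thesis
        unfolding sum.distrib by (subst sum.swap) (simp flip: sum_distrib_left)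
    qed
    finally have "T \<le> ((\<Sum>i<n. (1 / 2) ^ i * real (card (U i))) + real (card X) * (1 / 2) ^ n) / real (card X)"
      unfolding T by (rule divide_right_mono) simp
    also have "\<dots> = (\<Sum>i<n. (1 / 2) ^ i * \<mu> (U i)) + (1 / 2) ^ n"
      using cX by (simp add: add_divide_distrib sum_divide_distrib \<mu>_def)
    also have "(1 / 2) ^ n \<le> T / 2"
    \<comment> \<open>The condition 4v \<le> 2^n makes the truncated part at most 1/(4v), and this
      is at most T/2.\<close>
    proof -
      have "real (4 * v) \<le> real (2 ^ n)" using v by (simp only: of_nat_le_iff)
      then have "(1 / 2) ^ n \<le> 1 / (4 * real v)" using v by (simp add: power_one_over frac_le)
      then show ?thesis using Tv by simp
    qed
    finally have pig: "T / 2 \<le> (\<Sum>i<n. (1 / 2) ^ i * \<mu> (U i))" by simp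
    have "\<exists>i<n. T / (2 * real n) \<le> (1 / 2) ^ i * \<mu> (U i)"
    proof (rule ccontr)
      assume "\<not> ?thesis"
      then have "(\<Sum>i<n. (1 / 2) ^ i * \<mu> (U i)) < (\<Sum>i<n. T / (2 * real n))"
        using n by (intro sum_strict_mono) (auto simp: not_le)
      also have "\<dots> = T / 2" using n by simp
      finally show False using pig by simp
    qed
    then obtain i where i: "i < n" "T / (2 * real n) \<le> (1 / 2) ^ i * \<mu> (U i)" by blast
    have \<eta>: "0 < \<eta> i" "(\<eta> i)\<^sup>2 = (1 / 2) ^ Suc i / 16" "\<eta> i \<le> 1"
    proof -
      show "0 < \<eta> i" by (simp add: \<eta>_def)
      show sq: "(\<eta> i)\<^sup>2 = (1 / 2) ^ Suc i / 16" by (simp only: \<eta>_def power_divide) simp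
      have "(1 / 2 :: real) ^ Suc i \<le> 1" by (rule power_le_one) auto
      then have "(\<eta> i)\<^sup>2 \<le> 1\<^sup>2" unfolding sq by simp
      then show "\<eta> i \<le> 1" by (rule power2_le_imp_le) simp
    qed
    have "64 * ln (4 * real (card X)) / (\<eta> i)\<^sup>2 = 2048 * 2 ^ i * Lx"
      unfolding \<eta>(2) by (simp add: Lx_def field_simps power_one_over)
    then have "\<exists>xs. length xs = l i \<and> set xs \<subseteq> unit4 \<times> G \<and> (\<forall>x\<in>X. cmod (comb x - avg xs x) \<le> \<eta> i)"
      by (intro approx_sup \<eta> l) (simp add: l)
    then obtain xs where xs: "xs \<in> W i" and app: "\<And>x. x \<in> X \<Longrightarrow> cmod (comb x - av xs x) \<le> \<eta> i"
      by (auto simp: W_def av_def avg_def)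
    have UD: "U i \<subseteq> D i xs"
    proof
      fix x assume x: "x \<in> U i"
      have "(4 * \<eta> i)\<^sup>2 \<le> (cmod (comb x))\<^sup>2" using x by (simp add: power_mult_distrib \<eta>(2) U_def w_def)
      then have "4 * \<eta> i \<le> cmod (comb x)" by (rule power2_le_imp_le) simp
      moreover have "cmod (comb x) \<le> cmod (av xs x) + cmod (comb x - av xs x)"
        by (metis add.commute diff_add_cancel norm_triangle_ineq)
      ultimately show "x \<in> D i xs" using x app[of x] by (auto simp: D_def U_def)
    qed
    have \<mu>UD: "\<mu> (U i) \<le> \<mu> (D i xs)"
      unfolding \<mu>_def using card_mono[OF _ UD] X by (intro divide_right_mono) (auto simp: D_def)
    have U2: "2 ^ i * T / (2 * real n) \<le> \<mu> (U i)"
      using i(2) by (simp add: field_simps power_one_over)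
    have "\<tau> i \<le> 2 ^ i * T / (2 * real n)"
    proof -
      have "2 ^ i * (1 / (2 * real v)) / (2 * real n) \<le> 2 ^ i * T / (2 * real n)"
        using Tv by (intro divide_right_mono mult_left_mono) auto
      then show ?thesis by (simp add: \<tau>_def)
    qed
    then have "D i xs \<in> \<D> i" using xs U2 \<mu>UD by (auto simp: \<D>_def)
    from hit[OF i(1) this] have cnt: "real m * \<mu> (D i xs) / 4 \<le> real (card {j. j < m \<and> \<xi> j \<in> D i xs})" .
    have "(2 * \<eta> i)\<^sup>2 * real (card {j. j < m \<and> \<xi> j \<in> D i xs}) = (\<Sum>j\<in>{j. j < m \<and> \<xi> j \<in> D i xs}. (2 * \<eta> i)\<^sup>2)"
      by simp
    also have "\<dots> \<le> (\<Sum>j\<in>{j. j < m \<and> \<xi> j \<in> D i xs}. w (\<xi> j))"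
    proof (rule sum_mono)
      fix j assume j: "j \<in> {j. j < m \<and> \<xi> j \<in> D i xs}"
      then have "\<xi> j \<in> X" "3 * \<eta> i \<le> cmod (av xs (\<xi> j))" by (auto simp: D_def)
      moreover have "cmod (av xs (\<xi> j)) \<le> cmod (comb (\<xi> j)) + cmod (comb (\<xi> j) - av xs (\<xi> j))"
        by (metis add.commute diff_add_cancel norm_minus_commute norm_triangle_ineq)
      ultimately have "2 * \<eta> i \<le> cmod (comb (\<xi> j))" using app[of "\<xi> j"] by simp
      then show "(2 * \<eta> i)\<^sup>2 \<le> w (\<xi> j)" unfolding w_def using \<eta>(1) by (intro power_mono) auto
    qed
    also have "\<dots> \<le> (\<Sum>j<m. w (\<xi> j))" by (rule sum_mono2) (auto simp: w01)
    finally have *: "(2 * \<eta> i)\<^sup>2 * (real m * \<mu> (D i xs) / 4) \<le> (\<Sum>j<m. w (\<xi> j))"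
      using mult_left_mono[OF cnt, of "(2 * \<eta> i)\<^sup>2"] by simp
    \<comment> \<open>Origin of 64: (2\<eta>)^2 = 2^(-i)/8, a quarter of the expected hits, and the
      pigeonhole share 2^i T / (2n).\<close>
    have "real m * T / (64 * real n) = (2 * \<eta> i)\<^sup>2 * (real m * (2 ^ i * T / (2 * real n)) / 4)"
      unfolding power_mult_distrib \<eta>(2) by (simp add: power_one_over field_simps)
    also have "\<dots> \<le> (2 * \<eta> i)\<^sup>2 * (real m * \<mu> (D i xs) / 4)"
      using U2 \<mu>UD by (intro mult_left_mono divide_right_mono) auto
    also note *
    finally have "real m * T / (64 * real n) \<le> (\<Sum>j<m. w (\<xi> j))" .
    then have "T \<le> 64 * real n * ((1 / real m) * (\<Sum>j<m. w (\<xi> j)))"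
      using n m0 by (simp add: field_simps)
    also have "(\<Sum>j<m. w (\<xi> j)) = (\<Sum>j<m. (cmod (\<Sum>k\<in>K. c k * e k (\<xi> j)))\<^sup>2) / A\<^sup>2"
      unfolding w_eq by (rule sum_divide_distrib[symmetric])
    finally show ?thesis using A by (simp add: T_def field_simps)
  qed
  then show ?thesis using \<xi> by blast
qed

section \<open>Least squares on a grid\<close>

definition gpt :: "nat \<Rightarrow> ('d::finite \<Rightarrow> nat) \<Rightarrow> real^'d" where
  "gpt P n = (\<chi> i. 2 * pi * real (n i) / real P)"

definition grid :: "nat \<Rightarrow> (real^'d::finite) set" where
  "grid P = gpt P ` PiE UNIV (\<lambda>_. {..<P})"

lemma inj_gpt: "0 < P \<Longrightarrow> inj (gpt P)"
  by (rule injI) (auto simp: gpt_def vec_eq_iff fun_eq_iff)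

lemma finite_grid [simp]: "finite (grid P :: (real^'d::finite) set)"
  unfolding grid_def by (intro finite_imageI finite_PiE) auto

lemma card_grid: "0 < P \<Longrightarrow> card (grid P :: (real^'d::finite) set) = P ^ CARD('d)"
  unfolding grid_def by (subst card_image) (auto intro: inj_on_subset[OF inj_gpt] simp: card_PiE)

lemma grid_torus: "0 < P \<Longrightarrow> x \<in> grid P \<Longrightarrow> x \<in> torus"
  by (auto simp: grid_def gpt_def torus_def field_simps PiE_def Pi_def)

lemma sum_roots_of_unity:
  assumes "\<bar>k\<bar> < int P"
  shows "(\<Sum>n<P. cis (of_int k * (2 * pi * real n / real P))) = (if k = 0 then of_nat P else 0)"
proof (cases "k = 0")
  case False
  define z where "z = cis (of_int k * (2 * pi / real P))"
  have P: "0 < P" using assms by auto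
  have z: "cis (of_int k * (2 * pi * real n / real P)) = z ^ n" for n
    unfolding z_def Complex.DeMoivre by (rule arg_cong[where f = cis]) (simp add: field_simps)
  have "z ^ P = cis (2 * pi * of_int k)"
    unfolding z_def Complex.DeMoivre by (rule arg_cong[where f = cis]) (use P in \<open>simp add: field_simps\<close>)
  then have zP: "z ^ P = 1" using cis_multiple_2pi[of "of_int k"] by simp
  have "z \<noteq> 1"
  proof
    assume "z = 1"
    then have "cos (of_int k * (2 * pi / real P)) = 1" by (simp add: z_def complex_eq_iff)
    then obtain r :: int where "of_int k * (2 * pi / real P) = of_int r * 2 * pi" using cos_one_2pi_int by blast
    then have "real_of_int k = of_int (r * int P)" using P by (simp add: field_simps)
    then have "k = r * int P" by (simp only: of_int_eq_iff)
    moreover from this False have "1 * int P \<le> \<bar>r\<bar> * int P" by (intro mult_right_mono) auto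
    ultimately have "int P \<le> \<bar>k\<bar>" by (simp add: abs_mult)
    then show False using assms by simp
  qed
  moreover have "(\<Sum>n<P. cis (of_int k * (2 * pi * real n / real P))) = (\<Sum>n<P. z ^ n)" by (simp only: z)
  ultimately show ?thesis using False zP by (simp add: geometric_sum)
qed simp

lemma sum_grid_expk:
  fixes k :: "'d::finite \<Rightarrow> int"
  assumes "\<And>i. \<bar>k i\<bar> < int P"
  shows "(\<Sum>x\<in>grid P. expk k x) = (if \<forall>i. k i = 0 then of_nat P ^ CARD('d) else 0)"
proof -
  have P: "0 < P" using assms by force
  have "(\<Sum>x\<in>grid P. expk k x) = (\<Sum>n\<in>PiE UNIV (\<lambda>_. {..<P}). \<Prod>i\<in>UNIV. cis (of_int (k i) * (2 * pi * real (n i) / real P)))"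
    unfolding grid_def
    by (subst sum.reindex) (auto intro: inj_on_subset[OF inj_gpt[OF P]] simp: expk_prod gpt_def)
  also have "\<dots> = (\<Prod>i\<in>UNIV. \<Sum>n<P. cis (of_int (k i) * (2 * pi * real n / real P)))"
    by (rule prod_sum_PiE[symmetric]) auto
  also have "\<dots> = (\<Prod>i\<in>UNIV. if k i = 0 then of_nat P else 0)"
    by (intro prod.cong refl sum_roots_of_unity assms)
  also have "\<dots> = (if \<forall>i. k i = 0 then of_nat P ^ CARD('d) else 0)"
    by (auto intro!: prod_zero)
  finally show ?thesis .
qed

text \<open>Differences of frequencies are smaller than P in every coordinate, so distinct
  frequencies do not alias and the exponentials remain orthogonal on the grid.\<close>

lemma grid_parseval:
  fixes K :: "('d::finite \<Rightarrow> int) set"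
  assumes K: "finite K" "\<And>k l i. k \<in> K \<Longrightarrow> l \<in> K \<Longrightarrow> \<bar>k i - l i\<bar> < int P" and P: "0 < P"
  shows "(\<Sum>x\<in>grid P. (cmod (tpoly K c x))\<^sup>2) = real (card (grid P :: (real^'d) set)) * (\<Sum>k\<in>K. (cmod (c k))\<^sup>2)"
proof -
  have "complex_of_real (\<Sum>x\<in>grid P. (cmod (tpoly K c x))\<^sup>2) = (\<Sum>x\<in>grid P. tpoly K c x * cnj (tpoly K c x))"
    by (simp only: of_real_sum complex_norm_square)
  also have "\<dots> = (\<Sum>x\<in>grid P. \<Sum>k\<in>K. \<Sum>l\<in>K. c k * cnj (c l) * expk (\<lambda>i. k i - l i) x)"
    unfolding tpoly_def cnj_sum sum_product
    by (intro sum.cong refl) (simp add: expk_mult_cnj[symmetric] mult_ac)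
  also have "\<dots> = (\<Sum>k\<in>K. \<Sum>l\<in>K. c k * cnj (c l) * (\<Sum>x\<in>grid P. expk (\<lambda>i. k i - l i) x))"
    unfolding sum_distrib_left by (subst sum.swap, intro sum.cong refl, subst sum.swap, rule refl)
  also have "\<dots> = (\<Sum>k\<in>K. \<Sum>l\<in>K. c k * cnj (c l) * (if k = l then of_nat P ^ CARD('d) else 0))"
    using K by (intro sum.cong refl) (subst sum_grid_expk, auto simp: fun_eq_iff)
  also have "\<dots> = (\<Sum>k\<in>K. c k * cnj (c k) * of_nat P ^ CARD('d))"
    using K by (simp add: if_distrib[of "\<lambda>z. _ * z"] sum.delta cong: if_cong)
  also have "\<dots> = complex_of_real (real (card (grid P :: (real^'d) set)) * (\<Sum>k\<in>K. (cmod (c k))\<^sup>2))"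
    unfolding card_grid[OF P] of_real_mult of_real_sum complex_norm_square sum_distrib_left
    by (intro sum.cong) (simp_all add: mult_ac)
  finally show ?thesis by (simp only: of_real_eq_iff)
qed

section \<open>Sparsification in a weighted discrete norm\<close>

text \<open>The weighted discrete L2 norm; writing it through \<open>L2_set\<close> provides the
  triangle inequality, and weights may vanish.\<close>

definition wnorm :: "'x set \<Rightarrow> ('x \<Rightarrow> real) \<Rightarrow> ('x \<Rightarrow> complex) \<Rightarrow> real" where
  "wnorm X \<omega> w = L2_set (\<lambda>x. sqrt (\<omega> x) * cmod (w x)) X"

lemma wnorm_nonneg: "0 \<le> wnorm X \<omega> w" by (simp add: wnorm_def L2_set_nonneg)

lemma wnorm_square: "(\<And>x. x \<in> X \<Longrightarrow> 0 \<le> \<omega> x) \<Longrightarrow> (wnorm X \<omega> w)\<^sup>2 = (\<Sum>x\<in>X. \<omega> x * (cmod (w x))\<^sup>2)"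
  unfolding wnorm_def L2_set_def by (subst real_sqrt_pow2) (auto simp: power_mult_distrib intro!: sum_nonneg)

lemma wnorm_add_le:
  assumes "\<And>x. x \<in> X \<Longrightarrow> 0 \<le> \<omega> x"
  shows "wnorm X \<omega> (\<lambda>x. f x + g x) \<le> wnorm X \<omega> f + wnorm X \<omega> g"
proof -
  have "wnorm X \<omega> (\<lambda>x. f x + g x) \<le> L2_set (\<lambda>x. sqrt (\<omega> x) * cmod (f x) + sqrt (\<omega> x) * cmod (g x)) X"
    unfolding wnorm_def using assms
    by (intro L2_set_mono) (auto simp: norm_triangle_ineq mult_left_mono simp flip: distrib_left)
  also have "\<dots> \<le> wnorm X \<omega> f + wnorm X \<omega> g" unfolding wnorm_def by (rule L2_set_triangle_ineq)
  finally show ?thesis .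
qed

lemma wnorm_sum_le:
  assumes "\<And>x. x \<in> X \<Longrightarrow> 0 \<le> \<omega> x" "finite I"
  shows "wnorm X \<omega> (\<lambda>x. \<Sum>i\<in>I. f i x) \<le> (\<Sum>i\<in>I. wnorm X \<omega> (f i))"
  using assms(2)
proof (induction I rule: finite_induct)
  case empty
  then show ?case by (simp add: wnorm_def L2_set_def)
next
  case (insert i I)
  have "wnorm X \<omega> (\<lambda>x. f i x + (\<Sum>i\<in>I. f i x)) \<le> wnorm X \<omega> (f i) + wnorm X \<omega> (\<lambda>x. \<Sum>i\<in>I. f i x)"
    by (rule wnorm_add_le) (rule assms)
  then show ?case using insert by simp
qed

text \<open>A list of draws may repeat a frequency, even with different quarter turns, so
  coefficients are accumulated.\<close>

lemma sum_list_tpoly: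
  assumes "finite S" "snd ` set xs \<subseteq> S"
  shows "\<exists>c. \<forall>x. (\<Sum>(u, k)\<leftarrow>xs. u * expk k x) = tpoly S c x"
  using assms(2)
proof (induction xs)
  case Nil
  show ?case by (intro exI[of _ "\<lambda>_. 0"]) (simp add: tpoly_def)
next
  case (Cons a xs)
  obtain u k where a: "a = (u, k)" by force
  from Cons obtain c where c: "\<And>x. (\<Sum>(u, k)\<leftarrow>xs. u * expk k x) = tpoly S c x" by auto
  have k: "k \<in> S" using Cons.prems a by auto
  have "u * expk k x + tpoly S c x = tpoly S (\<lambda>l. c l + (if l = k then u else 0)) x" for x
    using k assms(1) by (simp add: tpoly_def distrib_right sum.distrib if_distrib[of "\<lambda>z. z * _"] sum.delta cong: if_cong)
  then show ?case using c by (auto simp: a)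
qed

text \<open>Maurey's bound scaled by \<open>l1norm K c\<close>, which costs at most a factor 2
  compared with the sum of the moduli. The maximum with 1 includes N = 0, where the approximant is
  zero and the bound is the trivial one.\<close>

lemma sparse_approximation:
  fixes K :: "('d::finite \<Rightarrow> int) set"
  assumes K: "finite K" and X: "finite X" and \<omega>: "\<And>x. x \<in> X \<Longrightarrow> 0 \<le> \<omega> x"
  shows "\<exists>K' c'. K' \<subseteq> K \<and> card K' \<le> N \<and>
     wnorm X \<omega> (\<lambda>x. tpoly K c x - tpoly K' c' x) \<le> 2 * sqrt (\<Sum>x\<in>X. \<omega> x) * (\<Sum>k\<in>K. cmod (c k)) / sqrt (max 1 (real N))"
proof -
  define A where "A = l1norm K c"
  define \<Omega> where "\<Omega> = (\<Sum>x\<in>X. \<omega> x)"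
  define B where "B = (\<Sum>k\<in>K. cmod (c k))"
  have \<Omega>: "0 \<le> \<Omega>" unfolding \<Omega>_def by (intro sum_nonneg \<omega>)
  have B: "0 \<le> B" unfolding B_def by (intro sum_nonneg) simp
  have wsq: "(wnorm X \<omega> w)\<^sup>2 = (\<Sum>x\<in>X. \<omega> x * (cmod (w x))\<^sup>2)" for w
    by (rule wnorm_square) (rule \<omega>)
  have AB: "0 \<le> A" "A \<le> 2 * B" unfolding A_def B_def by (rule l1norm_nonneg l1norm_le)+
  consider "N = 0" | "A = 0" | "0 < N" "A \<noteq> 0" by auto
  then show ?thesis
  proof cases
    case 1
    have "(wnorm X \<omega> (tpoly K c))\<^sup>2 \<le> (\<Sum>x\<in>X. \<omega> x * B\<^sup>2)"
      unfolding wsq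
    proof (intro sum_mono mult_left_mono power_mono \<omega>)
      fix x show "cmod (tpoly K c x) \<le> B" unfolding tpoly_def B_def
        by (rule order.trans[OF norm_sum]) (simp add: norm_mult)
    qed auto
    also have "\<dots> = (sqrt \<Omega> * B)\<^sup>2" using \<Omega> by (simp add: power_mult_distrib \<Omega>_def sum_distrib_right)
    finally have "wnorm X \<omega> (tpoly K c) \<le> sqrt \<Omega> * B" by (rule power2_le_imp_le) (use \<Omega> B in simp)
    also have "\<dots> \<le> 2 * sqrt \<Omega> * B" using \<Omega> B by simp
    moreover have "(\<lambda>x. tpoly K c x - tpoly {} c x) = tpoly K c" by (rule ext) (simp add: tpoly_def)
    ultimately show ?thesis using 1 by (intro exI[of _ "{}"] exI[of _ c]) (simp add: \<Omega>_def B_def)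
  next
    case 2
    then have "tpoly K c = (\<lambda>_. 0)" using l1norm_eq_0[OF K, of c] by (auto simp: A_def tpoly_def)
    then show ?thesis using \<Omega> B unfolding \<Omega>_def B_def
      by (intro exI[of _ "{}"] exI[of _ c]) (simp add: tpoly_def wnorm_def L2_set_def)
  next
    case 3
    define \<phi> where "\<phi> = (\<lambda>(u :: complex, k :: 'd \<Rightarrow> int) x. u * expk k x)"
    obtain p where cc: "convex_combination (unit4 \<times> K) p X \<phi>"
      and comb: "\<And>x. convex_combination.comb (unit4 \<times> K) p \<phi> x = (\<Sum>k\<in>K. c k * expk k x) / of_real A"
      using convex_combination_of_system[OF K order.refl X, of expk c] 3 unfolding \<phi>_def A_def by auto
    interpret convex_combination "unit4 \<times> K" p X \<phi> by (rule cc)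
    obtain xs where xs: "length xs = N" "set xs \<subseteq> unit4 \<times> K"
      and app: "(\<Sum>x\<in>X. \<omega> x * (cmod (comb x - avg xs x))\<^sup>2) \<le> \<Omega> / real N"
      using approx_l2[of \<omega> N] \<omega> 3(1) unfolding \<Omega>_def by blast
    define K' where "K' = snd ` set xs"
    have "K' \<subseteq> K" using xs by (auto simp: K'_def)
    have "card K' \<le> N" unfolding K'_def using card_image_le[of "set xs" snd] card_length[of xs] xs by auto
    obtain c0 where c0: "\<And>x. (\<Sum>(u, k)\<leftarrow>xs. u * expk k x) = tpoly K' c0 x"
      using sum_list_tpoly[of K' xs] by (auto simp: K'_def)
    define c' where "c' k = of_real A / of_nat N * c0 k" for k
    have c': "tpoly K' c' x = of_real A * avg xs x" for x
    proof -
      have "tpoly K' c' x = of_real A / of_nat N * tpoly K' c0 x"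
        by (simp add: tpoly_def c'_def sum_distrib_left mult_ac)
      also have "tpoly K' c0 x = (\<Sum>i\<leftarrow>xs. \<phi> i x)" unfolding c0[symmetric] \<phi>_def by (simp add: case_prod_unfold)
      finally show ?thesis by (simp add: avg_def xs)
    qed
    have "tpoly K c x - tpoly K' c' x = of_real A * (comb x - avg xs x)" for x
      using 3 unfolding c' comb by (simp add: tpoly_def right_diff_distrib)
    then have "(wnorm X \<omega> (\<lambda>x. tpoly K c x - tpoly K' c' x))\<^sup>2 = A\<^sup>2 * (\<Sum>x\<in>X. \<omega> x * (cmod (comb x - avg xs x))\<^sup>2)"
      unfolding wsq by (simp add: norm_mult power_mult_distrib sum_distrib_left mult_ac)
    also have "\<dots> \<le> (2 * B)\<^sup>2 * (\<Omega> / real N)" using app AB \<Omega> by (intro mult_mono power_mono) (auto intro!: sum_nonneg mult_nonneg_nonneg \<omega>)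
    also have "\<dots> = (2 * sqrt \<Omega> * B / sqrt (max 1 (real N)))\<^sup>2"
      using \<Omega> 3 by (simp add: power_mult_distrib power_divide max_def)
    finally have "wnorm X \<omega> (\<lambda>x. tpoly K c x - tpoly K' c' x) \<le> 2 * sqrt \<Omega> * B / sqrt (max 1 (real N))"
      by (rule power2_le_imp_le) (use \<Omega> B in simp)
    then show ?thesis using \<open>K' \<subseteq> K\<close> \<open>card K' \<le> N\<close> unfolding \<Omega>_def B_def by blast
  qed
qed

lemma trig_span_eq: "trig_span K = range (tpoly K)"
  by (auto simp: trig_span_def tpoly_def[abs_def])

lemma tpoly_diff: "tpoly K c x - tpoly K c' x = tpoly K (\<lambda>k. c k - c' k) x"
  by (simp add: tpoly_def left_diff_distrib sum_subtractf)

lemma cmod_add_square_le: "(cmod (z + w))\<^sup>2 \<le> 2 * (cmod z)\<^sup>2 + 2 * (cmod w)\<^sup>2"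
proof -
  have "(cmod (z + w))\<^sup>2 \<le> (cmod z + cmod w)\<^sup>2" by (intro power_mono norm_triangle_ineq) simp
  then show ?thesis using sum_squares_bound[of "cmod z" "cmod w"] by (simp add: power2_sum)
qed

lemma tpoly_in_span:
  assumes "finite K" "K' \<subseteq> K"
  shows "\<exists>b. \<forall>x. tpoly K' c x = tpoly K b x"
  using tpoly_extend[OF assms, of c] by metis

lemma tpoly_sum_in_span:
  assumes "finite K" "finite I" "\<And>i. i \<in> I \<Longrightarrow> S i \<subseteq> K"
  shows "\<exists>b. \<forall>x. (\<Sum>i\<in>I. tpoly (S i) (c i) x) = tpoly K b x"
  using assms(2,3)
proof (induction I rule: finite_induct)
  case empty
  show ?case by (intro exI[of _ "\<lambda>_. 0"]) (simp add: tpoly_def)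
next
  case (insert i I)
  then obtain b where "\<And>x. (\<Sum>i\<in>I. tpoly (S i) (c i) x) = tpoly K b x" by auto
  moreover obtain b' where "\<And>x. tpoly (S i) (c i) x = tpoly K b' x"
    using tpoly_in_span[OF assms(1), of "S i"] insert.prems by blast
  ultimately have "(\<Sum>i\<in>insert i I. tpoly (S i) (c i) x) = tpoly K (\<lambda>k. b' k + b k) x" for x
    using insert by (simp add: tpoly_def distrib_right sum.distrib)
  then show ?case by blast
qed

text \<open>The approximant u0 keeps the layers below n, sparsifies the layers from n to J - 1 and
  drops the rest. It is close to f both in L2 and at the points, and minimality makes the least
  squares solution u close to f at the points. Since u - u0 stays in the span of the v frequencies,
  \<open>rip\<close> transfers this to L2.\<close>

lemma least_squares_error:
  fixes f :: "real^'d::finite \<Rightarrow> complex" and J n m v :: nat and \<xi> :: "nat \<Rightarrow> real^'d"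
  defines "G \<equiv> hyp_cross (2 ^ J) :: ('d \<Rightarrow> int) set" and "X \<equiv> grid (2 * 2 ^ J + 1) :: (real^'d) set"
    and "A \<equiv> \<lambda>j. \<Sum>k\<in>levset j. cmod (fourier_coeff f k)"
  assumes f: "periodic_cont f" and m: "0 < m" and \<xi>: "\<And>j. j < m \<Longrightarrow> \<xi> j \<in> X"
    and rip: "\<And>K c. K \<subseteq> G \<Longrightarrow> card K \<le> v \<Longrightarrow>
       (\<Sum>k\<in>K. (cmod (c k))\<^sup>2) \<le> R * ((1 / real m) * (\<Sum>j<m. (cmod (tpoly K c (\<xi> j)))\<^sup>2))"
    and R: "1 \<le> R"
    and sA: "summable A" and nJ: "n \<le> J"
    and budget: "(\<Sum>j<n. card (levset j :: ('d \<Rightarrow> int) set)) + (\<Sum>j=n..<J. N j) \<le> v" and vG: "v \<le> card G"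
    and E1: "(\<Sum>j=n..<J. 3 * A j / sqrt (max 1 (real (N j)))) \<le> E"
    and E2: "(\<Sum>j. A (j + J)) \<le> E"
  shows "\<exists>K\<in>X_v v G. \<forall>u\<in>LS_set m \<xi> (trig_span K) f. Lq_norm 2 (\<lambda>x. f x - u x) \<le> 9 * sqrt R * E"
proof -
  define F where "F j = tpoly (levset j) (fourier_coeff f)" for j
  define T where "T x = (\<Sum>j<J. F j x)" for x
  \<comment> \<open>Uniform measure on the grid plus empirical measure of the points, of total mass
    2: one sparsification controls both errors at once.\<close>
  define \<omega> where "\<omega> x = 1 / real (card X) + real (card {j. j < m \<and> \<xi> j = x}) / real m" for x
  have finG: "finite G" by (simp add: G_def)
  have contf: "continuous_on UNIV f" using f by (simp add: periodic_cont_def)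
  have finX: "finite X" by (simp add: X_def)
  have cX: "0 < card X" unfolding X_def by (subst card_grid) auto
  have Xt: "x \<in> torus" if "x \<in> X" for x using that grid_torus unfolding X_def by auto
  have \<omega>0: "0 \<le> \<omega> x" for x by (simp add: \<omega>_def)
  have wsq: "(wnorm X \<omega> w)\<^sup>2 = (\<Sum>x\<in>X. \<omega> x * (cmod (w x))\<^sup>2)" for w
    by (rule wnorm_square) (rule \<omega>0)
  have \<omega>: "(\<Sum>x\<in>X. \<omega> x * h x) = (1 / real (card X)) * (\<Sum>x\<in>X. h x) + (1 / real m) * (\<Sum>j<m. h (\<xi> j))" for h
  proof -
    have "(\<Sum>j<m. h (\<xi> j)) = (\<Sum>x\<in>X. \<Sum>j\<in>{j. j \<in> {..<m} \<and> \<xi> j = x}. h (\<xi> j))"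
      by (rule sum.group[symmetric]) (use \<xi> finX in auto)
    also have "\<dots> = (\<Sum>x\<in>X. real (card {j. j < m \<and> \<xi> j = x}) * h x)"
      by (intro sum.cong) auto
    finally show ?thesis by (simp add: \<omega>_def distrib_right sum.distrib sum_distrib_left)
  qed
  have \<omega>2: "(\<Sum>x\<in>X. \<omega> x) = 2" using \<omega>[of "\<lambda>_. 1"] cX m by simp
  have A0: "0 \<le> A j" for j by (simp add: A_def sum_nonneg)
  have E0: "0 \<le> E" by (rule order.trans[OF _ E1], intro sum_nonneg divide_nonneg_nonneg mult_nonneg_nonneg A0) auto
  have lG: "levset j \<subseteq> G" if "j < J" for j
    using that unfolding levset_def G_def by (auto intro!: hyp_cross_lev)
  have app: "\<exists>K' c'. K' \<subseteq> levset j \<and> card K' \<le> N j \<and> wnorm X \<omega> (\<lambda>x. F j x - tpoly K' c' x) \<le> 3 * A j / sqrt (max 1 (real (N j)))" for j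
  proof -
    obtain K' c' where *: "K' \<subseteq> levset j" "card K' \<le> N j"
      "wnorm X \<omega> (\<lambda>x. F j x - tpoly K' c' x) \<le> 2 * sqrt 2 * A j / sqrt (max 1 (real (N j)))"
      using sparse_approximation[OF finite_levset finX, of \<omega> j "N j" "fourier_coeff f"] \<omega>0
      unfolding F_def A_def \<omega>2 by blast
    have "2 * sqrt 2 \<le> (3::real)" by (rule power2_le_imp_le) (auto simp: power_mult_distrib)
    then have "2 * sqrt 2 * A j / sqrt (max 1 (real (N j))) \<le> 3 * A j / sqrt (max 1 (real (N j)))"
      by (intro divide_right_mono mult_right_mono A0) auto
    with * show ?thesis by (meson order.trans)
  qed
  then obtain K' c' where K': "\<And>j. K' j \<subseteq> levset j" "\<And>j. card (K' j) \<le> N j"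
    and err: "\<And>j. wnorm X \<omega> (\<lambda>x. F j x - tpoly (K' j) (c' j) x) \<le> 3 * A j / sqrt (max 1 (real (N j)))" by metis
  define S where "S j = (if j < n then levset j else K' j)" for j
  define cc where "cc j = (if j < n then fourier_coeff f else c' j)" for j
  define u0 where "u0 x = (\<Sum>j<J. tpoly (S j) (cc j) x)" for x
  have S: "S j \<subseteq> levset j" for j using K' by (auto simp: S_def)
  define K0 where "K0 = (\<Union>j<J. S j)"
  have "card K0 \<le> (\<Sum>j<J. card (S j))" unfolding K0_def by (rule card_UN_le) simp
  also have "\<dots> = (\<Sum>j<n. card (S j)) + (\<Sum>j=n..<J. card (S j))"
    using nJ by (subst sum.atLeastLessThan_concat[of 0 n J, symmetric, unfolded atLeast0LessThan]) auto
  also have "\<dots> \<le> (\<Sum>j<n. card (levset j :: ('d \<Rightarrow> int) set)) + (\<Sum>j=n..<J. N j)"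
    using K' by (intro add_mono sum_mono) (auto simp: S_def)
  also have "\<dots> \<le> v" by (rule budget)
  finally have "card K0 \<le> v" .
  moreover have "K0 \<subseteq> G" unfolding K0_def using S lG by blast
  \<comment> \<open>\<open>X_v\<close> demands exactly v frequencies; the set is padded inside G,
    which has enough elements.\<close>
  ultimately obtain K where K: "K0 \<subseteq> K" "K \<subseteq> G" "card K = v"
    using exists_subset_between[of K0 v G] vG finG by blast
  have finK: "finite K" using K finG finite_subset by blast
  have SK: "S j \<subseteq> K" if "j \<in> {..<J}" for j using that K by (auto simp: K0_def)
  obtain b where b: "\<And>x. u0 x = tpoly K b x"
    unfolding u0_def using tpoly_sum_in_span[OF finK finite_lessThan, of J S, where c = cc] SK by blast
  obtain t where t: "\<And>x. T x = tpoly G t x"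
    unfolding T_def F_def using tpoly_sum_in_span[OF finG finite_lessThan, of J levset, where c = "\<lambda>_. fourier_coeff f"] lG by auto
  obtain b' where b': "\<And>x. u0 x = tpoly G b' x"
    using tpoly_in_span[OF finG K(2), of b] b by auto
  have Tu0: "wnorm X \<omega> (\<lambda>x. T x - u0 x) \<le> E"
  proof -
    have "(\<lambda>x. T x - u0 x) = (\<lambda>x. \<Sum>j=n..<J. F j x - tpoly (K' j) (c' j) x)"
    proof
      fix x
      have "T x - u0 x = (\<Sum>j<J. F j x - tpoly (S j) (cc j) x)" by (simp add: T_def u0_def sum_subtractf)
      also have "\<dots> = (\<Sum>j=n..<J. F j x - tpoly (S j) (cc j) x)"
        by (rule sum.mono_neutral_right) (auto simp: S_def cc_def F_def)
      also have "\<dots> = (\<Sum>j=n..<J. F j x - tpoly (K' j) (c' j) x)" by (intro sum.cong) (auto simp: S_def cc_def)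
      finally show "T x - u0 x = (\<Sum>j=n..<J. F j x - tpoly (K' j) (c' j) x)" .
    qed
    then have "wnorm X \<omega> (\<lambda>x. T x - u0 x) \<le> (\<Sum>j=n..<J. wnorm X \<omega> (\<lambda>x. F j x - tpoly (K' j) (c' j) x))"
      using wnorm_sum_le[of X \<omega> "{n..<J}"] \<omega>0 by simp
    also have "\<dots> \<le> (\<Sum>j=n..<J. 3 * A j / sqrt (max 1 (real (N j))))" by (intro sum_mono err)
    finally show ?thesis using E1 by simp
  qed
  have "(wnorm X \<omega> (\<lambda>x. T x - u0 x))\<^sup>2 \<le> E\<^sup>2" by (intro power_mono Tu0 wnorm_nonneg)
  then have TE: "(1 / real (card X)) * (\<Sum>x\<in>X. (cmod (T x - u0 x))\<^sup>2) + (1 / real m) * (\<Sum>j<m. (cmod (T (\<xi> j) - u0 (\<xi> j)))\<^sup>2) \<le> E\<^sup>2"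
    unfolding wsq \<omega> .
  have TX: "(1 / real (card X)) * (\<Sum>x\<in>X. (cmod (T x - u0 x))\<^sup>2) \<le> E\<^sup>2"
    by (rule order.trans[OF _ TE]) (simp add: sum_nonneg)
  have T\<xi>: "(1 / real m) * (\<Sum>j<m. (cmod (T (\<xi> j) - u0 (\<xi> j)))\<^sup>2) \<le> E\<^sup>2"
    by (rule order.trans[OF _ TE]) (simp add: sum_nonneg)
  \<comment> \<open>T and u0 have frequencies in G, for which the grid of 2 * 2^J + 1 points per
    axis is exact; the grid part of the weighted norm is thus an L2 norm.\<close>
  have Tint: "(\<integral>x. (cmod (T x - u0 x))\<^sup>2 \<partial>torus_measure) \<le> E\<^sup>2"
  proof -
    have "(\<integral>x. (cmod (T x - u0 x))\<^sup>2 \<partial>torus_measure) = (\<Sum>k\<in>G. (cmod (t k - b' k))\<^sup>2)"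
      by (simp add: t b' tpoly_diff parseval_tpoly[OF finG])
    also have "\<dots> = (1 / real (card X)) * (\<Sum>x\<in>X. (cmod (T x - u0 x))\<^sup>2)"
    proof -
      have diff: "\<bar>k i - l i\<bar> < int (2 * 2 ^ J + 1)" if "k \<in> G" "l \<in> G" for k l i
        using hyp_cross_coord[of k J i] hyp_cross_coord[of l J i] that unfolding G_def by simp
      have "(\<Sum>x\<in>X. (cmod (tpoly G (\<lambda>k. t k - b' k) x))\<^sup>2) = real (card X) * (\<Sum>k\<in>G. (cmod (t k - b' k))\<^sup>2)"
        unfolding X_def by (rule grid_parseval[OF finG]) (rule diff, simp_all)
      then show ?thesis using cX by (simp add: t b' tpoly_diff)
    qed
    finally show ?thesis using TX by simp
  qed
  have fT: "cmod (f x - T x) \<le> E" if "x \<in> torus" for x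
    using fourier_series_tail[OF f sA[unfolded A_def] that, of J] E2 unfolding T_def F_def A_def by simp
  \<comment> \<open>f need not be a polynomial, so the tail f - T is estimated uniformly on the
    torus, in particular at the sample points.\<close>
  have fu0: "emp_err m \<xi> f u0 \<le> 4 * E\<^sup>2"
  proof -
    have "(\<Sum>j<m. (cmod (f (\<xi> j) - u0 (\<xi> j)))\<^sup>2) \<le> (\<Sum>j<m. 2 * E\<^sup>2 + 2 * (cmod (T (\<xi> j) - u0 (\<xi> j)))\<^sup>2)"
    proof (rule sum_mono)
      fix j assume "j \<in> {..<m}"
      then have "(cmod (f (\<xi> j) - T (\<xi> j)))\<^sup>2 \<le> E\<^sup>2" using Xt \<xi> fT by (intro power_mono) auto
      then show "(cmod (f (\<xi> j) - u0 (\<xi> j)))\<^sup>2 \<le> 2 * E\<^sup>2 + 2 * (cmod (T (\<xi> j) - u0 (\<xi> j)))\<^sup>2"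
        using cmod_add_square_le[of "f (\<xi> j) - T (\<xi> j)" "T (\<xi> j) - u0 (\<xi> j)"] by simp
    qed
    then have "emp_err m \<xi> f u0 \<le> (1 / real m) * (\<Sum>j<m. 2 * E\<^sup>2 + 2 * (cmod (T (\<xi> j) - u0 (\<xi> j)))\<^sup>2)"
      unfolding emp_err_def by (rule mult_left_mono) simp
    also have "\<dots> = 2 * E\<^sup>2 + 2 * ((1 / real m) * (\<Sum>j<m. (cmod (T (\<xi> j) - u0 (\<xi> j)))\<^sup>2))"
      using m by (simp add: sum.distrib distrib_left sum_distrib_left)
    finally show ?thesis using T\<xi> by simp
  qed
  show ?thesis
  proof (intro bexI ballI)
    show "K \<in> X_v v G" using K by (simp add: X_v_def)
    fix u assume u: "u \<in> LS_set m \<xi> (trig_span K) f"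
    then obtain c where c: "u = tpoly K c" by (auto simp: LS_set_def trig_span_eq)
    have "u0 \<in> trig_span K" using b unfolding trig_span_eq by (auto simp: fun_eq_iff)
    then have fu: "emp_err m \<xi> f u \<le> 4 * E\<^sup>2" using u fu0 by (auto simp: LS_set_def)
    \<comment> \<open>u and u0 both have empirical error at most 4 E^2, so their difference has
      empirical mean square at most 16 E^2.\<close>
    have "(1 / real m) * (\<Sum>j<m. (cmod (u (\<xi> j) - u0 (\<xi> j)))\<^sup>2) \<le> (1 / real m) * (\<Sum>j<m. 2 * (cmod (f (\<xi> j) - u (\<xi> j)))\<^sup>2 + 2 * (cmod (f (\<xi> j) - u0 (\<xi> j)))\<^sup>2)"
    proof (intro mult_left_mono sum_mono)
      fix j show "(cmod (u (\<xi> j) - u0 (\<xi> j)))\<^sup>2 \<le> 2 * (cmod (f (\<xi> j) - u (\<xi> j)))\<^sup>2 + 2 * (cmod (f (\<xi> j) - u0 (\<xi> j)))\<^sup>2"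
        using cmod_add_square_le[of "u (\<xi> j) - f (\<xi> j)" "f (\<xi> j) - u0 (\<xi> j)"] by (simp add: norm_minus_commute)
    qed simp
    also have "\<dots> = 2 * emp_err m \<xi> f u + 2 * emp_err m \<xi> f u0"
      by (simp add: emp_err_def sum.distrib distrib_left sum_distrib_left mult_ac)
    also have "\<dots> \<le> 16 * E\<^sup>2" using fu fu0 by simp
    finally have emp: "(1 / real m) * (\<Sum>j<m. (cmod (tpoly K (\<lambda>k. c k - b k) (\<xi> j)))\<^sup>2) \<le> 16 * E\<^sup>2"
      by (simp add: c b tpoly_diff)
    have "(\<integral>x. (cmod (u x - u0 x))\<^sup>2 \<partial>torus_measure) = (\<Sum>k\<in>K. (cmod (c k - b k))\<^sup>2)"
      by (simp add: c b tpoly_diff parseval_tpoly[OF finK])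
    also have "\<dots> \<le> R * ((1 / real m) * (\<Sum>j<m. (cmod (tpoly K (\<lambda>k. c k - b k) (\<xi> j)))\<^sup>2))"
      using K by (intro rip) auto
    also have "\<dots> \<le> R * (16 * E\<^sup>2)" using R by (intro mult_left_mono emp) auto
    finally have uu0: "(\<integral>x. (cmod (u x - u0 x))\<^sup>2 \<partial>torus_measure) \<le> R * (16 * E\<^sup>2)" .
    have contu: "continuous_on UNIV u" unfolding c by (rule continuous_on_tpoly) (rule continuous_on_id)
    have contu0: "continuous_on UNIV u0" unfolding u0_def by (intro continuous_intros)
    have contT: "continuous_on UNIV T" unfolding T_def F_def by (intro continuous_intros)
    have int: "integrable torus_measure (\<lambda>x. (cmod (T x - u0 x))\<^sup>2)" "integrable torus_measure (\<lambda>x. (cmod (u x - u0 x))\<^sup>2)"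
       "integrable torus_measure (\<lambda>x. (cmod (f x - u x))\<^sup>2)"
      by (intro integrable_torus_measure continuous_on_power continuous_on_norm continuous_on_diff contu contu0 contT contf)+
    \<comment> \<open>The path from f to u passes through T and u0. The three squared contributions
      2 E^2, 4 E^2 and 64 R E^2 add up to at most 70 R E^2, which is below (9 sqrt R E)^2.\<close>
    have "(\<integral>x. (cmod (f x - u x))\<^sup>2 \<partial>torus_measure) \<le>
       (\<integral>x. 2 * E\<^sup>2 + (4 * (cmod (T x - u0 x))\<^sup>2 + 4 * (cmod (u x - u0 x))\<^sup>2) \<partial>torus_measure)"
    proof (rule integral_mono_AE)
      show "integrable torus_measure (\<lambda>x. 2 * E\<^sup>2 + (4 * (cmod (T x - u0 x))\<^sup>2 + 4 * (cmod (u x - u0 x))\<^sup>2))"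
        using int by simp
      show "AE x in torus_measure. (cmod (f x - u x))\<^sup>2 \<le> 2 * E\<^sup>2 + (4 * (cmod (T x - u0 x))\<^sup>2 + 4 * (cmod (u x - u0 x))\<^sup>2)"
        using AE_torus
      proof eventually_elim
        fix x :: "real^'d" assume "x \<in> torus"
        then have "(cmod (f x - T x))\<^sup>2 \<le> E\<^sup>2" by (intro power_mono fT) auto
        then show "(cmod (f x - u x))\<^sup>2 \<le> 2 * E\<^sup>2 + (4 * (cmod (T x - u0 x))\<^sup>2 + 4 * (cmod (u x - u0 x))\<^sup>2)"
          using cmod_add_square_le[of "f x - T x" "T x - u x"] cmod_add_square_le[of "T x - u0 x" "u0 x - u x"]
          by (simp add: norm_minus_commute)
      qed
    qed (rule int)
    also have "\<dots> = 2 * E\<^sup>2 + (4 * (\<integral>x. (cmod (T x - u0 x))\<^sup>2 \<partial>torus_measure) + 4 * (\<integral>x. (cmod (u x - u0 x))\<^sup>2 \<partial>torus_measure))"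
      using int by simp
    also have "\<dots> \<le> 2 * E\<^sup>2 + (4 * E\<^sup>2 + 4 * (R * (16 * E\<^sup>2)))"
      using Tint uu0 by (intro add_mono mult_left_mono) auto
    finally have L2: "(\<integral>x. (cmod (f x - u x))\<^sup>2 \<partial>torus_measure) \<le> 70 * R * E\<^sup>2"
      using mult_right_mono[OF R, of "6 * E\<^sup>2"] by simp
    have "Lq_norm 2 (\<lambda>x. f x - u x) = sqrt (\<integral>x. (cmod (f x - u x))\<^sup>2 \<partial>torus_measure)"
      by (subst Lq_norm_torus_measure)
         (auto intro!: borel_measurable_continuous_onI continuous_on_diff contf contu simp: powr_half_sqrt)
    also have "\<dots> \<le> sqrt ((9 * sqrt R * E)\<^sup>2)"
    proof (rule real_sqrt_le_mono)
      have "70 * R * E\<^sup>2 \<le> 81 * R * E\<^sup>2" using R by (intro mult_right_mono) auto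
      also have "\<dots> = (9 * sqrt R * E)\<^sup>2" using R by (simp add: power_mult_distrib)
      finally show "(\<integral>x. (cmod (f x - u x))\<^sup>2 \<partial>torus_measure) \<le> (9 * sqrt R * E)\<^sup>2" using L2 by simp
    qed
    also have "\<dots> = 9 * sqrt R * E" using R E0 by simp
    finally show "Lq_norm 2 (\<lambda>x. f x - u x) \<le> 9 * sqrt R * E" .
  qed
qed

section \<open>Choice of parameters\<close>

text \<open>Since b is arbitrary, exponents of logarithms may have either sign; a two-sided
  comparison of the bases handles both.\<close>

lemma powr_le_powr_comparable:
  fixes x y c \<kappa> :: real
  assumes "0 < x" "0 < y" "1 \<le> c" "x \<le> c * y" "y \<le> c * x"
  shows "x powr \<kappa> \<le> c powr \<bar>\<kappa>\<bar> * y powr \<kappa>"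
proof (cases "0 \<le> \<kappa>")
  case True
  have "x powr \<kappa> \<le> (c * y) powr \<kappa>" using assms True by (intro powr_mono2) auto
  then show ?thesis using assms True by (simp add: powr_mult)
next
  case False
  have "x powr \<kappa> \<le> (y / c) powr \<kappa>" using assms False by (intro powr_mono2') (auto simp: field_simps)
  also have "\<dots> = c powr \<bar>\<kappa>\<bar> * y powr \<kappa>" using assms False by (simp add: powr_divide powr_minus field_simps)
  finally show ?thesis .
qed

text \<open>Combines the layer estimate with the definition of the class. Passing from max(j, 1) to
  j + 1 costs a factor depending on b and d only.\<close>

lemma wiener_decay:
  fixes p a b :: real
  assumes p: "1 < p" "p \<le> 2"
  obtains C where "0 < C" "\<And>(f :: real^'d::finite \<Rightarrow> complex) j. f \<in> W_class a b p \<Longrightarrow>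
    (\<Sum>k\<in>levset j. cmod (fourier_coeff f k)) \<le>
      C * 2 powr (- (a - 1 / p) * real j) * (real j + 1) powr ((real CARD('d) - 1) * (b + 1 - 1 / p))"
proof -
  define e where "e = real CARD('d) - 1"
  obtain C where C: "0 < C" "\<And>j (c :: ('d \<Rightarrow> int) \<Rightarrow> complex). (\<Sum>k\<in>levset j. cmod (c k)) \<le>
     C * 2 powr (real j / p) * (real j + 1) powr (e * (1 - 1 / p)) * Lq_norm p (tpoly (levset j) c)"
    using wiener_norm_levset_le[OF p, where 'd = 'd] unfolding e_def by blast
  show ?thesis
  proof (rule that[of "C * 2 powr \<bar>e * b\<bar>"])
    show "0 < C * 2 powr \<bar>e * b\<bar>" using C by simp
    fix f :: "real^'d \<Rightarrow> complex" and j assume f: "f \<in> W_class a b p"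
    have "Lq_norm p (tpoly (levset j) (fourier_coeff f)) \<le> 2 powr (- a * real j) * real (max j 1) powr (e * b)"
      using f by (simp add: W_class_def f_block_eq e_def)
    also have "\<dots> \<le> 2 powr (- a * real j) * (2 powr \<bar>e * b\<bar> * (real j + 1) powr (e * b))"
      by (intro mult_left_mono powr_le_powr_comparable) (auto simp: max_def)
    finally have L: "Lq_norm p (tpoly (levset j) (fourier_coeff f)) \<le> 2 powr (- a * real j) * (2 powr \<bar>e * b\<bar> * (real j + 1) powr (e * b))" .
    have "(\<Sum>k\<in>levset j. cmod (fourier_coeff f k)) \<le>
      C * 2 powr (real j / p) * (real j + 1) powr (e * (1 - 1 / p)) * Lq_norm p (tpoly (levset j) (fourier_coeff f))"
      by (rule C)
    also have "\<dots> \<le> C * 2 powr (real j / p) * (real j + 1) powr (e * (1 - 1 / p)) * (2 powr (- a * real j) * (2 powr \<bar>e * b\<bar> * (real j + 1) powr (e * b)))"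
      using C by (intro mult_left_mono L) auto
    also have "\<dots> = C * 2 powr \<bar>e * b\<bar> * (2 powr (real j / p) * 2 powr (- a * real j)) * ((real j + 1) powr (e * (1 - 1 / p)) * (real j + 1) powr (e * b))"
      by (simp only: mult_ac)
    also have "\<dots> = C * 2 powr \<bar>e * b\<bar> * 2 powr (real j / p + - a * real j) * (real j + 1) powr (e * (1 - 1 / p) + e * b)"
      by (simp only: powr_add)
    also have "real j / p + - a * real j = - (a - 1 / p) * real j" by (simp add: algebra_simps)
    also have "e * (1 - 1 / p) + e * b = e * (b + 1 - 1 / p)" by (simp add: algebra_simps)
    finally show "(\<Sum>k\<in>levset j. cmod (fourier_coeff f k)) \<le>
      C * 2 powr \<bar>e * b\<bar> * 2 powr (- (a - 1 / p) * real j) * (real j + 1) powr ((real CARD('d) - 1) * (b + 1 - 1 / p))"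
      by (simp add: e_def)
  qed
qed

text \<open>Polynomial growth is absorbed by half of the exponential decay.\<close>

lemma summable_powr_geometric:
  fixes \<alpha> B :: real
  assumes \<alpha>: "0 < \<alpha>" and B: "0 \<le> B"
  shows "summable (\<lambda>i. 2 powr (- \<alpha> * real i) * (real i + 1) powr B)"
proof -
  \<comment> \<open>Chosen so that (B + 1) \<delta> i is the exponent of 2^(\<alpha>i/2) after ln t
    \<le> t is used at t = \<delta>(i + 1); B + 1 keeps the denominator positive for B = 0.\<close>
  define \<delta> where "\<delta> = \<alpha> / 2 * ln 2 / (B + 1)"
  have \<delta>: "0 < \<delta>" using \<alpha> B by (simp add: \<delta>_def)
  define K where "K = exp ((B + 1) * (\<delta> - ln \<delta>))"
  have growth: "(real i + 1) powr B \<le> K * 2 powr (\<alpha> / 2 * real i)" for i :: nat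
  proof -
    have "(real i + 1) powr B \<le> (real i + 1) powr (B + 1)" by (intro powr_mono) auto
    also have "\<dots> = exp ((B + 1) * ln (real i + 1))" by (simp add: powr_def)
    also have "\<dots> \<le> exp ((B + 1) * (\<delta> * (real i + 1) - ln \<delta>))"
    proof -
      have "ln (\<delta> * (real i + 1)) \<le> \<delta> * (real i + 1)" using \<delta> by (intro less_imp_le ln_less_self) simp
      then have "ln (real i + 1) \<le> \<delta> * (real i + 1) - ln \<delta>" using \<delta> by (simp add: ln_mult)
      then show ?thesis using B by (simp add: mult_left_mono)
    qed
    also have "(B + 1) * (\<delta> * (real i + 1) - ln \<delta>) = (B + 1) * (\<delta> - ln \<delta>) + (B + 1) * \<delta> * real i" by (simp add: algebra_simps)
    also have "(B + 1) * \<delta> = \<alpha> / 2 * ln 2"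
      unfolding \<delta>_def times_divide_eq_right by (rule nonzero_mult_div_cancel_left) (use B in simp)
    also have "exp ((B + 1) * (\<delta> - ln \<delta>) + \<alpha> / 2 * ln 2 * real i) = K * 2 powr (\<alpha> / 2 * real i)"
      by (simp add: K_def exp_add powr_def mult_ac)
    finally show ?thesis .
  qed
  have bound: "2 powr (- \<alpha> * real i) * (real i + 1) powr B \<le> K * (2 powr (- \<alpha> / 2)) ^ i" for i :: nat
  proof -
    have "2 powr (- \<alpha> * real i) * (real i + 1) powr B \<le> 2 powr (- \<alpha> * real i) * (K * 2 powr (\<alpha> / 2 * real i))"
      by (intro mult_left_mono growth) simp
    also have "\<dots> = K * 2 powr (- \<alpha> * real i + \<alpha> / 2 * real i)" by (simp only: powr_add mult_ac)
    also have "- \<alpha> * real i + \<alpha> / 2 * real i = - \<alpha> / 2 * real i" by simp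
    also have "2 powr (- \<alpha> / 2 * real i) = (2 powr (- \<alpha> / 2)) powr real i" by (rule powr_powr[symmetric])
    also have "\<dots> = (2 powr (- \<alpha> / 2)) ^ i" by (rule powr_realpow) simp
    finally show ?thesis .
  qed
  have "summable (\<lambda>i. K * (2 powr (- \<alpha> / 2)) ^ i)"
    using \<alpha> by (intro summable_mult summable_geometric) (auto intro!: powr_less_one)
  then show ?thesis by (rule summable_comparison_test'[of _ 0]) (use bound in auto)
qed

section \<open>Distribution of the v frequencies over the layers\<close>

text \<open>n is the last level at which the full layers below still fit into v/2 frequencies. The
  upper inequality makes v comparable with 2^n (n+1)^e.\<close>

lemma exists_level:
  fixes v e :: nat
  assumes "2 \<le> v"
  obtains n where "2 * (2 ^ n * (n + 1) ^ e) \<le> v" "v < 2 * (2 ^ (n + 1) * (n + 2) ^ e)"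
proof -
  define n where "n = (LEAST n. v < 2 * (2 ^ (n + 1) * (n + 2) ^ e))"
  have "v < 2 * (2 ^ (v + 1) * (v + 2) ^ e)"
  proof -
    have "v < 2 ^ v" by (rule less_exp)
    also have "\<dots> \<le> 2 ^ v * (4 * (v + 2) ^ e)" by simp
    finally show ?thesis by simp
  qed
  then have 1: "v < 2 * (2 ^ (n + 1) * (n + 2) ^ e)" unfolding n_def by (rule LeastI)
  have 2: "2 * (2 ^ n * (n + 1) ^ e) \<le> v"
  proof (cases n)
    case 0
    then show ?thesis using assms by simp
  next
    case (Suc k)
    have "\<not> v < 2 * (2 ^ (k + 1) * (k + 2) ^ e)" using Suc unfolding n_def by (intro not_less_Least) simp
    then show ?thesis using Suc by simp
  qed
  from that[OF 2 1] show ?thesis .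
qed

lemma sum_levset_le: "(\<Sum>j<n. card (levset j :: ('d::finite \<Rightarrow> int) set)) \<le> 2 ^ n * (n + 1) ^ (CARD('d) - 1)"
proof -
  have "(\<Sum>j<n. card (levset j :: ('d \<Rightarrow> int) set)) \<le> (\<Sum>j<n. 2 ^ j * (n + 1) ^ (CARD('d) - 1))"
    by (intro sum_mono order.trans[OF card_levset] mult_left_mono power_mono) auto
  also have "\<dots> = (\<Sum>j<n. 2 ^ j) * (n + 1) ^ (CARD('d) - 1)" by (simp only: sum_distrib_right)
  also have "(\<Sum>j<n. 2 ^ j) = 2 ^ n - (1 :: nat)" by (induction n) auto
  also have "(2 ^ n - 1) * (n + 1) ^ (CARD('d) - 1) \<le> 2 ^ n * (n + 1) ^ (CARD('d) - 1)" by (intro mult_right_mono) auto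
  finally show ?thesis .
qed

text \<open>Half of v goes to the full layers and half to the sparsified ones, in geometrically
  decreasing shares; the factor (1 - 2^(-\<alpha>))/2 normalizes the geometric series.\<close>

lemma sparsity_budget:
  fixes \<alpha> :: real and v n J :: nat
  assumes \<alpha>: "0 < \<alpha>" and low: "2 * (2 ^ n * (n + 1) ^ (CARD('d::finite) - 1)) \<le> v"
  defines "N \<equiv> \<lambda>j. nat \<lfloor>(1 - 2 powr - \<alpha>) / 2 * real v * 2 powr (- \<alpha> * (real j - real n))\<rfloor>"
  shows "(\<Sum>j<n. card (levset j :: ('d \<Rightarrow> int) set)) + (\<Sum>j=n..<J. N j) \<le> v"
proof -
  define q where "q = 2 powr - \<alpha>"
  have q: "0 < q" "q < 1" using \<alpha> by (auto simp: q_def intro!: powr_less_one)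
  have "real (\<Sum>j=n..<J. N j) \<le> (\<Sum>j=n..<J. (1 - q) / 2 * real v * q ^ (j - n))"
    unfolding of_nat_sum
  proof (rule sum_mono)
    fix j assume "j \<in> {n..<J}"
    then have "2 powr (- \<alpha> * (real j - real n)) = (2 powr - \<alpha>) powr real (j - n)"
      by (simp only: powr_powr of_nat_diff atLeastLessThan_iff)
    also have "\<dots> = q ^ (j - n)" unfolding q_def by (rule powr_realpow) simp
    finally have eq: "2 powr (- \<alpha> * (real j - real n)) = q ^ (j - n)" .
    show "real (N j) \<le> (1 - q) / 2 * real v * q ^ (j - n)"
      unfolding N_def eq q_def[symmetric] by (rule of_nat_floor) (use q in simp)
  qed
  also have "\<dots> = (1 - q) / 2 * real v * (\<Sum>j=n..<J. q ^ (j - n))" by (simp add: sum_distrib_left)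
  also have "(\<Sum>j=n..<J. q ^ (j - n)) = (\<Sum>i<J - n. q ^ i)"
    by (rule sum.reindex_bij_witness[of _ "\<lambda>i. i + n" "\<lambda>j. j - n"]) auto
  also have "\<dots> \<le> 1 / (1 - q)"
  proof -
    have "(\<Sum>i<J - n. q ^ i) \<le> (\<Sum>i. q ^ i)" using q by (intro sum_le_suminf summable_geometric) auto
    then show ?thesis using q by (simp add: suminf_geometric)
  qed
  finally have "real (\<Sum>j=n..<J. N j) \<le> (1 - q) / 2 * real v * (1 / (1 - q))" using q by (simp add: mult_left_mono)
  also have "\<dots> = real v / 2" using q by (simp add: divide_simps)
  finally have "real (\<Sum>j=n..<J. N j) \<le> real v / 2" .
  moreover have "real (\<Sum>j<n. card (levset j :: ('d \<Rightarrow> int) set)) \<le> real v / 2"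
  proof -
    have "2 * (\<Sum>j<n. card (levset j :: ('d \<Rightarrow> int) set)) \<le> v"
      using order.trans[OF mult_left_mono[OF sum_levset_le[where 'd = 'd and n = n], of 2] low] by simp
    then have "real (2 * (\<Sum>j<n. card (levset j :: ('d \<Rightarrow> int) set))) \<le> real v" by (simp only: of_nat_le_iff)
    then show ?thesis by linarith
  qed
  ultimately show ?thesis by linarith
qed

text \<open>In layer n + i the coefficients decay like 2^(-\<alpha>i), while the inverse square root
  of the share grows like 2^(\<alpha>i/2). The quotient 2^(-\<alpha>i/2) is summable even with its
  polynomial factor, so the sum has the size B of layer n.\<close>

lemma level_errors:
  fixes \<alpha> \<beta> C :: real and A :: "nat \<Rightarrow> real" and v n J :: nat
  assumes \<alpha>: "0 < \<alpha>" and C: "0 \<le> C" and v: "0 < v" and nJ: "n \<le> J"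
    and A0: "\<And>j. 0 \<le> A j" and A: "\<And>j. A j \<le> C * 2 powr (- \<alpha> * real j) * (real j + 1) powr \<beta>"
    and J: "log 2 (real v) \<le> \<alpha> * (real J - real n)"
  defines "\<sigma> \<equiv> 1 - 2 powr - \<alpha>"
  defines "N \<equiv> \<lambda>j. nat \<lfloor>\<sigma> / 2 * real v * 2 powr (- \<alpha> * (real j - real n))\<rfloor>"
    and "s \<equiv> \<lambda>i. 2 powr (- (\<alpha> / 2) * real i) * (real i + 1) powr \<bar>\<beta>\<bar>"
  defines "B \<equiv> 5 * C * sqrt (2 / (\<sigma> * real v)) * 2 powr (- \<alpha> * real n) * (real n + 1) powr \<beta>"
  shows "summable A" "(\<Sum>j=n..<J. 3 * A j / sqrt (max 1 (real (N j)))) \<le> B * (\<Sum>i. s i)" "(\<Sum>j. A (j + J)) \<le> B * (\<Sum>i. s i)"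
proof -
  have \<sigma>: "0 < \<sigma>" "\<sigma> \<le> 1" using \<alpha> by (auto simp: \<sigma>_def intro!: powr_less_one)
  have s0: "0 \<le> s i" for i by (simp add: s_def)
  have B0: "0 \<le> B" using C \<sigma> v by (simp add: B_def)
  have sums: "summable s" unfolding s_def by (rule summable_powr_geometric) (use \<alpha> in auto)
  \<comment> \<open>The share before rounding. All errors, including those of the dropped layers,
    are compared with A / sqrt y.\<close>
  define y where "y i = \<sigma> / 2 * real v * 2 powr (- \<alpha> * real i)" for i :: nat
  have y: "0 < y i" for i using \<sigma> v by (simp add: y_def)
  have key: "5 * A (i + n) / sqrt (y i) \<le> B * s i" for i
  proof -
    have "(real (i + n) + 1) powr \<beta> \<le> (real n + 1) powr \<beta> * (real i + 1) powr \<bar>\<beta>\<bar>"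
    proof (cases "0 \<le> \<beta>")
      case True
      have "(real (i + n) + 1) powr \<beta> \<le> ((real n + 1) * (real i + 1)) powr \<beta>"
        using True by (intro powr_mono2) (auto simp: algebra_simps)
      then show ?thesis using True by (simp add: powr_mult)
    next
      case False
      have "(real (i + n) + 1) powr \<beta> \<le> (real n + 1) powr \<beta> * 1"
        using False by (simp add: powr_mono2')
      also have "\<dots> \<le> (real n + 1) powr \<beta> * (real i + 1) powr \<bar>\<beta>\<bar>"
        by (intro mult_left_mono) (auto simp: ge_one_powr_ge_zero)
      finally show ?thesis .
    qed
    then have "A (i + n) \<le> C * 2 powr (- \<alpha> * real (i + n)) * ((real n + 1) powr \<beta> * (real i + 1) powr \<bar>\<beta>\<bar>)"
      using C by (intro order.trans[OF A] mult_left_mono) auto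
    also have "2 powr (- \<alpha> * real (i + n)) = 2 powr (- \<alpha> * real n) * 2 powr (- \<alpha> * real i)"
      by (simp add: algebra_simps flip: powr_add)
    finally have A1: "A (i + n) \<le> C * (2 powr (- \<alpha> * real n) * 2 powr (- \<alpha> * real i)) * ((real n + 1) powr \<beta> * (real i + 1) powr \<bar>\<beta>\<bar>)" .
    have "1 / sqrt (y i) = sqrt (2 / (\<sigma> * real v)) * 2 powr (\<alpha> / 2 * real i)"
    proof -
      have "2 powr (- \<alpha> * real i) = (2 powr (- (\<alpha> / 2) * real i))\<^sup>2"
        by (simp add: power2_eq_square flip: powr_add)
      then have "sqrt (y i) = sqrt (\<sigma> / 2 * real v) * sqrt ((2 powr (- (\<alpha> / 2) * real i))\<^sup>2)"
        by (simp only: y_def real_sqrt_mult)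
      then have "sqrt (y i) = sqrt (\<sigma> / 2 * real v) * 2 powr (- (\<alpha> / 2) * real i)" by simp
      moreover have "sqrt (2 / (\<sigma> * real v)) = 1 / sqrt (\<sigma> / 2 * real v)" by (simp add: real_sqrt_divide real_sqrt_mult)
      moreover have "2 powr (\<alpha> / 2 * real i) = 1 / 2 powr (- (\<alpha> / 2) * real i)" by (simp add: powr_minus_divide)
      ultimately show ?thesis by simp
    qed
    then have "5 * A (i + n) / sqrt (y i) = 5 * A (i + n) * (sqrt (2 / (\<sigma> * real v)) * 2 powr (\<alpha> / 2 * real i))"
      by (metis mult.right_neutral times_divide_eq_right)
    also have "\<dots> \<le> 5 * (C * (2 powr (- \<alpha> * real n) * 2 powr (- \<alpha> * real i)) * ((real n + 1) powr \<beta> * (real i + 1) powr \<bar>\<beta>\<bar>)) * (sqrt (2 / (\<sigma> * real v)) * 2 powr (\<alpha> / 2 * real i))"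
      using \<sigma> by (intro mult_right_mono mult_left_mono A1) auto
    also have "\<dots> = B * ((2 powr (- \<alpha> * real i) * 2 powr (\<alpha> / 2 * real i)) * (real i + 1) powr \<bar>\<beta>\<bar>)"
      by (simp only: B_def mult_ac)
    also have "2 powr (- \<alpha> * real i) * 2 powr (\<alpha> / 2 * real i) = 2 powr (- (\<alpha> / 2) * real i)"
      by (simp flip: powr_add)
    finally show ?thesis by (simp only: s_def)
  qed
  have N: "N (i + n) = nat \<lfloor>y i\<rfloor>" for i by (simp add: N_def y_def)
  have "(\<Sum>j=n..<J. 3 * A j / sqrt (max 1 (real (N j)))) = (\<Sum>i<J-n. 3 * A (i + n) / sqrt (max 1 (real (N (i + n)))))"
    by (rule sum.reindex_bij_witness[of _ "\<lambda>i. i + n" "\<lambda>j. j - n"]) auto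
  also have "\<dots> \<le> (\<Sum>i<J-n. B * s i)"
  proof (rule sum_mono)
    fix i
    \<comment> \<open>Rounding down loses at most half of the share because at least 1 is kept; this
      turns the factor 3 into 3 sqrt 2, which is at most 5.\<close>
    have "y i / 2 \<le> max 1 (real (N (i + n)))" unfolding N using y[of i] by linarith
    then have "sqrt (y i / 2) \<le> sqrt (max 1 (real (N (i + n))))" by (rule real_sqrt_le_mono)
    then have "3 * A (i + n) / sqrt (max 1 (real (N (i + n)))) \<le> 3 * A (i + n) / sqrt (y i / 2)"
      using A0 y by (intro divide_left_mono) auto
    also have "\<dots> = (3 * sqrt 2) * A (i + n) / sqrt (y i)" using y by (simp add: real_sqrt_divide)
    also have "\<dots> \<le> 5 * A (i + n) / sqrt (y i)"
    proof (intro divide_right_mono mult_right_mono A0)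
      show "3 * sqrt 2 \<le> (5::real)" by (rule power2_le_imp_le) (auto simp: power_mult_distrib)
    qed (use y in \<open>auto intro: less_imp_le\<close>)
    also note key
    finally show "3 * A (i + n) / sqrt (max 1 (real (N (i + n)))) \<le> B * s i" .
  qed
  also have "\<dots> = B * (\<Sum>i<J-n. s i)" by (simp add: sum_distrib_left)
  also have "\<dots> \<le> B * (\<Sum>i. s i)" using B0 s0 sums by (intro mult_left_mono sum_le_suminf) auto
  finally show "(\<Sum>j=n..<J. 3 * A j / sqrt (max 1 (real (N j)))) \<le> B * (\<Sum>i. s i)" .
  have tail: "A (j + J) \<le> B * s (j + (J - n))" for j
  proof -
    define i where "i = j + (J - n)"
    have i: "j + J = i + n" using nJ by (simp add: i_def)
    \<comment> \<open>From layer J on the share is at most 1, so a dropped layer costs no more than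
      the bound for a sparsified one and fits the same series.\<close>
    have "y i \<le> 1"
    proof -
      note J
      also have "\<alpha> * (real J - real n) \<le> \<alpha> * real i"
        using \<alpha> nJ by (intro mult_left_mono) (auto simp: i_def of_nat_diff)
      finally have "log 2 (real v) \<le> \<alpha> * real i" .
      then have "2 powr (- \<alpha> * real i) \<le> 2 powr (- log 2 (real v))" by simp
      also have "\<dots> = 1 / real v" using v by (simp add: powr_minus powr_log_cancel divide_inverse)
      finally have "real v * 2 powr (- \<alpha> * real i) \<le> 1" using v by (simp add: field_simps)
      then have "\<sigma> / 2 * (real v * 2 powr (- \<alpha> * real i)) \<le> 1 * 1" using \<sigma> by (intro mult_mono) auto
      then show ?thesis by (simp add: y_def mult.assoc)
    qed
    then have "sqrt (y i) \<le> 1" by simp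
    then have "5 * A (i + n) / 1 \<le> 5 * A (i + n) / sqrt (y i)"
      using y[of i] A0[of "i + n"] by (intro divide_left_mono) auto
    then have "A (i + n) \<le> 5 * A (i + n) / sqrt (y i)" using A0[of "i + n"] by linarith
    also note key
    finally show ?thesis unfolding i by (simp add: i_def)
  qed
  have sums': "summable (\<lambda>j. B * s (j + (J - n)))" using sums by (intro summable_mult) (simp add: summable_iff_shift)
  have sA: "summable (\<lambda>j. A (j + J))"
    by (rule summable_comparison_test'[OF sums', of 0]) (use tail A0 in auto)
  then show "summable A" by (simp add: summable_iff_shift)
  have "(\<Sum>j. A (j + J)) \<le> (\<Sum>j. B * s (j + (J - n)))" by (rule suminf_le[OF tail sA sums'])
  also have "\<dots> = B * (\<Sum>j. s (j + (J - n)))" using sums by (intro suminf_mult) (simp add: summable_iff_shift)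
  also have "\<dots> \<le> B * (\<Sum>i. s i)"
  proof (intro mult_left_mono B0)
    have "(\<Sum>i. s i) = (\<Sum>j. s (j + (J - n))) + (\<Sum>i<J - n. s i)" by (rule suminf_split_initial_segment[OF sums])
    then show "(\<Sum>j. s (j + (J - n))) \<le> (\<Sum>i. s i)" using s0 by (simp add: sum_nonneg)
  qed
  finally show "(\<Sum>j. A (j + J)) \<le> B * (\<Sum>i. s i)" .
qed

text \<open>From 2^n comparable with v / (n+1)^e, the power -\<alpha> of 2^n costs
  (n+1)^(e\<alpha>); then n + 1 is replaced by ln v, to which it is comparable with constants
  depending on e only.\<close>

lemma level_rate:
  fixes \<alpha> \<beta> :: real and v n e :: nat
  assumes \<alpha>: "0 < \<alpha>" and low: "2 * (2 ^ n * (n + 1) ^ e) \<le> v" and high: "v < 2 * (2 ^ (n + 1) * (n + 2) ^ e)"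
  shows "2 powr (- \<alpha> * real n) * (real n + 1) powr \<beta> \<le>
     (2 ^ (e + 2)) powr \<alpha> * (real e + 2) powr \<bar>real e * \<alpha> + \<beta>\<bar> * real v powr - \<alpha> * ln (real v) powr (real e * \<alpha> + \<beta>)"
proof -
  have "1 \<le> 2 ^ n * (n + 1) ^ e" by (simp add: Suc_le_eq)
  then have v: "2 \<le> v" using low by linarith
  have hi: "real v \<le> 2 ^ (e + 2) * (2 ^ n * (real n + 1) ^ e)"
  proof -
    \<comment> \<open>Replacing n + 2 by 2(n + 1) gives 2^e, and the two powers of 2 in
      \<open>high\<close> give the remaining factor 4.\<close>
    have "(n + 2) ^ e \<le> (2 * (n + 1)) ^ e" by (intro power_mono) auto
    then have "2 * (2 ^ (n + 1) * (n + 2) ^ e) \<le> 2 * (2 ^ (n + 1) * (2 * (n + 1)) ^ e)" by simp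
    also have "\<dots> = 2 ^ (e + 2) * (2 ^ n * (n + 1) ^ e)" by (simp add: power_mult_distrib power_add del: mult_Suc mult_Suc_right)
    finally have "v \<le> 2 ^ (e + 2) * (2 ^ n * (n + 1) ^ e)" using high by linarith
    then have "real v \<le> real (2 ^ (e + 2) * (2 ^ n * (n + 1) ^ e))" by (simp only: of_nat_le_iff)
    then show ?thesis by (simp add: add.commute)
  qed
  have lnv: "0 < ln (real v)" using v by simp
  have "2 ^ (n + 1) \<le> v"
  proof -
    have "2 ^ (n + 1) * 1 \<le> 2 ^ (n + 1) * (n + 1) ^ e" by (intro mult_left_mono) (auto simp: Suc_le_eq)
    also have "\<dots> = 2 * (2 ^ n * (n + 1) ^ e)" by simp
    also note low
    finally show ?thesis by simp
  qed
  then have "real (2 ^ (n + 1)) \<le> real v" by (simp only: of_nat_le_iff)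
  then have "ln (2 ^ (n + 1)) \<le> ln (real v)" by (subst ln_le_cancel_iff) (use v in auto)
  then have "(real n + 1) * ln 2 \<le> ln (real v)" by (simp add: ln_realpow ln_mult algebra_simps)
  moreover have "(real n + 1) * (1 / 2) \<le> (real n + 1) * ln 2"
    using ln2_ge_two_thirds by (intro mult_left_mono) auto
  ultimately have "(real n + 1) * (1 / 2) \<le> ln (real v)" by (rule order.trans[rotated])
  then have "2 * ((real n + 1) * (1 / 2)) \<le> 2 * ln (real v)" by (intro mult_left_mono) auto
  moreover have "2 * ((real n + 1) * (1 / 2)) = real n + 1" by simp
  ultimately have up: "real n + 1 \<le> 2 * ln (real v)" by (simp only:)
  have lo: "ln (real v) \<le> (real e + 2) * (real n + 1)"
  proof -
    have "real n + 1 \<le> 2 ^ n"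
    proof -
      have "n + 1 \<le> 2 ^ n" by (simp add: Suc_leI)
      then have "real (n + 1) \<le> real (2 ^ n)" by (simp only: of_nat_le_iff)
      then show ?thesis by simp
    qed
    then have "2 ^ (e + 2) * (2 ^ n * (real n + 1) ^ e) \<le> 2 ^ (e + 2) * (2 ^ n * (2 ^ n) ^ e)"
      by (intro mult_left_mono power_mono) auto
    also have "\<dots> = 2 ^ (e + 2 + n + n * e)" by (simp add: power_add power_mult)
    also have "\<dots> \<le> 2 ^ ((e + 2) * (n + 1))" by (intro power_increasing) (auto simp: algebra_simps)
    finally have "real v \<le> 2 ^ ((e + 2) * (n + 1))" using hi by simp
    then have "ln (real v) \<le> ln (2 ^ ((e + 2) * (n + 1)))" by (subst ln_le_cancel_iff) (use v in auto)
    also have "\<dots> = real ((e + 2) * (n + 1)) * ln 2" by (rule ln_realpow)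
    also have "\<dots> \<le> real ((e + 2) * (n + 1)) * 1" using ln_2_less_1 by (intro mult_left_mono) auto
    finally show ?thesis by (simp add: algebra_simps)
  qed
  have "2 powr (- \<alpha> * real n) = (2 ^ n) powr - \<alpha>" by (simp add: powr_powr mult.commute flip: powr_realpow)
  also have "\<dots> \<le> (real v / (2 ^ (e + 2) * (real n + 1) ^ e)) powr - \<alpha>"
    using hi v \<alpha> by (intro powr_mono2') (auto simp: field_simps)
  also have "\<dots> = (2 ^ (e + 2)) powr \<alpha> * (real n + 1) powr (real e * \<alpha>) * real v powr - \<alpha>"
  proof -
    have "((real n + 1) ^ e) powr \<alpha> = (real n + 1) powr (real e * \<alpha>)" by (simp add: powr_powr flip: powr_realpow)
    then show ?thesis using v by (simp add: powr_divide powr_mult powr_minus_divide field_simps)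
  qed
  finally have "2 powr (- \<alpha> * real n) * (real n + 1) powr \<beta> \<le>
     (2 ^ (e + 2)) powr \<alpha> * (real n + 1) powr (real e * \<alpha>) * real v powr - \<alpha> * (real n + 1) powr \<beta>"
    by (rule mult_right_mono) simp
  also have "\<dots> = (2 ^ (e + 2)) powr \<alpha> * real v powr - \<alpha> * (real n + 1) powr (real e * \<alpha> + \<beta>)"
    by (simp only: powr_add mult_ac)
  also have "\<dots> \<le> (2 ^ (e + 2)) powr \<alpha> * real v powr - \<alpha> * ((real e + 2) powr \<bar>real e * \<alpha> + \<beta>\<bar> * ln (real v) powr (real e * \<alpha> + \<beta>))"
  proof (intro mult_left_mono powr_le_powr_comparable)
    have "2 * ln (real v) \<le> (real e + 2) * ln (real v)" using lnv by (intro mult_right_mono) auto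
    with up show "real n + 1 \<le> (real e + 2) * ln (real v)" by (rule order.trans)
  qed (use lnv lo in auto)
  finally show ?thesis by (simp only: mult_ac)
qed

section \<open>Sizes of the grid, the cross and the sample\<close>

text \<open>\<open>n'\<close> is the number of value levels in the sampling inequality; as it is of
  order log v, its square root is the loss in the final rate.\<close>

lemma level_count_bounds:
  fixes v :: nat
  assumes v: "2 \<le> v"
  defines "n' \<equiv> nat \<lceil>log 2 (real v)\<rceil> + 2"
  shows "4 * v \<le> 2 ^ n'" "real n' \<le> 7 * ln (real v)" "0 < n'"
proof -
  have l0: "1 \<le> log 2 (real v)" using v by (simp add: le_log_iff)
  have "real (4 * v) \<le> real (2 ^ n')"
  proof -
    have "real v = 2 powr log 2 (real v)" using v by simp
    also have "\<dots> \<le> 2 powr real (nat \<lceil>log 2 (real v)\<rceil>)" by (intro powr_mono) (use l0 in linarith, simp)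
    finally show ?thesis by (simp add: n'_def powr_realpow)
  qed
  then show "4 * v \<le> 2 ^ n'" by (simp only: of_nat_le_iff)
  have ln: "2 / 3 \<le> ln (real v)"
    by (rule order.trans[OF ln2_ge_two_thirds]) (use v in simp)
  have "real n' \<le> log 2 (real v) + 3" using l0 unfolding n'_def by linarith
  moreover have "log 2 (real v) \<le> 3 / 2 * ln (real v)"
  proof -
    have "ln (real v) / ln 2 \<le> ln (real v) / (2 / 3)"
      using ln ln2_ge_two_thirds by (intro divide_left_mono) auto
    then show ?thesis by (simp add: log_def)
  qed
  ultimately show "real n' \<le> 7 * ln (real v)" using ln by linarith
qed (simp add: n'_def)

text \<open>In J - n the part log v / \<alpha> makes the tail from J on negligible, and the part log
  v ensures that the cross contains v frequencies. Both keep 2^J polynomial in v.\<close>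

lemma grid_size_bounds:
  fixes v n d :: nat and \<alpha> :: real
  assumes v: "2 \<le> v" and \<alpha>: "0 < \<alpha>" and n: "2 * 2 ^ n \<le> v"
  defines "J \<equiv> n + nat \<lceil>log 2 (real v) * (1 / \<alpha> + 1)\<rceil>"
  shows "v \<le> 2 ^ J" "log 2 (real v) \<le> \<alpha> * (real J - real n)"
    "real ((2 * 2 ^ J + 1) ^ d) \<le> real v powr (real d * (4 + 1 / \<alpha>))"
proof -
  define L where "L = log 2 (real v)"
  have L: "1 \<le> L" using v by (simp add: le_log_iff L_def)
  have L0: "0 \<le> L * (1 / \<alpha> + 1)" using L \<alpha> by simp
  have Jn: "real J - real n \<ge> L * (1 / \<alpha> + 1)" "real J \<le> real n + L * (1 / \<alpha> + 1) + 1"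
    using L0 unfolding J_def L_def[symmetric] by linarith+
  have vL: "real v = 2 powr L" using v by (simp add: L_def)
  have 1: "0 \<le> L / \<alpha>" using L \<alpha> by simp
  have "L \<le> real J" using Jn 1 by (simp add: distrib_left)
  then have "real v \<le> 2 powr real J" unfolding vL by simp
  then have "real v \<le> real (2 ^ J)" by (simp add: powr_realpow)
  then show "v \<le> 2 ^ J" by (simp only: of_nat_le_iff)
  have "L \<le> \<alpha> * (L * (1 / \<alpha> + 1))" using \<alpha> L by (simp add: field_simps)
  also have "\<dots> \<le> \<alpha> * (real J - real n)" using \<alpha> Jn by (intro mult_left_mono) auto
  finally show "log 2 (real v) \<le> \<alpha> * (real J - real n)" by (simp add: L_def)
  have "real (2 ^ n) * 2 \<le> real v" using of_nat_mono[OF n, where 'a = real] by simp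
  have v1: "1 \<le> real v" "2 \<le> real v" using v by auto
  have "(2::real) ^ J = 2 powr real J" by (simp add: powr_realpow)
  also have "\<dots> \<le> 2 powr (real n + L * (1 / \<alpha> + 1) + 1)" using Jn by simp
  also have "\<dots> = 2 ^ n * 2 * real v powr (1 / \<alpha> + 1)"
  proof -
    have "real v powr (1 / \<alpha> + 1) = 2 powr (L * (1 / \<alpha> + 1))" unfolding vL by (rule powr_powr)
    moreover have "2 powr (real n + L * (1 / \<alpha> + 1) + 1) = 2 powr real n * 2 powr (L * (1 / \<alpha> + 1)) * 2 powr 1"
      by (simp only: powr_add)
    ultimately show ?thesis by (simp add: powr_realpow)
  qed
  also have "\<dots> \<le> real v * real v powr (1 / \<alpha> + 1)"
    using \<open>real (2 ^ n) * 2 \<le> real v\<close> by (intro mult_right_mono) auto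
  finally have J: "(2::real) ^ J \<le> real v * real v powr (1 / \<alpha> + 1)" .
  have "real (2 * 2 ^ J + 1) \<le> 2 * 2 * 2 ^ J"
  proof -
    have "(1::real) \<le> 2 ^ J" by (rule one_le_power) simp
    then have "(1::real) \<le> 2 * 2 ^ J" by linarith
    then show ?thesis by simp
  qed
  \<comment> \<open>Each constant 2 is absorbed by a factor v, and 2^J by v^(2 + 1/\<alpha>):
    together the exponent 4 + 1/\<alpha>.\<close>
  also have "\<dots> \<le> real v * real v * (real v * real v powr (1 / \<alpha> + 1))"
    using v1 J by (intro mult_mono) auto
  also have "\<dots> = real v powr 1 * real v powr 1 * (real v powr 1 * real v powr (1 / \<alpha> + 1))" using v1 by simp
  also have "\<dots> = real v powr (4 + 1 / \<alpha>)" unfolding powr_add[symmetric] by (rule arg_cong[where f = "\<lambda>t. real v powr t"]) simp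
  finally have "real (2 * 2 ^ J + 1) ^ d \<le> (real v powr (4 + 1 / \<alpha>)) ^ d" by (intro power_mono) auto
  also have "\<dots> = (real v powr (4 + 1 / \<alpha>)) powr real d" using v1 by (intro powr_realpow[symmetric]) simp
  also have "\<dots> = real v powr (real d * (4 + 1 / \<alpha>))" by (simp add: powr_powr mult.commute)
  finally show "real ((2 * 2 ^ J + 1) ^ d) \<le> real v powr (real d * (4 + 1 / \<alpha>))" by simp
qed

text \<open>Grid and cross are polynomial in v, so each contributes one logarithm with factor c0 +
  2, where 4 \<le> v^2 accounts for the 2; the number of levels contributes 7 log v, and 16 * 7 =
  112.\<close>

lemma sample_size_bound:
  fixes v x g :: nat and c0 m N :: real
  assumes v: "2 \<le> v" and c0: "0 \<le> c0" and x: "0 < x" "real x \<le> real v powr c0" and g: "0 < g" "real g \<le> real v powr c0"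
    and N: "0 \<le> N" "N \<le> 7 * ln (real v)"
    and m: "112 * (2049 * (c0 + 2)\<^sup>2 + 1) * real v * (ln (2 * real v)) ^ 4 \<le> m"
  shows "16 * real v * N * (2049 * ln (4 * real x) * ln (4 * real g) + 1) \<le> m"
proof -
  define L where "L = ln (2 * real v)"
  have L: "1 \<le> L"
  proof -
    have "exp 1 \<le> (4::real)" using exp_le by simp
    then have "ln (exp 1) \<le> ln (2 * real v)" using v by (subst ln_le_cancel_iff) auto
    then show ?thesis by (simp add: L_def)
  qed
  have lnL: "ln (real v) \<le> L" "0 \<le> ln (real v)" using v by (auto simp: L_def)
  have size: "0 \<le> ln (4 * real y) \<and> ln (4 * real y) \<le> (c0 + 2) * L" if "0 < y" "real y \<le> real v powr c0" for y :: nat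
  proof
    show "0 \<le> ln (4 * real y)" using that by simp
    have "2 * 2 \<le> real v * real v" using v by (intro mult_mono) auto
    then have "4 * real y \<le> (real v * real v) * real v powr c0" using that by (intro mult_mono) auto
    also have "\<dots> = real v powr 1 * real v powr 1 * real v powr c0" using v by simp
    also have "\<dots> = real v powr (c0 + 2)" unfolding powr_add[symmetric] by (simp add: add.commute)
    finally have "ln (4 * real y) \<le> ln (real v powr (c0 + 2))" using that v by (subst ln_le_cancel_iff) auto
    also have "\<dots> = (c0 + 2) * ln (real v)" using v by (simp add: ln_powr)
    also have "\<dots> \<le> (c0 + 2) * L" using lnL c0 by (intro mult_left_mono) auto
    finally show "ln (4 * real y) \<le> (c0 + 2) * L" .
  qed
  have "ln (4 * real x) * ln (4 * real g) \<le> ((c0 + 2) * L) * ((c0 + 2) * L)"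
    using size[OF x] size[OF g] by (intro mult_mono) auto
  then have "2049 * ln (4 * real x) * ln (4 * real g) + 1 \<le> 2049 * ((c0 + 2)\<^sup>2 * L\<^sup>2) + 1"
  proof -
    assume "ln (4 * real x) * ln (4 * real g) \<le> (c0 + 2) * L * ((c0 + 2) * L)"
    then have "2049 * (ln (4 * real x) * ln (4 * real g)) \<le> 2049 * ((c0 + 2) * L * ((c0 + 2) * L))" by simp
    moreover have "(c0 + 2) * L * ((c0 + 2) * L) = (c0 + 2)\<^sup>2 * L\<^sup>2" by (simp only: power2_eq_square mult_ac)
    ultimately show ?thesis by (simp only: mult.assoc add_right_mono)
  qed
  also have "\<dots> \<le> (2049 * (c0 + 2)\<^sup>2 + 1) * L\<^sup>2"
    using L by (simp add: distrib_right one_le_power)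
  finally have main: "2049 * ln (4 * real x) * ln (4 * real g) + 1 \<le> (2049 * (c0 + 2)\<^sup>2 + 1) * L\<^sup>2" .
  have "16 * real v * N * (2049 * ln (4 * real x) * ln (4 * real g) + 1) \<le> 16 * real v * (7 * L) * ((2049 * (c0 + 2)\<^sup>2 + 1) * L\<^sup>2)"
    using N lnL main size[OF x] size[OF g] by (intro mult_mono) auto
  also have "\<dots> = 112 * (2049 * (c0 + 2)\<^sup>2 + 1) * real v * L ^ 3" by (simp add: power2_eq_square power3_eq_cube mult_ac)
  also have "\<dots> \<le> 112 * (2049 * (c0 + 2)\<^sup>2 + 1) * real v * L ^ 4"
    using L by (intro mult_left_mono power_increasing) auto
  also have "\<dots> \<le> m" using m by (simp add: L_def)
  finally show ?thesis .
qed

theorem theorem5p2: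
  fixes p a :: real
  assumes "1 < p" "p \<le> 2" "a > 1 / p"
  shows "\<exists>c0 c::real. \<forall>b::real. \<exists>C::real. \<forall>v::nat. v \<ge> 2 \<longrightarrow>
     (\<exists>M::real. real (card (hyp_cross M :: ('d::finite \<Rightarrow> int) set)) \<le> real v powr c0 \<and>
       (\<forall>m::nat. real m \<ge> c * real v * (ln (2 * real v)) ^ 4 \<longrightarrow>
          rho_ls m v (W_class a b p :: (real^'d \<Rightarrow> complex) set) (hyp_cross M) \<le>
          ereal (C * real v powr (- a + 1 / p - 1 / 2) *
             ln (real v) powr ((real CARD('d) - 1) * (a + b + 1 - 2 / p) + 1 / 2))))"
proof -
  define \<alpha> where "\<alpha> = a - 1 / p"
  have \<alpha>: "0 < \<alpha>" using assms by (simp add: \<alpha>_def)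
  define e where "e = CARD('d) - 1"
  have e: "real e = real CARD('d) - 1" by (simp add: e_def of_nat_diff)
  \<comment> \<open>Both c0 and c involve only a, d and p; they are fixed before b is
    introduced.\<close>
  define c0 where "c0 = real CARD('d) * (4 + 1 / \<alpha>)"
  have c0: "0 \<le> c0" using \<alpha> by (simp add: c0_def)
  define c where "c = 112 * (2049 * (c0 + 2)\<^sup>2 + 1)"
  show ?thesis
  proof (rule exI[of _ c0], rule exI[of _ c], rule allI)
    fix b :: real
    define \<beta> where "\<beta> = (real CARD('d) - 1) * (b + 1 - 1 / p)"
    define \<kappa> where "\<kappa> = real e * \<alpha> + \<beta>"
    obtain C1 where C1: "0 < C1" and decay: "\<And>(f :: real^'d \<Rightarrow> complex) j. f \<in> W_class a b p \<Longrightarrow>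
      (\<Sum>k\<in>levset j. cmod (fourier_coeff f k)) \<le> C1 * 2 powr (- \<alpha> * real j) * (real j + 1) powr \<beta>"
      using wiener_decay[OF assms(1,2), where 'd = 'd and a = a and b = b] unfolding \<alpha>_def \<beta>_def by blast
    define \<sigma> where "\<sigma> = 1 - 2 powr - \<alpha>"
    have \<sigma>: "0 < \<sigma>" using \<alpha> by (auto simp: \<sigma>_def intro!: powr_less_one)
    define S where "S = (\<Sum>i. 2 powr (- (\<alpha> / 2) * real i) * (real i + 1) powr \<bar>\<beta>\<bar>)"
    have S: "0 \<le> S" unfolding S_def by (intro suminf_nonneg summable_powr_geometric) (use \<alpha> in auto)
    define D where "D = (2 ^ (e + 2)) powr \<alpha> * (real e + 2) powr \<bar>\<kappa>\<bar>"
    \<comment> \<open>9 comes from least squares, 448 = 64 * 7 from the sampling constant and the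
      bound on \<open>n'\<close>; the bracket bounds B * S without its powers of v and log
      v.\<close>
    define C where "C = 9 * sqrt 448 * (5 * C1 * sqrt (2 / \<sigma>) * D * S)"
    show "\<exists>C::real. \<forall>v::nat. v \<ge> 2 \<longrightarrow>
     (\<exists>M::real. real (card (hyp_cross M :: ('d::finite \<Rightarrow> int) set)) \<le> real v powr c0 \<and>
       (\<forall>m::nat. real m \<ge> c * real v * (ln (2 * real v)) ^ 4 \<longrightarrow>
          rho_ls m v (W_class a b p :: (real^'d \<Rightarrow> complex) set) (hyp_cross M) \<le>
          ereal (C * real v powr (- a + 1 / p - 1 / 2) *
             ln (real v) powr ((real CARD('d) - 1) * (a + b + 1 - 2 / p) + 1 / 2))))"
    proof (rule exI[of _ C], intro allI impI)
      fix v :: nat assume v: "2 \<le> v"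
      obtain n where low: "2 * (2 ^ n * (n + 1) ^ e) \<le> v" and high: "v < 2 * (2 ^ (n + 1) * (n + 2) ^ e)"
        using exists_level[OF v] by blast
      have n2: "2 * 2 ^ n \<le> v"
      proof -
        have "2 ^ n * 1 \<le> 2 ^ n * (n + 1) ^ e" by (intro mult_left_mono) (auto simp: Suc_le_eq)
        then show ?thesis using low by linarith
      qed
      define J where "J = n + nat \<lceil>log 2 (real v) * (1 / \<alpha> + 1)\<rceil>"
      define N where "N j = nat \<lfloor>\<sigma> / 2 * real v * 2 powr (- \<alpha> * (real j - real n))\<rfloor>" for j
      define n' where "n' = nat \<lceil>log 2 (real v)\<rceil> + 2"
      define X where "X = (grid (2 * 2 ^ J + 1) :: (real^'d) set)"
      define G where "G = (hyp_cross (2 ^ J) :: ('d \<Rightarrow> int) set)"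
      define B where "B = 5 * C1 * sqrt (2 / (\<sigma> * real v)) * 2 powr (- \<alpha> * real n) * (real n + 1) powr \<beta>"
      have vJ: "v \<le> 2 ^ J" and JL: "log 2 (real v) \<le> \<alpha> * (real J - real n)"
        and size: "real ((2 * 2 ^ J + 1) ^ CARD('d)) \<le> real v powr c0"
        unfolding J_def c0_def using grid_size_bounds[OF v \<alpha> n2] by auto
      have n': "4 * v \<le> 2 ^ n'" "real n' \<le> 7 * ln (real v)" "0 < n'"
        unfolding n'_def using level_count_bounds[OF v] by auto
      have cardX: "card X = (2 * 2 ^ J + 1) ^ CARD('d)" unfolding X_def by (rule card_grid) simp
      have X: "finite X" "0 < card X" "real (card X) \<le> real v powr c0"
        using size unfolding cardX by (auto simp: X_def)
      have cardG: "real (card G) \<le> real v powr c0"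
        using of_nat_mono[OF card_hyp_cross_le[where 'd = 'd and J = J], where 'a = real] size unfolding G_def by linarith
      have vG: "v \<le> card G" using vJ card_hyp_cross_ge[of J, where 'd = 'd] unfolding G_def by linarith
      have G: "finite G" "0 < card G" using vG v by (auto simp: G_def)
      have bound: "9 * sqrt (64 * real n') * (B * S) \<le> C * real v powr (- a + 1 / p - 1 / 2) *
             ln (real v) powr ((real CARD('d) - 1) * (a + b + 1 - 2 / p) + 1 / 2)"
      proof -
        have lnv: "0 < ln (real v)" using v by simp
        have "sqrt (64 * real n') \<le> sqrt (448 * ln (real v))" using n' by simp
        also have "\<dots> = sqrt 448 * ln (real v) powr (1 / 2)" using lnv by (simp add: real_sqrt_mult powr_half_sqrt)
        finally have 1: "sqrt (64 * real n') \<le> sqrt 448 * ln (real v) powr (1 / 2)" .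
        have "sqrt (2 / (\<sigma> * real v)) = sqrt (2 / \<sigma>) * (1 / sqrt (real v))" by (simp add: real_sqrt_divide real_sqrt_mult)
        also have "1 / sqrt (real v) = real v powr - (1 / 2)" by (simp add: powr_minus_divide powr_half_sqrt)
        finally have 2: "sqrt (2 / (\<sigma> * real v)) = sqrt (2 / \<sigma>) * real v powr - (1 / 2)" .
        have "B = 5 * C1 * sqrt (2 / \<sigma>) * real v powr - (1 / 2) * (2 powr (- \<alpha> * real n) * (real n + 1) powr \<beta>)"
          unfolding B_def 2 by (simp only: mult_ac)
        also have "\<dots> \<le> 5 * C1 * sqrt (2 / \<sigma>) * real v powr - (1 / 2) * (D * real v powr - \<alpha> * ln (real v) powr \<kappa>)"
          unfolding D_def \<kappa>_def using C1 \<sigma> by (intro mult_left_mono level_rate[OF \<alpha> low high]) auto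
        finally have 3: "B \<le> 5 * C1 * sqrt (2 / \<sigma>) * real v powr - (1 / 2) * (D * real v powr - \<alpha> * ln (real v) powr \<kappa>)" .
        have "9 * sqrt (64 * real n') * (B * S) \<le> 9 * (sqrt 448 * ln (real v) powr (1 / 2)) *
            ((5 * C1 * sqrt (2 / \<sigma>) * real v powr - (1 / 2) * (D * real v powr - \<alpha> * ln (real v) powr \<kappa>)) * S)"
          using S C1 \<sigma> by (intro mult_mono mult_left_mono mult_right_mono 1 3) (auto simp: B_def)
        also have "\<dots> = C * (real v powr - \<alpha> * real v powr - (1 / 2)) * (ln (real v) powr \<kappa> * ln (real v) powr (1 / 2))"
          unfolding C_def by (simp only: mult_ac)
        also have "\<dots> = C * real v powr (- \<alpha> + - (1 / 2)) * ln (real v) powr (\<kappa> + 1 / 2)"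
          by (simp only: powr_add)
        also have "- \<alpha> + - (1 / 2) = - a + 1 / p - 1 / 2" by (simp add: \<alpha>_def)
        \<comment> \<open>Here (d-1)(a - 1/p) from the choice of n and (d-1)(b + 1 - 1/p) from the
          layer estimate combine to the stated exponent; the extra 1/2 is the sampling loss.\<close>
        also have "\<kappa> = (real CARD('d) - 1) * (a + b + 1 - 2 / p)"
          unfolding \<kappa>_def \<beta>_def e \<alpha>_def using assms(1) by (simp add: field_simps)
        finally show ?thesis .
      qed
      show "\<exists>M::real. real (card (hyp_cross M :: ('d::finite \<Rightarrow> int) set)) \<le> real v powr c0 \<and>
       (\<forall>m::nat. real m \<ge> c * real v * (ln (2 * real v)) ^ 4 \<longrightarrow>
          rho_ls m v (W_class a b p :: (real^'d \<Rightarrow> complex) set) (hyp_cross M) \<le>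
          ereal (C * real v powr (- a + 1 / p - 1 / 2) *
             ln (real v) powr ((real CARD('d) - 1) * (a + b + 1 - 2 / p) + 1 / 2)))"
      proof (rule exI[of _ "2 ^ J"], intro conjI allI impI)
        show "real (card (hyp_cross (2 ^ J) :: ('d::finite \<Rightarrow> int) set)) \<le> real v powr c0"
          using cardG by (simp add: G_def)
        fix m :: nat assume m: "c * real v * (ln (2 * real v)) ^ 4 \<le> real m"
        have m': "16 * real v * real n' * (2049 * ln (4 * real (card X)) * ln (4 * real (card G)) + 1) \<le> real m"
          by (rule sample_size_bound[OF v c0 X(2,3) G(2) cardG _ n'(2)]) (use m in \<open>simp_all add: c_def\<close>)
        have m0: "0 < m"
        proof -
          have "0 < c * real v * (ln (2 * real v)) ^ 4" using v by (auto simp: c_def add_nonneg_pos)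
          then show ?thesis using m by linarith
        qed
        have "\<exists>\<xi>. (\<forall>j<m. \<xi> j \<in> X) \<and> (\<forall>K c. K \<subseteq> G \<longrightarrow> card K \<le> v \<longrightarrow>
           (\<Sum>k\<in>K. (cmod (c k))\<^sup>2) \<le> 64 * real n' * ((1 / real m) * (\<Sum>j<m. (cmod (\<Sum>k\<in>K. c k * expk k (\<xi> j)))\<^sup>2)))"
        proof (rule sparse_lower_discretization)
          show "G \<noteq> {}" "X \<noteq> {}" using G X by auto
          fix K :: "('d \<Rightarrow> int) set" and c assume K: "K \<subseteq> G"
          show "(\<Sum>x\<in>X. (cmod (\<Sum>k\<in>K. c k * expk k x))\<^sup>2) = real (card X) * (\<Sum>k\<in>K. (cmod (c k))\<^sup>2)"
            unfolding X_def tpoly_def[symmetric]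
          proof (rule grid_parseval)
            show "finite K" using K G finite_subset by blast
            fix k l i assume "k \<in> K" "l \<in> K"
            then have "\<bar>k i\<bar> \<le> 2 ^ J" "\<bar>l i\<bar> \<le> 2 ^ J"
              using K by (auto simp: G_def intro!: hyp_cross_coord)
            then show "\<bar>k i - l i\<bar> < int (2 * 2 ^ J + 1)" by simp
          qed simp
        qed (use v n' m' G X in auto)
        then obtain \<xi> where \<xi>: "\<And>j. j < m \<Longrightarrow> \<xi> j \<in> X" and rip: "\<And>K c. K \<subseteq> G \<Longrightarrow> card K \<le> v \<Longrightarrow>
           (\<Sum>k\<in>K. (cmod (c k))\<^sup>2) \<le> 64 * real n' * ((1 / real m) * (\<Sum>j<m. (cmod (tpoly K c (\<xi> j)))\<^sup>2))"
          unfolding tpoly_def by blast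
        have main: "\<exists>K\<in>X_v v G. \<forall>u\<in>LS_set m \<xi> (trig_span K) f. Lq_norm 2 (\<lambda>x. f x - u x) \<le> 9 * sqrt (64 * real n') * (B * S)"
          if f: "f \<in> W_class a b p" for f :: "real^'d \<Rightarrow> complex"
        proof -
          have nJ: "n \<le> J" by (simp add: J_def)
          have "0 \<le> (\<Sum>k\<in>levset j. cmod (fourier_coeff f k))" for j by (intro sum_nonneg) simp
          note errs = level_errors[OF \<alpha> _ _ nJ this decay[OF f] JL]
          show ?thesis unfolding G_def
          proof (rule least_squares_error)
            show "periodic_cont f" using f by (simp add: W_class_def)
            show "(\<Sum>j<n. card (levset j :: ('d \<Rightarrow> int) set)) + (\<Sum>j=n..<J. N j) \<le> v"
              unfolding N_def \<sigma>_def by (rule sparsity_budget[OF \<alpha>]) (use low in \<open>simp add: e_def\<close>)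
            show "summable (\<lambda>j. \<Sum>k\<in>levset j. cmod (fourier_coeff f k))" using errs(1) C1 v by simp
            show "(\<Sum>j=n..<J. 3 * (\<Sum>k\<in>levset j. cmod (fourier_coeff f k)) / sqrt (max 1 (real (N j)))) \<le> B * S"
              using errs(2) C1 v by (simp add: N_def \<sigma>_def B_def S_def)
            show "(\<Sum>j. \<Sum>k\<in>levset (j + J). cmod (fourier_coeff f k)) \<le> B * S"
              using errs(3) C1 v by (simp add: N_def \<sigma>_def B_def S_def)
          qed (use m0 \<xi> rip nJ vG n' in \<open>auto simp: X_def G_def\<close>)
        qed
        have "rho_ls m v (W_class a b p :: (real^'d \<Rightarrow> complex) set) G \<le> ereal (9 * sqrt (64 * real n') * (B * S))"
          unfolding rho_ls_def
        \<comment> \<open>The same points are used for every f; only the frequency set K is chosen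
          afterwards.\<close>
        proof (rule INF_lower2[of \<xi>])
          have "x \<in> torus" if "x \<in> X" for x using that unfolding X_def by (rule grid_torus[rotated]) simp
          then show "\<xi> \<in> {\<xi>. \<forall>j<m. \<xi> j \<in> torus}" using \<xi> by simp
          show "(SUP f\<in>W_class a b p. INF K\<in>X_v v G. SUP u\<in>LS_set m \<xi> (trig_span K) f. ereal (Lq_norm 2 (\<lambda>x. f x - u x)))
             \<le> ereal (9 * sqrt (64 * real n') * (B * S))"
          proof (rule SUP_least)
            fix f :: "real^'d \<Rightarrow> complex" assume "f \<in> W_class a b p"
            from main[OF this] obtain K where "K \<in> X_v v G"
              "\<forall>u\<in>LS_set m \<xi> (trig_span K) f. Lq_norm 2 (\<lambda>x. f x - u x) \<le> 9 * sqrt (64 * real n') * (B * S)" by blast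
            then show "(INF K\<in>X_v v G. SUP u\<in>LS_set m \<xi> (trig_span K) f. ereal (Lq_norm 2 (\<lambda>x. f x - u x)))
               \<le> ereal (9 * sqrt (64 * real n') * (B * S))"
              by (intro INF_lower2[of K] SUP_least) auto
          qed
        qed
        then show "rho_ls m v (W_class a b p :: (real^'d \<Rightarrow> complex) set) (hyp_cross (2 ^ J)) \<le>
          ereal (C * real v powr (- a + 1 / p - 1 / 2) *
             ln (real v) powr ((real CARD('d) - 1) * (a + b + 1 - 2 / p) + 1 / 2))"
          unfolding G_def using bound by (meson ereal_less_eq(3) order.trans)
      qed
    qed
  qed
qed

end
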